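(* There exists a unique (up to isomorphism of functors) colimit-preserving functor $$\mathbb T:\square_S^{op}\mathbf{Set}\downarrow{!^S\Sigma}\longrightarrow\mathbf{WHDTS}$$ from labelled symmetric precubical sets to weak higher dimensional transition systems extending the functor $\mathbb T$ defined on the full subcategory of labelled cubes by $\mathbb T(\square_S[a_1,\dots,a_n])=C_n[a_1,\dots,a_n]$ and by $f\mapsto\mathbb T(f)$ on maps of labelled cubes. Moreover, this functor is a left adjoint.
   Context: $\Sigma$ is a fixed nonempty set of labels. A weak higher dimensional transition system is a triple $(S,\mu:L\to\Sigma,T=\bigcup_{n\ge1}T_n)$ with $S$ a set (states), $L$ a set (actions), $\mu$ a set map (labelling map) and $T_n\subset S\times L^n\times S$ ($n$-transitions) such that: - (Multiset axiom) for every permutation $\sigma$ of $\{1,\dots,n\}$, $n\ge2$, if $(\alpha,u_1,\dots,u_n,\beta)\in T$ then $(\alpha,u_{\sigma(1)},\dots,u_{\sigma(n)},\beta)\in T$; - (Coherence axiom) for $n\ge3$, $p,q\ge1$ with $p+q<n$, if $(\alpha,u_1,\dots,u_n,\beta)$, $(\alpha,u_1,\dots,u_p,\nu_1)$, $(\nu_1,u_{p+1},\dots,u_n,\beta)$, $(\alpha,u_1,\dots,u_{p+q},\nu_2)$, $(\nu_2,u_{p+q+1},\dots,u_n,\beta)$ are transitions, then $(\nu_1,u_{p+1},\dots,u_{p+q},\nu_2)$ is a transition. A morphism $f$ consists of a map $f_0$ on states and a map $\widetilde f$ on actions commuting with the labelling maps, such that $(f_0(\alpha),\widetilde f(u_1),\dots,\widetilde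 f(u_n),f_0(\beta))$ is a transition whenever $(\alpha,u_1,\dots,u_n,\beta)$ is. The category is $\mathbf{WHDTS}$. $C_n[a_1,\dots,a_n]$ ($n\ge0$, $a_i\in\Sigma$) has set of states $\{0,1\}^n$ (a singleton for $n=0$), set of actions $\{(a_1,1),\dots,(a_n,n)\}$, labelling $\mu(a_i,i)=a_i$, and its $d$-transitions ($d\ge1$) are the tuples $((\epsilon_1,\dots,\epsilon_n),(a_{i_1},i_1),\dots,(a_{i_d},i_d),(\epsilon_1',\dots,\epsilon_n'))$ with $i_1,\dots,i_d$ pairwise distinct, $\epsilon_i\le\epsilon_i'$ for all $i$, and $\epsilon_i\ne\epsilon_i'$ iff $i\in\{i_1,\dots,i_d\}$. $\square_S$ is the category with objects $[n]=\{0,1\}^n$, $n\ge0$, whose morphisms are the set maps generated by the face maps $\delta_i^\alpha(\epsilon_1,\dots,\epsilon_{n-1})=(\epsilon_1,\dots,\epsilon_{i-1},\alpha,\epsilon_i,\dots,\epsilon_{n-1})$ ($\alpha\in\{0,1\}$) and the symmetry maps $\sigma_i:[n]\to[n]$ exchanging coordinates $i$ and $i+1$. A symmetric precubical set is a presheaf on $\square_S$; $\square_S[n]=\square_S(-,[n])$. The symmetric precubical set $!^S\Sigma$ has $(!^S\Sigma)_n=\Sigma^n$, where $(\delta_i^0)^*=(\delta_i^1)^*$ removes the $i$-th letter and $\sigma_i^*$ exchanges letters $i$ and $i+1$. A labelled symmetric precubical set is an object of the comma category $\square_S^{op}\mathbf{Set}\downarrow{!^S\Sigma}$. The labelled cube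 $\square_S[a_1,\dots,a_n]$ is $\square_S[n]\to{!^S\Sigma}$ corresponding to $(a_1,\dots,a_n)\in\Sigma^n$. For a map of labelled cubes $f:\square_S[a_1,\dots,a_m]\to\square_S[b_1,\dots,b_n]$, with underlying map $f_0:[m]\to[n]$ of $\square_S$, there is a unique set map $\widehat f:\{1,\dots,n\}\to\{1,\dots,m\}\cup\{-\infty,+\infty\}$ with $f_0(\epsilon_1,\dots,\epsilon_m)=(\epsilon_{\widehat f(1)},\dots,\epsilon_{\widehat f(n)})$ for all $(\epsilon_1,\dots,\epsilon_m)\in[m]$ (with $\epsilon_{-\infty}=0$, $\epsilon_{+\infty}=1$); it restricts to a bijection $\overline f:\widehat f^{-1}(\{1,\dots,m\})\to\{1,\dots,m\}$ and $a_i=b_{\overline f^{-1}(i)}$. The map $\mathbb T(f):C_m[a_1,\dots,a_m]\to C_n[b_1,\dots,b_n]$ is $f_0$ on states and $(a_i,i)\mapsto(a_i,\overline f^{-1}(i))$ on actions. *)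

theory Defs
  imports "HOL-Library.FuncSet" "HOL-Combinatorics.Permutations"
begin

section \<open>Categories, functors, colimits, adjunctions\<close>

text \<open>
  \<open>Comp C g f\<close> is the composite of \<open>f\<close> followed by \<open>g\<close>; it is only meaningful when
  \<open>Cod C f = Dom C g\<close>.
\<close>

record ('o, 'a) category =
  Ob :: "'o set"
  Arr :: "'a set"
  Dom :: "'a \<Rightarrow> 'o"
  Cod :: "'a \<Rightarrow> 'o"
  Id :: "'o \<Rightarrow> 'a"
  Comp :: "'a \<Rightarrow> 'a \<Rightarrow> 'a"

definition Hom :: "('o, 'a) category \<Rightarrow> 'o \<Rightarrow> 'o \<Rightarrow> 'a set" where
  "Hom C X Y = {f \<in> Arr C. Dom C f = X \<and> Cod C f = Y}"

definition is_category :: "('o, 'a) category \<Rightarrow> bool" where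
  "is_category C \<longleftrightarrow>
     (\<forall>f\<in>Arr C. Dom C f \<in> Ob C \<and> Cod C f \<in> Ob C) \<and>
     (\<forall>X\<in>Ob C. Id C X \<in> Hom C X X) \<and>
     (\<forall>X Y Z. \<forall>f\<in>Hom C X Y. \<forall>g\<in>Hom C Y Z. Comp C g f \<in> Hom C X Z) \<and>
     (\<forall>X Y. \<forall>f\<in>Hom C X Y. Comp C f (Id C X) = f \<and> Comp C (Id C Y) f = f) \<and>
     (\<forall>W X Y Z. \<forall>f\<in>Hom C W X. \<forall>g\<in>Hom C X Y. \<forall>h\<in>Hom C Y Z.
        Comp C h (Comp C g f) = Comp C (Comp C h g) f)"

record ('o, 'a, 'p, 'b) fctr =
  FOb :: "'o \<Rightarrow> 'p"
  FArr :: "'a \<Rightarrow> 'b"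

definition is_functor ::
  "('o, 'a) category \<Rightarrow> ('p, 'b) category \<Rightarrow> ('o, 'a, 'p, 'b) fctr \<Rightarrow> bool" where
  "is_functor C E F \<longleftrightarrow>
     (\<forall>X\<in>Ob C. FOb F X \<in> Ob E) \<and>
     (\<forall>X Y. \<forall>f\<in>Hom C X Y. FArr F f \<in> Hom E (FOb F X) (FOb F Y)) \<and>
     (\<forall>X\<in>Ob C. FArr F (Id C X) = Id E (FOb F X)) \<and>
     (\<forall>X Y Z. \<forall>f\<in>Hom C X Y. \<forall>g\<in>Hom C Y Z.
        FArr F (Comp C g f) = Comp E (FArr F g) (FArr F f))"

definition fctr_comp ::
  "('p, 'b, 'q, 'c) fctr \<Rightarrow> ('o, 'a, 'p, 'b) fctr \<Rightarrow> ('o, 'a, 'q, 'c) fctr" where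
  "fctr_comp G F = \<lparr>FOb = (\<lambda>X. FOb G (FOb F X)), FArr = (\<lambda>f. FArr G (FArr F f))\<rparr>"

definition is_iso :: "('o, 'a) category \<Rightarrow> 'o \<Rightarrow> 'o \<Rightarrow> 'a \<Rightarrow> bool" where
  "is_iso C X Y f \<longleftrightarrow> f \<in> Hom C X Y \<and>
     (\<exists>g\<in>Hom C Y X. Comp C g f = Id C X \<and> Comp C f g = Id C Y)"

definition naturally_isomorphic ::
  "('o, 'a) category \<Rightarrow> ('p, 'b) category \<Rightarrow>
   ('o, 'a, 'p, 'b) fctr \<Rightarrow> ('o, 'a, 'p, 'b) fctr \<Rightarrow> bool" where
  "naturally_isomorphic C E F G \<longleftrightarrow>
     (\<exists>t. (\<forall>X\<in>Ob C. is_iso E (FOb F X) (FOb G X) (t X)) \<and>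
          (\<forall>X Y. \<forall>f\<in>Hom C X Y. Comp E (t Y) (FArr F f) = Comp E (FArr G f) (t X)))"

definition is_cocone ::
  "('j, 'k) category \<Rightarrow> ('o, 'a) category \<Rightarrow> ('j, 'k, 'o, 'a) fctr \<Rightarrow>
   'o \<Rightarrow> ('j \<Rightarrow> 'a) \<Rightarrow> bool" where
  "is_cocone J C D c l \<longleftrightarrow>
     c \<in> Ob C \<and>
     (\<forall>i\<in>Ob J. l i \<in> Hom C (FOb D i) c) \<and>
     (\<forall>i j. \<forall>f\<in>Hom J i j. Comp C (l j) (FArr D f) = l i)"

definition is_colimit ::
  "('j, 'k) category \<Rightarrow> ('o, 'a) category \<Rightarrow> ('j, 'k, 'o, 'a) fctr \<Rightarrow>
   'o \<Rightarrow> ('j \<Rightarrow> 'a) \<Rightarrow> bool" where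
  "is_colimit J C D c l \<longleftrightarrow>
     is_cocone J C D c l \<and>
     (\<forall>d m. is_cocone J C D d m \<longrightarrow>
        (\<exists>!h. h \<in> Hom C c d \<and> (\<forall>i\<in>Ob J. Comp C h (l i) = m i)))"

definition is_left_adjoint_of ::
  "('o, 'a) category \<Rightarrow> ('p, 'b) category \<Rightarrow>
   ('o, 'a, 'p, 'b) fctr \<Rightarrow> ('p, 'b, 'o, 'a) fctr \<Rightarrow> bool" where
  "is_left_adjoint_of C E F G \<longleftrightarrow>
     (\<exists>\<phi>. (\<forall>X\<in>Ob C. \<forall>Y\<in>Ob E. bij_betw (\<phi> X Y) (Hom E (FOb F X) Y) (Hom C X (FOb G Y))) \<and>
          (\<forall>X\<in>Ob C. \<forall>X'\<in>Ob C. \<forall>Y\<in>Ob E. \<forall>Y'\<in>Ob E.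
             \<forall>f\<in>Hom C X' X. \<forall>g\<in>Hom E Y Y'. \<forall>h\<in>Hom E (FOb F X) Y.
               \<phi> X' Y' (Comp E g (Comp E h (FArr F f))) =
                 Comp C (FArr G g) (Comp C (\<phi> X Y h) f)))"

definition is_left_adjoint ::
  "('o, 'a) category \<Rightarrow> ('p, 'b) category \<Rightarrow> ('o, 'a, 'p, 'b) fctr \<Rightarrow> bool" where
  "is_left_adjoint C E F \<longleftrightarrow>
     is_functor C E F \<and> (\<exists>G. is_functor E C G \<and> is_left_adjoint_of C E F G)"


section \<open>Small sets\<close>

text \<open>
  The category of sets is represented by a family \<open>U\<close> of ``small'' subsets of a type,
  containing an infinite set and closed under subsets, replacement and small unions. If the
  type has the cardinality of a Grothendieck universe and \<open>U\<close> consists of the subsets of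
  strictly smaller cardinality, this is, up to equivalence, the usual category of sets;
  \<open>U = UNIV\<close> is always an instance when the type is infinite. Closure under power sets is
  not required.
\<close>

definition universe :: "'e set set \<Rightarrow> bool" where
  "universe U \<longleftrightarrow>
     (\<exists>A\<in>U. infinite A) \<and>
     (\<forall>A\<in>U. \<forall>B. B \<subseteq> A \<longrightarrow> B \<in> U) \<and>
     (\<forall>A\<in>U. \<forall>f. f ` A \<in> U) \<and>
     (\<forall>A\<in>U. \<forall>X. (\<forall>i\<in>A. X i \<in> U) \<longrightarrow> (\<Union>i\<in>A. X i) \<in> U)"

text \<open>
  The type from which all sets draw their elements: arbitrary atoms, together with the vertices
  of cubes, the actions \<open>(a, i)\<close>, the words over \<open>\<Sigma>\<close> and the morphisms of \<open>\<box>\<^sub>S\<close>, so that the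
  objects \<open>C\<^sub>n[a\<^sub>1,\<dots>,a\<^sub>n]\<close>, \<open>!\<^sup>S\<Sigma>\<close> and \<open>\<box>\<^sub>S[n]\<close> can be formed literally.
\<close>

datatype 'x elem =
    Atom 'x
  | Vertex "bool list"
  | Indexed "'x elem" nat
  | Word "'x elem list"
  | CubeMap "bool list \<Rightarrow> bool list"

text \<open>
  A functor preserves colimits if it preserves every colimit, existing in the source, of a
  diagram indexed by a small category.
\<close>

definition preserves_colimits ::
  "'e set set \<Rightarrow> ('o, 'a) category \<Rightarrow> ('p, 'b) category \<Rightarrow> ('o, 'a, 'p, 'b) fctr \<Rightarrow> bool" where
  "preserves_colimits U C E F \<longleftrightarrow>
     (\<forall>(J :: ('e, 'e) category) D c l.
        is_category J \<and> Ob J \<in> U \<and> Arr J \<in> U \<and> is_functor J C D \<and> is_colimit J C D c l \<longrightarrow>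
        is_colimit J E (fctr_comp F D) (FOb F c) (\<lambda>i. FArr F (l i)))"


section \<open>Weak higher dimensional transition systems\<close>

text \<open>
  An \<open>n\<close>-transition \<open>(\<alpha>, u\<^sub>1, \<dots>, u\<^sub>n, \<beta>)\<close> is the triple of \<open>\<alpha>\<close>, the list of length \<open>n\<close> of
  the \<open>u\<^sub>i\<close>, and \<open>\<beta>\<close>. Here and below, set maps are represented by functions that are
  \<open>undefined\<close> outside their domain, so that equality of maps is equality of functions.
\<close>

record 'e whdts =
  States :: "'e set"
  Actions :: "'e set"
  Labelling :: "'e \<Rightarrow> 'e"
  Trans :: "('e \<times> 'e list \<times> 'e) set"

definition is_whdts :: "'e set set \<Rightarrow> 'e set \<Rightarrow> 'e whdts \<Rightarrow> bool" where
  "is_whdts U \<Sigma> X \<longleftrightarrow>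
     States X \<in> U \<and> Actions X \<in> U \<and>
     Labelling X \<in> Actions X \<rightarrow>\<^sub>E \<Sigma> \<and>
     Trans X \<subseteq> {(\<alpha>, us, \<beta>). \<alpha> \<in> States X \<and> \<beta> \<in> States X \<and> us \<noteq> [] \<and> set us \<subseteq> Actions X} \<and>
     (\<forall>\<alpha> us \<beta> \<sigma>. length us \<ge> 2 \<and> \<sigma> permutes {..<length us} \<and> (\<alpha>, us, \<beta>) \<in> Trans X \<longrightarrow>
        (\<alpha>, permute_list \<sigma> us, \<beta>) \<in> Trans X) \<and>
     (\<forall>\<alpha> us \<beta> p q \<nu>1 \<nu>2.
        length us \<ge> 3 \<and> p \<ge> 1 \<and> q \<ge> 1 \<and> p + q < length us \<and>
        (\<alpha>, us, \<beta>) \<in> Trans X \<and>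
        (\<alpha>, take p us, \<nu>1) \<in> Trans X \<and> (\<nu>1, drop p us, \<beta>) \<in> Trans X \<and>
        (\<alpha>, take (p + q) us, \<nu>2) \<in> Trans X \<and> (\<nu>2, drop (p + q) us, \<beta>) \<in> Trans X \<longrightarrow>
        (\<nu>1, take q (drop p us), \<nu>2) \<in> Trans X)"

definition whdts_map :: "'e whdts \<Rightarrow> 'e whdts \<Rightarrow> ('e \<Rightarrow> 'e) \<times> ('e \<Rightarrow> 'e) \<Rightarrow> bool" where
  "whdts_map X Y f \<longleftrightarrow>
     fst f \<in> States X \<rightarrow>\<^sub>E States Y \<and>
     snd f \<in> Actions X \<rightarrow>\<^sub>E Actions Y \<and>
     (\<forall>u\<in>Actions X. Labelling Y (snd f u) = Labelling X u) \<and>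
     (\<forall>(\<alpha>, us, \<beta>)\<in>Trans X. (fst f \<alpha>, map (snd f) us, fst f \<beta>) \<in> Trans Y)"

type_synonym 'e whdts_arrow = "'e whdts \<times> (('e \<Rightarrow> 'e) \<times> ('e \<Rightarrow> 'e)) \<times> 'e whdts"

definition WHDTS :: "'e set set \<Rightarrow> 'e set \<Rightarrow> ('e whdts, 'e whdts_arrow) category" where
  "WHDTS U \<Sigma> =
     \<lparr>Ob = {X. is_whdts U \<Sigma> X},
      Arr = {(X, f, Y). is_whdts U \<Sigma> X \<and> is_whdts U \<Sigma> Y \<and> whdts_map X Y f},
      Dom = (\<lambda>(X, f, Y). X),
      Cod = (\<lambda>(X, f, Y). Y),
      Id = (\<lambda>X. (X, (\<lambda>s\<in>States X. s, \<lambda>u\<in>Actions X. u), X)),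
      Comp = (\<lambda>(Y, g, Z) (X, f, Y').
        (X, (compose (States X) (fst g) (fst f), compose (Actions X) (snd g) (snd f)), Z))\<rparr>"


section \<open>Symmetric precubical sets\<close>

definition cube :: "nat \<Rightarrow> bool list set" where
  "cube n = {\<epsilon>. length \<epsilon> = n}"

text \<open>The face map \<open>\<delta>\<^sub>i\<^sup>\<alpha> : [n] \<rightarrow> [n + 1]\<close> for \<open>1 \<le> i \<le> n + 1\<close>.\<close>

definition face :: "nat \<Rightarrow> nat \<Rightarrow> bool \<Rightarrow> bool list \<Rightarrow> bool list" where
  "face n i \<alpha> = (\<lambda>\<epsilon>\<in>cube n. take (i - 1) \<epsilon> @ \<alpha> # drop (i - 1) \<epsilon>)"

text \<open>The symmetry map \<open>\<sigma>\<^sub>i : [n] \<rightarrow> [n]\<close> for \<open>1 \<le> i < n\<close>; lists are indexed from \<open>0\<close>.\<close>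

definition symmetry :: "nat \<Rightarrow> nat \<Rightarrow> bool list \<Rightarrow> bool list" where
  "symmetry n i = (\<lambda>\<epsilon>\<in>cube n. \<epsilon>[i - 1 := \<epsilon> ! i, i := \<epsilon> ! (i - 1)])"

text \<open>\<open>cube_map m n f\<close>: \<open>f\<close> is a morphism from \<open>[m]\<close> to \<open>[n]\<close> in \<open>\<box>\<^sub>S\<close>.\<close>

inductive cube_map :: "nat \<Rightarrow> nat \<Rightarrow> (bool list \<Rightarrow> bool list) \<Rightarrow> bool" where
  cube_map_id: "cube_map n n (\<lambda>\<epsilon>\<in>cube n. \<epsilon>)"
| cube_map_face: "1 \<le> i \<Longrightarrow> i \<le> Suc n \<Longrightarrow> cube_map n (Suc n) (face n i \<alpha>)"
| cube_map_symmetry: "1 \<le> i \<Longrightarrow> i < n \<Longrightarrow> cube_map n n (symmetry n i)"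
| cube_map_comp: "cube_map l m f \<Longrightarrow> cube_map m n g \<Longrightarrow> cube_map l n (compose (cube l) g f)"

text \<open>
  For \<open>f : [m] \<rightarrow> [n]\<close> in \<open>\<box>\<^sub>S\<close>, \<open>hat m n f\<close> is the map
  \<open>{1,\<dots>,n} \<rightarrow> {1,\<dots>,m} \<union> {-\<infinity>, +\<infinity>}\<close> describing the coordinates of \<open>f\<close>, and \<open>position m n f\<close> is
  the inverse of the bijection to which it restricts.
\<close>

datatype coord = MinusInf | Coord nat | PlusInf

fun coord_value :: "bool list \<Rightarrow> coord \<Rightarrow> bool" where
  "coord_value \<epsilon> MinusInf = False"
| "coord_value \<epsilon> PlusInf = True"
| "coord_value \<epsilon> (Coord i) = \<epsilon> ! (i - 1)"

definition coordinates ::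
  "nat \<Rightarrow> nat \<Rightarrow> (bool list \<Rightarrow> bool list) \<Rightarrow> (nat \<Rightarrow> coord) \<Rightarrow> bool" where
  "coordinates m n f h \<longleftrightarrow>
     h \<in> {1..n} \<rightarrow>\<^sub>E Coord ` {1..m} \<union> {MinusInf, PlusInf} \<and>
     (\<forall>\<epsilon>\<in>cube m. f \<epsilon> = map (\<lambda>j. coord_value \<epsilon> (h j)) [1..<Suc n])"

definition hat :: "nat \<Rightarrow> nat \<Rightarrow> (bool list \<Rightarrow> bool list) \<Rightarrow> nat \<Rightarrow> coord" where
  "hat m n f = (THE h. coordinates m n f h)"

definition position :: "nat \<Rightarrow> nat \<Rightarrow> (bool list \<Rightarrow> bool list) \<Rightarrow> nat \<Rightarrow> nat" where
  "position m n f i =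
     the_inv_into {j \<in> {1..n}. hat m n f j \<in> Coord ` {1..m}} (hat m n f) (Coord i)"

text \<open>
  A symmetric precubical set is a contravariant functor from \<open>\<box>\<^sub>S\<close> to small sets;
  \<open>Act K m n f : K\<^sub>n \<rightarrow> K\<^sub>m\<close> is the image of \<open>f : [m] \<rightarrow> [n]\<close>.
\<close>

record 'e spset =
  Cells :: "nat \<Rightarrow> 'e set"
  Act :: "nat \<Rightarrow> nat \<Rightarrow> (bool list \<Rightarrow> bool list) \<Rightarrow> 'e \<Rightarrow> 'e"

definition is_spset :: "'e set set \<Rightarrow> 'e spset \<Rightarrow> bool" where
  "is_spset U K \<longleftrightarrow>
     (\<forall>n. Cells K n \<in> U) \<and>
     (\<forall>m n f. cube_map m n f \<longrightarrow> Act K m n f \<in> Cells K n \<rightarrow>\<^sub>E Cells K m) \<and>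
     (\<forall>m n f. \<not> cube_map m n f \<longrightarrow> Act K m n f = undefined) \<and>
     (\<forall>n. Act K n n (\<lambda>\<epsilon>\<in>cube n. \<epsilon>) = (\<lambda>x\<in>Cells K n. x)) \<and>
     (\<forall>l m n f g. cube_map l m f \<and> cube_map m n g \<longrightarrow>
        Act K l n (compose (cube l) g f) = compose (Cells K n) (Act K l m f) (Act K m n g))"

definition spset_map :: "'e spset \<Rightarrow> 'e spset \<Rightarrow> (nat \<Rightarrow> 'e \<Rightarrow> 'e) \<Rightarrow> bool" where
  "spset_map K K' \<phi> \<longleftrightarrow>
     (\<forall>n. \<phi> n \<in> Cells K n \<rightarrow>\<^sub>E Cells K' n) \<and>
     (\<forall>m n f. cube_map m n f \<longrightarrow>
        (\<forall>x\<in>Cells K n. \<phi> m (Act K m n f x) = Act K' m n f (\<phi> n x)))"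

definition spset_id :: "'e spset \<Rightarrow> nat \<Rightarrow> 'e \<Rightarrow> 'e" where
  "spset_id K = (\<lambda>n. \<lambda>x\<in>Cells K n. x)"

definition spset_comp ::
  "'e spset \<Rightarrow> (nat \<Rightarrow> 'e \<Rightarrow> 'e) \<Rightarrow> (nat \<Rightarrow> 'e \<Rightarrow> 'e) \<Rightarrow> nat \<Rightarrow> 'e \<Rightarrow> 'e" where
  "spset_comp K \<psi> \<phi> = (\<lambda>n. compose (Cells K n) (\<psi> n) (\<phi> n))"

text \<open>The representable \<open>\<box>\<^sub>S[n]\<close>.\<close>

definition representable :: "nat \<Rightarrow> 'x elem spset" where
  "representable n =
     \<lparr>Cells = (\<lambda>m. CubeMap ` {f. cube_map m n f}),
      Act = (\<lambda>l m g. if cube_map l m g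
        then (\<lambda>x\<in>CubeMap ` {f. cube_map m n f}.
                case x of CubeMap f \<Rightarrow> CubeMap (compose (cube l) f g))
        else undefined)\<rparr>"

text \<open>
  The \<open>n\<close>-cells of \<open>!\<^sup>S\<Sigma>\<close> are the words of length \<open>n\<close>. A morphism \<open>f : [m] \<rightarrow> [n]\<close> takes
  \<open>a\<^sub>1\<dots>a\<^sub>n\<close> to the word of length \<open>m\<close> whose \<open>i\<close>-th letter is \<open>a\<^sub>j\<close> for the coordinate \<open>j\<close> of the
  target along which the \<open>i\<close>-th coordinate of the source is sent. The lemmas
  \<open>word_act_face\<close> and \<open>word_act_symmetry\<close> below show that this removes the \<open>i\<close>-th letter for
  \<open>\<delta>\<^sub>i\<^sup>\<alpha>\<close> and exchanges letters \<open>i\<close> and \<open>i + 1\<close> for \<open>\<sigma>\<^sub>i\<close>, and \<open>is_spset_bang\<close> that it is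
  functorial.
\<close>

definition word_act :: "nat \<Rightarrow> nat \<Rightarrow> (bool list \<Rightarrow> bool list) \<Rightarrow> 'e list \<Rightarrow> 'e list" where
  "word_act m n f w = map (\<lambda>i. w ! (position m n f i - 1)) [1..<Suc m]"

definition bang :: "'x elem set \<Rightarrow> 'x elem spset" where
  "bang \<Sigma> =
     \<lparr>Cells = (\<lambda>n. Word ` {w. length w = n \<and> set w \<subseteq> \<Sigma>}),
      Act = (\<lambda>m n f. if cube_map m n f
        then (\<lambda>x\<in>Word ` {w. length w = n \<and> set w \<subseteq> \<Sigma>}.
                case x of Word w \<Rightarrow> Word (word_act m n f w))
        else undefined)\<rparr>"

lemma coord_value_sep:
  assumes "c \<in> Coord ` {1..m} \<union> {MinusInf, PlusInf}" "d \<in> Coord ` {1..m} \<union> {MinusInf, PlusInf}"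
    "\<And>e. e \<in> cube m \<Longrightarrow> coord_value e c = coord_value e d"
  shows "c = d"
proof -
  have T: "replicate m True \<in> cube m" and F: "replicate m False \<in> cube m"
    and S: "\<And>i. (replicate m False)[i - 1 := True] \<in> cube m" by (auto simp: cube_def)
  note a = assms(3)[OF T] assms(3)[OF F] assms(3)[OF S]
  show ?thesis
  proof (cases c)
    case (Coord i)
    then have i: "1 \<le> i" "i \<le> m" using assms(1) by auto
    show ?thesis
    proof (cases d)
      case (Coord k)
      then have k: "1 \<le> k" "k \<le> m" using assms(2) by auto
      show ?thesis using a(3)[of k] \<open>c = _\<close> \<open>d = _\<close> i k
        by (auto simp: nth_list_update split: if_splits)
    qed (use a i Coord in auto)
  next
    case MinusInf
    then show ?thesis using a assms(2) by (cases d) auto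
  next
    case PlusInf
    then show ?thesis using a assms(2) by (cases d) auto
  qed
qed

lemma coordinates_unique:
  assumes "coordinates m n f h" "coordinates m n f h'" shows "h = h'"
proof (rule PiE_ext)
  show "h \<in> {1..n} \<rightarrow>\<^sub>E Coord ` {1..m} \<union> {MinusInf, PlusInf}"
    "h' \<in> {1..n} \<rightarrow>\<^sub>E Coord ` {1..m} \<union> {MinusInf, PlusInf}"
    using assms by (auto simp: coordinates_def)
  fix j assume j: "j \<in> {1..n}"
  show "h j = h' j"
  proof (rule coord_value_sep)
    show "h j \<in> Coord ` {1..m} \<union> {MinusInf, PlusInf}" "h' j \<in> Coord ` {1..m} \<union> {MinusInf, PlusInf}"
      using assms j unfolding coordinates_def by blast+
    fix e assume e: "e \<in> cube m"
    have "map (\<lambda>j. coord_value e (h j)) [1..<Suc n] = map (\<lambda>j. coord_value e (h' j)) [1..<Suc n]"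
      using assms e unfolding coordinates_def by metis
    then have "\<forall>j\<in>set [1..<Suc n]. coord_value e (h j) = coord_value e (h' j)"
      by (simp only: map_eq_conv)
    then show "coord_value e (h j) = coord_value e (h' j)" using j by (simp del: upt_Suc)
  qed
qed

lemma hat_eqI: "coordinates m n f h \<Longrightarrow> hat m n f = h"
  unfolding hat_def using coordinates_unique by (intro the_equality) blast+

lemma position_eqI:
  assumes "coordinates m n f h" "\<exists>!j. j \<in> {1..n} \<and> h j = Coord i" "j \<in> {1..n}" "h j = Coord i"
    "i \<in> {1..m}"
  shows "position m n f i = j"
proof -
  have eq: "hat m n f = h" using hat_eqI assms by blast
  show ?thesis unfolding position_def the_inv_into_def eq
    using assms(2-5) by (intro the_equality) auto
qed

lemma coordinates_id: "coordinates n n (\<lambda>\<epsilon>\<in>cube n. \<epsilon>) (\<lambda>j\<in>{1..n}. Coord j)"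
  by (auto simp: coordinates_def cube_def intro!: nth_equalityI simp del: upt_Suc)

lemma coordinates_face:
  assumes "1 \<le> i" "i \<le> Suc n"
  shows "coordinates n (Suc n) (face n i \<alpha>)
    (\<lambda>j\<in>{1..Suc n}. if j < i then Coord j else if j = i then (if \<alpha> then PlusInf else MinusInf) else Coord (j - 1))"
  (is "coordinates _ _ _ ?h")
proof -
  have 1: "?h j \<in> Coord ` {1..n} \<union> {MinusInf, PlusInf}" if j: "j \<in> {1..Suc n}" for j
  proof -
    consider "j < i" | "j = i" | "j > i" by linarith
    then show ?thesis
    proof cases
      case 1
      then have "j \<in> {1..n}" using assms j by auto
      then show ?thesis using 1 by auto
    next
      case 3
      then have "j - 1 \<in> {1..n}" using assms j by auto
      then show ?thesis using 3 j by simp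
    qed (use j in auto)
  qed
  have 2: "take (i - 1) e @ \<alpha> # drop (i - 1) e = map (\<lambda>j. coord_value e (?h j)) [1..<Suc (Suc n)]"
    (is "?l = ?r") if e: "length e = n" for e
  proof (rule nth_equalityI)
    show "length ?l = length ?r" using assms e by auto
    fix k assume "k < length ?l"
    then have k: "k < Suc n" using assms e by auto
    have r: "?r ! k = coord_value e (?h (Suc k))" using k by (simp del: upt_Suc)
    have "k < i - 1 \<or> k = i - 1 \<or> i - 1 < k" by linarith
    then show "?l ! k = ?r ! k" unfolding r
      using k assms e by (elim disjE) (simp_all add: nth_append min_def nth_Cons', auto)
  qed
  show ?thesis unfolding coordinates_def using 1 2
    by (auto simp: face_def cube_def simp del: upt_Suc)
qed

lemma coordinates_symmetry:
  assumes "1 \<le> i" "i < n"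
  shows "coordinates n n (symmetry n i)
    (\<lambda>j\<in>{1..n}. if j = i then Coord (Suc i) else if j = Suc i then Coord i else Coord j)"
  (is "coordinates _ _ _ ?h")
proof -
  have 1: "?h j \<in> Coord ` {1..n} \<union> {MinusInf, PlusInf}" if j: "j \<in> {1..n}" for j
    using assms j by auto
  have 2: "e[i - 1 := e ! i, i := e ! (i - 1)] = map (\<lambda>j. coord_value e (?h j)) [1..<Suc n]"
    (is "?l = ?r") if e: "length e = n" for e
  proof (rule nth_equalityI)
    show "length ?l = length ?r" using assms e by auto
    fix k assume "k < length ?l"
    then have k: "k < n" using assms e by auto
    have r: "?r ! k = coord_value e (?h (Suc k))" using k by (simp del: upt_Suc)
    have "k = i - 1 \<or> k = i \<or> (k \<noteq> i - 1 \<and> k \<noteq> i)" by linarith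
    then show "?l ! k = ?r ! k" unfolding r
      using k assms e by (elim disjE) (auto simp: nth_list_update)
  qed
  show ?thesis unfolding coordinates_def using 1 2
    by (auto simp: symmetry_def cube_def simp del: upt_Suc)
qed

lemma coordinates_comp:
  assumes "coordinates l m f h" "coordinates m n g k"
  shows "coordinates l n (compose (cube l) g f)
    (\<lambda>j\<in>{1..n}. case k j of Coord i \<Rightarrow> h i | c \<Rightarrow> c)"
proof -
  have 1: "(case k j of Coord i \<Rightarrow> h i | c \<Rightarrow> c) \<in> Coord ` {1..l} \<union> {MinusInf, PlusInf}"
    if "j \<in> {1..n}" for j
  proof -
    have "k j \<in> Coord ` {1..m} \<union> {MinusInf, PlusInf}" using assms that by (auto simp: coordinates_def)
    then show ?thesis using assms(1) unfolding coordinates_def by (auto dest: PiE_mem)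
  qed
  have 2: "g (f e) = map (\<lambda>j. coord_value e ((\<lambda>j\<in>{1..n}. case k j of Coord i \<Rightarrow> h i | c \<Rightarrow> c) j)) [1..<Suc n]"
    if e: "e \<in> cube l" for e
  proof -
    have fe: "f e = map (\<lambda>j. coord_value e (h j)) [1..<Suc m]" using assms(1) e by (auto simp: coordinates_def)
    then have "f e \<in> cube m" by (auto simp: cube_def)
    then have "g (f e) = map (\<lambda>j. coord_value (f e) (k j)) [1..<Suc n]"
      using assms(2) by (auto simp: coordinates_def)
    also have "\<dots> = map (\<lambda>j. coord_value e ((\<lambda>j\<in>{1..n}. case k j of Coord i \<Rightarrow> h i | c \<Rightarrow> c) j)) [1..<Suc n]"
    proof (rule map_cong[OF refl])
      fix j assume "j \<in> set [1..<Suc n]"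
      then have j: "j \<in> {1..n}" by auto
      then have "k j \<in> Coord ` {1..m} \<union> {MinusInf, PlusInf}" using assms by (auto simp: coordinates_def)
      then show "coord_value (f e) (k j) = coord_value e ((\<lambda>j\<in>{1..n}. case k j of Coord i \<Rightarrow> h i | c \<Rightarrow> c) j)"
        using j by (auto simp: fe simp del: upt_Suc)
    qed
    finally show ?thesis .
  qed
  show ?thesis unfolding coordinates_def using 1 2 by (auto simp: compose_def simp del: upt_Suc)
qed

lemma face_ex1:
  assumes "1 \<le> i" "i \<le> Suc n" "k \<in> {1..n}"
  shows "\<exists>!j. j \<in> {1..Suc n} \<and> (\<lambda>j\<in>{1..Suc n}. if j < i then Coord j else if j = i then if \<alpha> then PlusInf else MinusInf else Coord (j - 1)) j = Coord k"
    (is "\<exists>!j. _ \<and> ?h j = _")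
proof (intro ex1I conjI)
  show "(if k < i then k else Suc k) \<in> {1..Suc n}" using assms by simp
  show "?h (if k < i then k else Suc k) = Coord k" using assms by simp
  fix j assume j: "j \<in> {1..Suc n} \<and> ?h j = Coord k"
  consider "j < i" | "j = i" | "j > i" by linarith
  then show "j = (if k < i then k else Suc k)" using j by cases (simp_all split: if_splits, linarith?)
qed

lemma symmetry_ex1:
  assumes "1 \<le> i" "i < n" "k \<in> {1..n}"
  shows "\<exists>!j. j \<in> {1..n} \<and> (\<lambda>j\<in>{1..n}. if j = i then Coord (Suc i) else if j = Suc i then Coord i else Coord j) j = Coord k"
    (is "\<exists>!j. _ \<and> ?h j = _")
proof (intro ex1I conjI)
  show "(if k = i then Suc i else if k = Suc i then i else k) \<in> {1..n}" using assms by simp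
  show "?h (if k = i then Suc i else if k = Suc i then i else k) = Coord k" using assms by simp
  fix j assume j: "j \<in> {1..n} \<and> ?h j = Coord k"
  consider "j = i" | "j = Suc i" | "j \<noteq> i" "j \<noteq> Suc i" by linarith
  then show "j = (if k = i then Suc i else if k = Suc i then i else k)" using j by cases (auto split: if_splits)
qed

lemma id_ex1: "k \<in> {1..n} \<Longrightarrow> \<exists>!j. j \<in> {1..n} \<and> (\<lambda>j\<in>{1..n}. Coord j) j = Coord k"
  by (rule ex1I[of _ k]) (auto split: if_splits)

lemma cube_map_coordinates:
  assumes "cube_map m n f"
  shows "\<exists>h. coordinates m n f h \<and> (\<forall>i\<in>{1..m}. \<exists>!j. j \<in> {1..n} \<and> h j = Coord i)"
  using assms
proof induction
  case (cube_map_id n)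
  show ?case by (rule exI, rule conjI[OF coordinates_id], rule ballI, rule id_ex1)
next
  case (cube_map_face i n \<alpha>)
  show ?case 
    by (rule exI, rule conjI[OF coordinates_face[OF cube_map_face]], rule ballI, rule face_ex1[OF cube_map_face])
next
  case (cube_map_symmetry i n)
  show ?case
    by (rule exI, rule conjI[OF coordinates_symmetry[OF cube_map_symmetry]], rule ballI, rule symmetry_ex1[OF cube_map_symmetry])
next
  case (cube_map_comp l m f n g)
  then obtain h k where h: "coordinates l m f h" "\<forall>i\<in>{1..l}. \<exists>!j. j \<in> {1..m} \<and> h j = Coord i"
    and k: "coordinates m n g k" "\<forall>i\<in>{1..m}. \<exists>!j. j \<in> {1..n} \<and> k j = Coord i" by blast
  show ?case
  proof (rule exI, rule conjI[OF coordinates_comp[OF h(1) k(1)]], rule ballI)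
    fix i assume i: "i \<in> {1..l}"
    obtain a where a: "a \<in> {1..m}" "h a = Coord i" using h i by blast
    obtain b where b: "b \<in> {1..n}" "k b = Coord a" using k a by blast
    show "\<exists>!j. j \<in> {1..n} \<and> (\<lambda>j\<in>{1..n}. case k j of Coord i \<Rightarrow> h i | c \<Rightarrow> c) j = Coord i"
    proof (rule ex1I[of _ b])
      show "b \<in> {1..n} \<and> (\<lambda>j\<in>{1..n}. case k j of Coord i \<Rightarrow> h i | c \<Rightarrow> c) b = Coord i" using a b by auto
      fix j assume j: "j \<in> {1..n} \<and> (\<lambda>j\<in>{1..n}. case k j of Coord i \<Rightarrow> h i | c \<Rightarrow> c) j = Coord i"
      then have "k j \<in> Coord ` {1..m} \<union> {MinusInf, PlusInf}" using k by (auto simp: coordinates_def)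
      then obtain c where c: "k j = Coord c" "c \<in> {1..m}" "h c = Coord i" using j by auto
      then have "c = a" using h i a by blast
      then show "j = b" using k c a b j by blast
    qed
  qed
qed

lemma position_spec:
  assumes "cube_map m n f" "i \<in> {1..m}"
  shows "position m n f i \<in> {1..n}" "hat m n f (position m n f i) = Coord i"
    "\<And>j. j \<in> {1..n} \<Longrightarrow> hat m n f j = Coord i \<Longrightarrow> j = position m n f i"
    and coordinates_hat: "coordinates m n f (hat m n f)"
proof -
  obtain h where h: "coordinates m n f h" "\<forall>i\<in>{1..m}. \<exists>!j. j \<in> {1..n} \<and> h j = Coord i"
    using cube_map_coordinates assms by blast
  then obtain j where j: "j \<in> {1..n}" "h j = Coord i" using assms by blast
  have p: "position m n f i = j" by (rule position_eqI[OF h(1) bspec[OF h(2) assms(2)] j assms(2)])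
  have e: "hat m n f = h" by (rule hat_eqI[OF h(1)])
  show "position m n f i \<in> {1..n}" "hat m n f (position m n f i) = Coord i" using j p e by auto
  have u: "\<exists>!j. j \<in> {1..n} \<and> h j = Coord i" using h(2) assms(2) by (rule bspec)
  show "k = position m n f i" if "k \<in> {1..n}" "hat m n f k = Coord i" for k
    unfolding p using that j unfolding e by (intro Uniq_D[OF ex1_iff_ex_Uniq[THEN iffD1, OF u, THEN conjunct2]]) auto
  show "coordinates m n f (hat m n f)" using e h by simp
qed

lemma hat_coordinates: "cube_map m n f \<Longrightarrow> coordinates m n f (hat m n f)"
proof -
  assume "cube_map m n f"
  then obtain h where "coordinates m n f h" using cube_map_coordinates by blast
  with hat_eqI[OF this] show ?thesis by simp
qed

lemma position_id: "i \<in> {1..n} \<Longrightarrow> position n n (\<lambda>\<epsilon>\<in>cube n. \<epsilon>) i = i"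
  by (rule position_eqI[OF coordinates_id id_ex1]) simp_all

lemma position_face:
  assumes "1 \<le> i" "i \<le> Suc n" "k \<in> {1..n}"
  shows "position n (Suc n) (face n i \<alpha>) k = (if k < i then k else Suc k)"
  by (rule position_eqI[OF coordinates_face[OF assms(1,2)] face_ex1[OF assms]]) (use assms in simp_all)

lemma position_symmetry:
  assumes "1 \<le> i" "i < n" "k \<in> {1..n}"
  shows "position n n (symmetry n i) k = (if k = i then Suc i else if k = Suc i then i else k)"
  by (rule position_eqI[OF coordinates_symmetry[OF assms(1,2)] symmetry_ex1[OF assms]]) (use assms in simp_all)

lemma position_comp:
  assumes f: "cube_map l m f" and g: "cube_map m n g" and i: "i \<in> {1..l}"
  shows "position l n (compose (cube l) g f) i = position m n g (position l m f i)"
proof -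
  note F = position_spec[OF f i]
  note G = position_spec[OF g F(1)]
  have fg: "cube_map l n (compose (cube l) g f)" by (rule cube_map_comp[OF f g])
  have "hat l n (compose (cube l) g f) = (\<lambda>j\<in>{1..n}. case hat m n g j of Coord i \<Rightarrow> hat l m f i | c \<Rightarrow> c)"
    by (rule hat_eqI[OF coordinates_comp[OF F(4) G(4)]])
  then show ?thesis
    using position_spec(3)[OF fg i G(1)] G(1,2) F(1,2) by simp
qed

lemma word_act_face:
  assumes "1 \<le> i" "i \<le> Suc n" "length w = Suc n"
  shows "word_act n (Suc n) (face n i \<alpha>) w = take (i - 1) w @ drop i w"
  using assms
  by (intro nth_equalityI) (auto simp: word_act_def position_face nth_append simp del: upt_Suc)

lemma word_act_symmetry:
  assumes "1 \<le> i" "i < n" "length w = n"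
  shows "word_act n n (symmetry n i) w = w[i - 1 := w ! i, i := w ! (i - 1)]"
  using assms
  by (intro nth_equalityI) (auto simp: word_act_def position_symmetry nth_list_update simp del: upt_Suc)

lemma word_act_id: "word_act (length w) (length w) (\<lambda>\<epsilon>\<in>cube (length w). \<epsilon>) w = w"
  by (intro nth_equalityI) (auto simp: word_act_def position_id simp del: upt_Suc)

lemma word_act_comp:
  assumes f: "cube_map l m f" and g: "cube_map m n g"
  shows "word_act l n (compose (cube l) g f) w = word_act l m f (word_act m n g w)"
proof -
  have "w ! (position l n (compose (cube l) g f) i - 1)
     = map (\<lambda>i. w ! (position m n g i - 1)) [1..<Suc m] ! (position l m f i - 1)"
    if i: "i \<in> {1..l}" for i
    using position_comp[OF f g i] position_spec(1)[OF f i] by (auto simp del: upt_Suc)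
  then show ?thesis unfolding word_act_def by (auto simp del: upt_Suc)
qed

lemma word_act_in:
  assumes f: "cube_map m n f" and w: "length w = n" "set w \<subseteq> A"
  shows "length (word_act m n f w) = m" "set (word_act m n f w) \<subseteq> A"
proof -
  show "length (word_act m n f w) = m" by (auto simp: word_act_def)
  have "w ! (position m n f i - 1) \<in> A" if "i \<in> {1..m}" for i
  proof -
    have "position m n f i \<in> {1..n}" by (rule position_spec(1)[OF f that])
    then show ?thesis using w by (auto simp: subset_iff)
  qed
  then show "set (word_act m n f w) \<subseteq> A" by (auto simp: word_act_def simp del: upt_Suc)
qed

lemma universe_finite:
  assumes "universe U" "finite (B :: 'e set)" shows "B \<in> U"
proof -
  obtain A where A: "A \<in> U" "infinite A" using assms by (auto simp: universe_def)
  then obtain C where C: "C \<subseteq> A" "finite C" "card C = card B" using infinite_arbitrarily_large by metis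
  then obtain h where "bij_betw h C B" using assms finite_same_card_bij by blast
  then have "B = h ` C" by (auto simp: bij_betw_def)
  moreover have "C \<in> U" using C A assms by (auto simp: universe_def)
  ultimately show ?thesis using assms by (auto simp: universe_def)
qed

lemma universe_words:
  assumes U: "universe U" and S: "S \<in> U"
  shows "Word ` {w. length w = n \<and> set w \<subseteq> S} \<in> U"
proof (induction n)
  case 0
  then show ?case using universe_finite[OF U] by simp
next
  case (Suc n)
  let ?W = "Word ` {w. length w = n \<and> set w \<subseteq> S}"
  have "Word ` {w. length w = Suc n \<and> set w \<subseteq> S}
     = (\<Union>a\<in>S. (\<lambda>x. case x of Word w \<Rightarrow> Word (a # w)) ` ?W)"
    by (auto simp: length_Suc_conv image_iff)
  then show ?case using U S Suc unfolding universe_def by simp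
qed

lemma cube_map_cube: assumes "cube_map m n f" shows "f \<in> cube m \<rightarrow>\<^sub>E cube n"
  using assms
  by induction (auto simp: cube_def face_def symmetry_def compose_def PiE_iff extensional_def)

lemma finite_cube: "finite (cube n)"
  unfolding cube_def using finite_lists_length_eq[of "UNIV::bool set" n] by simp

lemma finite_cube_maps: "finite {f. cube_map m n f}"
  by (rule finite_subset[of _ "cube m \<rightarrow>\<^sub>E cube n"])
     (use cube_map_cube finite_cube in \<open>auto intro!: finite_PiE\<close>)

lemma is_spset_bang:
  assumes U: "universe U" and S: "S \<in> U"
  shows "is_spset U (bang S)"
  unfolding is_spset_def
proof (intro conjI allI impI)
  fix n show "Cells (bang S) n \<in> U" using universe_words[OF U S] by (simp add: bang_def)
next
  fix m n f assume "cube_map m n f"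
  then show "Act (bang S) m n f \<in> Cells (bang S) n \<rightarrow>\<^sub>E Cells (bang S) m"
    by (auto simp: bang_def word_act_in intro!: imageI)
next
  fix m n f assume "\<not> cube_map m n f"
  then show "Act (bang S) m n f = undefined" by (simp add: bang_def)
next
  fix n show "Act (bang S) n n (\<lambda>\<epsilon>\<in>cube n. \<epsilon>) = (\<lambda>x\<in>Cells (bang S) n. x)"
    using cube_map_id[of n] by (intro ext) (auto simp: bang_def word_act_id)
next
  fix l m n f g assume *: "cube_map l m f \<and> cube_map m n g"
  then show "Act (bang S) l n (compose (cube l) g f) =
     compose (Cells (bang S) n) (Act (bang S) l m f) (Act (bang S) m n g)"
  proof -
    have "Word (word_act m n g w) \<in> Word ` {w. length w = m \<and> set w \<subseteq> S}"
      if "length w = n" "set w \<subseteq> S" for w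
      using that * word_act_in[of m n g w S] by simp
    then show ?thesis using * cube_map_comp[of l m f n g]
      by (intro ext) (auto simp: bang_def compose_def[of "_ ` _"] word_act_comp)
  qed
qed

text \<open>The comma category \<open>\<box>\<^sub>S\<^sup>o\<^sup>pSet \<down> !\<^sup>S\<Sigma>\<close>; an object is a pair of \<open>K\<close> and a map \<open>K \<rightarrow> !\<^sup>S\<Sigma>\<close>.\<close>

type_synonym 'e lspset = "'e spset \<times> (nat \<Rightarrow> 'e \<Rightarrow> 'e)"
type_synonym 'e lspset_arrow = "'e lspset \<times> (nat \<Rightarrow> 'e \<Rightarrow> 'e) \<times> 'e lspset"

definition is_lspset :: "'x elem set set \<Rightarrow> 'x elem set \<Rightarrow> 'x elem lspset \<Rightarrow> bool" where
  "is_lspset U \<Sigma> X \<longleftrightarrow> is_spset U (fst X) \<and> spset_map (fst X) (bang \<Sigma>) (snd X)"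

definition lspset_map :: "'e lspset \<Rightarrow> 'e lspset \<Rightarrow> (nat \<Rightarrow> 'e \<Rightarrow> 'e) \<Rightarrow> bool" where
  "lspset_map X Y \<phi> \<longleftrightarrow>
     spset_map (fst X) (fst Y) \<phi> \<and> spset_comp (fst X) (snd Y) \<phi> = snd X"

definition LSPSET ::
  "'x elem set set \<Rightarrow> 'x elem set \<Rightarrow> ('x elem lspset, 'x elem lspset_arrow) category" where
  "LSPSET U \<Sigma> =
     \<lparr>Ob = {X. is_lspset U \<Sigma> X},
      Arr = {(X, \<phi>, Y). is_lspset U \<Sigma> X \<and> is_lspset U \<Sigma> Y \<and> lspset_map X Y \<phi>},
      Dom = (\<lambda>(X, \<phi>, Y). X),
      Cod = (\<lambda>(X, \<phi>, Y). Y),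
      Id = (\<lambda>X. (X, spset_id (fst X), X)),
      Comp = (\<lambda>(Y, \<psi>, Z) (X, \<phi>, Y'). (X, spset_comp (fst X) \<psi> \<phi>, Z))\<rparr>"


section \<open>Labelled cubes and the cubes \<open>C\<^sub>n[a\<^sub>1,\<dots>,a\<^sub>n]\<close>\<close>

text \<open>By Yoneda, the map \<open>\<box>\<^sub>S[n] \<rightarrow> !\<^sup>S\<Sigma>\<close> corresponding to a word sends \<open>f\<close> to the image of
  the word under \<open>f\<close>.\<close>

definition labelled_cube :: "'x elem list \<Rightarrow> 'x elem lspset" where
  "labelled_cube a =
     (representable (length a),
      (\<lambda>m. \<lambda>x\<in>Cells (representable (length a)) m.
         case x of CubeMap f \<Rightarrow> Word (word_act m (length a) f a)))"

definition cube_whdts :: "'x elem list \<Rightarrow> 'x elem whdts" where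
  "cube_whdts a =
     \<lparr>States = Vertex ` cube (length a),
      Actions = {Indexed (a ! (i - 1)) i | i. i \<in> {1..length a}},
      Labelling = (\<lambda>u\<in>{Indexed (a ! (i - 1)) i | i. i \<in> {1..length a}}.
                     case u of Indexed c i \<Rightarrow> c),
      Trans = {(Vertex \<epsilon>, map (\<lambda>i. Indexed (a ! (i - 1)) i) is, Vertex \<epsilon>') | \<epsilon> is \<epsilon>'.
                 \<epsilon> \<in> cube (length a) \<and> \<epsilon>' \<in> cube (length a) \<and>
                 is \<noteq> [] \<and> distinct is \<and> set is \<subseteq> {1..length a} \<and>
                 (\<forall>i\<in>{1..length a}. \<epsilon> ! (i - 1) \<le> \<epsilon>' ! (i - 1)) \<and>
                 (\<forall>i\<in>{1..length a}. \<epsilon> ! (i - 1) \<noteq> \<epsilon>' ! (i - 1) \<longleftrightarrow> i \<in> set is)}\<rparr>"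

text \<open>
  The value of \<open>\<bbbT>\<close> on a map of labelled cubes; the underlying map of \<open>\<box>\<^sub>S\<close> is the image of the
  identity of \<open>[m]\<close>.
\<close>

definition underlying_cube_map :: "nat \<Rightarrow> (nat \<Rightarrow> 'x elem \<Rightarrow> 'x elem) \<Rightarrow> bool list \<Rightarrow> bool list" where
  "underlying_cube_map m \<phi> = (case \<phi> m (CubeMap (\<lambda>\<epsilon>\<in>cube m. \<epsilon>)) of CubeMap g \<Rightarrow> g)"

definition cube_whdts_map ::
  "'x elem list \<Rightarrow> 'x elem list \<Rightarrow> (bool list \<Rightarrow> bool list) \<Rightarrow> 'x elem whdts_arrow" where
  "cube_whdts_map a b f0 =
     (cube_whdts a,
      (\<lambda>s\<in>States (cube_whdts a). case s of Vertex \<epsilon> \<Rightarrow> Vertex (f0 \<epsilon>),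
       \<lambda>u\<in>Actions (cube_whdts a).
         case u of Indexed c i \<Rightarrow> Indexed c (position (length a) (length b) f0 i)),
      cube_whdts b)"

definition extends_labelled_cubes ::
  "'x elem set set \<Rightarrow> 'x elem set \<Rightarrow>
   ('x elem lspset, 'x elem lspset_arrow, 'x elem whdts, 'x elem whdts_arrow) fctr \<Rightarrow> bool" where
  "extends_labelled_cubes U \<Sigma> F \<longleftrightarrow>
     (\<forall>a. set a \<subseteq> \<Sigma> \<longrightarrow> FOb F (labelled_cube a) = cube_whdts a) \<and>
     (\<forall>a b \<phi>. set a \<subseteq> \<Sigma> \<and> set b \<subseteq> \<Sigma> \<and>
        (labelled_cube a, \<phi>, labelled_cube b)
          \<in> Hom (LSPSET U \<Sigma>) (labelled_cube a) (labelled_cube b) \<longrightarrow>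
        FArr F (labelled_cube a, \<phi>, labelled_cube b) =
          cube_whdts_map a b (underlying_cube_map (length a) \<phi>))"

end

theory Submission
  imports Defs
begin

text \<open>
  Evaluating a weak higher dimensional transition system \<open>Y\<close> on cubes gives a labelled symmetric
  precubical set, the nerve of \<open>Y\<close>: an \<open>n\<close>-cell labelled by a word \<open>a\<close> of length \<open>n\<close> is a map from the
  cube \<open>cube_whdts a\<close> to \<open>Y\<close>, and cells are restricted along maps of \<open>\<box>\<^sub>S\<close> by precomposition. This is
  possible because the assignment of cubes to words is functorial (\<open>whdts_map_cube_fun\<close>,
  \<open>cube_fun_comp\<close>, \<open>cube_fun_id\<close>). The functor wanted is a left adjoint of the nerve.
  
  A map from \<open>X\<close> to the nerve of \<open>Y\<close> is the same as a choice, for every cell of \<open>X\<close>, of a map from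
  the cube on the label of that cell to \<open>Y\<close>, compatibly with restriction
  (\<open>lspset_map_classify\<close>, \<open>lspset_map_nerve\<close>), that is, a cocone with vertex \<open>Y\<close> on the diagram of these
  cubes indexed by the category of cells of \<open>X\<close>. Weak higher dimensional transition systems have
  small colimits (\<open>WHDTS_cocomplete\<close>): states and actions are computed as colimits of sets, and the
  transitions are generated from the images of the given ones by the multiset and coherence axioms.
  So the colimit of the diagram of cubes carries a universal arrow from \<open>X\<close> to the nerve functor
  (\<open>ex_universal_arrow_nerve\<close>). By the Yoneda lemma, \<open>cube_whdts a\<close> itself carries a universal arrow
  from the labelled cube on \<open>a\<close> (\<open>universal_arrow_labelled_cube\<close>). A choice of universal arrows amounts to a left
  adjoint. Choosing the Yoneda one on every labelled cube makes the left adjoint extend the given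
  functor on labelled cubes on the nose; on maps between labelled cubes this is the naturality
  of the Yoneda arrows (\<open>cube_unit_natural\<close>). Colimits are preserved, as they are by every left adjoint.
  
  Uniqueness holds because labelled cubes are dense: each \<open>X\<close> is the colimit of the labelled cubes
  over its category of cells (\<open>labelled_cubes_dense\<close>). This indexing category is small, so a functor
  preserving colimits is determined, up to a natural isomorphism, by its restriction to labelled
  cubes (\<open>naturally_isomorphic_if_agree_on_dense\<close>).
\<close>

section \<open>Left adjoints from universal arrows\<close>

lemma cat_Id: "is_category C \<Longrightarrow> X \<in> Ob C \<Longrightarrow> Id C X \<in> Hom C X X"
  by (simp add: is_category_def)

lemma cat_Comp:
  "is_category C \<Longrightarrow> f \<in> Hom C X Y \<Longrightarrow> g \<in> Hom C Y Z \<Longrightarrow> Comp C g f \<in> Hom C X Z"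
  unfolding is_category_def by blast

lemma cat_Comp_Id: "is_category C \<Longrightarrow> f \<in> Hom C X Y \<Longrightarrow> Comp C f (Id C X) = f"
  unfolding is_category_def by blast

lemma cat_Id_Comp: "is_category C \<Longrightarrow> f \<in> Hom C X Y \<Longrightarrow> Comp C (Id C Y) f = f"
  unfolding is_category_def by blast

lemma cat_assoc:
  "is_category C \<Longrightarrow> f \<in> Hom C W X \<Longrightarrow> g \<in> Hom C X Y \<Longrightarrow> h \<in> Hom C Y Z \<Longrightarrow>
     Comp C h (Comp C g f) = Comp C (Comp C h g) f"
  unfolding is_category_def by blast

lemma cat_Hom_Ob:
  assumes "is_category C" "f \<in> Hom C X Y" shows "X \<in> Ob C" "Y \<in> Ob C"
  using assms unfolding is_category_def Hom_def by auto

lemma functor_Ob: "is_functor C E F \<Longrightarrow> X \<in> Ob C \<Longrightarrow> FOb F X \<in> Ob E"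
  by (simp add: is_functor_def)

lemma functor_Hom:
  "is_functor C E F \<Longrightarrow> f \<in> Hom C X Y \<Longrightarrow> FArr F f \<in> Hom E (FOb F X) (FOb F Y)"
  unfolding is_functor_def by blast

lemma functor_Id: "is_functor C E F \<Longrightarrow> X \<in> Ob C \<Longrightarrow> FArr F (Id C X) = Id E (FOb F X)"
  by (simp add: is_functor_def)

lemma functor_Comp:
  "is_functor C E F \<Longrightarrow> f \<in> Hom C X Y \<Longrightarrow> g \<in> Hom C Y Z \<Longrightarrow>
     FArr F (Comp C g f) = Comp E (FArr F g) (FArr F f)"
  unfolding is_functor_def by blast

definition universal_arrow ::
  "('o, 'a) category \<Rightarrow> ('p, 'b) category \<Rightarrow> ('p, 'b, 'o, 'a) fctr \<Rightarrow> 'o \<Rightarrow> 'p \<Rightarrow> 'a \<Rightarrow> bool" where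
  "universal_arrow C E G X L \<eta> \<longleftrightarrow>
     L \<in> Ob E \<and> \<eta> \<in> Hom C X (FOb G L) \<and>
     (\<forall>Y\<in>Ob E. \<forall>g\<in>Hom C X (FOb G Y). \<exists>!h. h \<in> Hom E L Y \<and> Comp C (FArr G h) \<eta> = g)"

locale universal_arrows =
  fixes C :: "('o, 'a) category" and E :: "('p, 'b) category" and G :: "('p, 'b, 'o, 'a) fctr"
    and L :: "'o \<Rightarrow> 'p" and \<eta> :: "'o \<Rightarrow> 'a"
  assumes C: "is_category C" and E: "is_category E" and G: "is_functor E C G"
    and universal: "X \<in> Ob C \<Longrightarrow> universal_arrow C E G X (L X) (\<eta> X)"
begin

lemma L_Ob: "X \<in> Ob C \<Longrightarrow> L X \<in> Ob E"
  and unit_Hom: "X \<in> Ob C \<Longrightarrow> \<eta> X \<in> Hom C X (FOb G (L X))"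
  using universal by (auto simp: universal_arrow_def)

lemma transpose_ex1:
  "Y \<in> Ob E \<Longrightarrow> g \<in> Hom C X (FOb G Y) \<Longrightarrow> \<exists>!h. h \<in> Hom E (L X) Y \<and> Comp C (FArr G h) (\<eta> X) = g"
  using universal[OF cat_Hom_Ob(1)[OF C]] unfolding universal_arrow_def by simp

lemma transpose_eqI:
  assumes "X \<in> Ob C" "h \<in> Hom E (L X) Y" "h' \<in> Hom E (L X) Y"
    and "Comp C (FArr G h) (\<eta> X) = Comp C (FArr G h') (\<eta> X)"
  shows "h = h'"
proof -
  have "Y \<in> Ob E" by (rule cat_Hom_Ob(2)[OF E assms(2)])
  moreover have "Comp C (FArr G h) (\<eta> X) \<in> Hom C X (FOb G Y)"
    by (rule cat_Comp[OF C unit_Hom[OF assms(1)] functor_Hom[OF G assms(2)]])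
  ultimately have "\<exists>!k. k \<in> Hom E (L X) Y \<and> Comp C (FArr G k) (\<eta> X) = Comp C (FArr G h) (\<eta> X)"
    by (rule transpose_ex1)
  then show ?thesis using assms(2-4) by auto
qed

definition left_adjoint :: "('o, 'a, 'p, 'b) fctr" where
  "left_adjoint =
     \<lparr>FOb = L,
      FArr = (\<lambda>f. THE h. h \<in> Hom E (L (Dom C f)) (L (Cod C f)) \<and>
        Comp C (FArr G h) (\<eta> (Dom C f)) = Comp C (\<eta> (Cod C f)) f)\<rparr>"

lemma FOb_left_adjoint: "FOb left_adjoint X = L X"
  by (simp add: left_adjoint_def)

lemma FArr_left_adjoint:
  assumes f: "f \<in> Hom C X Y"
  shows "FArr left_adjoint f \<in> Hom E (L X) (L Y)"
    and "Comp C (FArr G (FArr left_adjoint f)) (\<eta> X) = Comp C (\<eta> Y) f"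
proof -
  have XY: "Dom C f = X" "Cod C f = Y" "X \<in> Ob C" "Y \<in> Ob C"
    using f cat_Hom_Ob[OF C f] by (auto simp: Hom_def)
  have "Comp C (\<eta> Y) f \<in> Hom C X (FOb G (L Y))"
    by (rule cat_Comp[OF C f unit_Hom[OF XY(4)]])
  from theI'[OF transpose_ex1[OF L_Ob[OF XY(4)] this]]
  show "FArr left_adjoint f \<in> Hom E (L X) (L Y)"
    and "Comp C (FArr G (FArr left_adjoint f)) (\<eta> X) = Comp C (\<eta> Y) f"
    by (simp_all add: left_adjoint_def XY)
qed

lemma FArr_left_adjoint_eqI:
  assumes "f \<in> Hom C X Y" "h \<in> Hom E (L X) (L Y)" "Comp C (FArr G h) (\<eta> X) = Comp C (\<eta> Y) f"
  shows "FArr left_adjoint f = h"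
  using transpose_eqI[OF cat_Hom_Ob(1)[OF C assms(1)]] FArr_left_adjoint[OF assms(1)] assms by metis

lemma is_functor_left_adjoint: "is_functor C E left_adjoint"
  unfolding is_functor_def FOb_left_adjoint
proof (intro conjI ballI allI)
  fix X assume X: "X \<in> Ob C"
  show "L X \<in> Ob E" by (rule L_Ob[OF X])
  show "FArr left_adjoint (Id C X) = Id E (L X)"
    by (rule FArr_left_adjoint_eqI[OF cat_Id[OF C X] cat_Id[OF E L_Ob[OF X]]])
       (simp add: functor_Id[OF G L_Ob[OF X]] cat_Id_Comp[OF C unit_Hom[OF X]]
         cat_Comp_Id[OF C unit_Hom[OF X]])
next
  fix X Y f assume "f \<in> Hom C X Y"
  then show "FArr left_adjoint f \<in> Hom E (L X) (L Y)" by (rule FArr_left_adjoint)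
next
  fix X Y Z f g assume f: "f \<in> Hom C X Y" and g: "g \<in> Hom C Y Z"
  note Ff = FArr_left_adjoint[OF f] and Fg = FArr_left_adjoint[OF g]
  note ob = cat_Hom_Ob[OF C f] cat_Hom_Ob[OF C g]
  have "Comp C (FArr G (Comp E (FArr left_adjoint g) (FArr left_adjoint f))) (\<eta> X)
      = Comp C (FArr G (FArr left_adjoint g)) (Comp C (\<eta> Y) f)"
    using functor_Comp[OF G Ff(1) Fg(1)] Ff(2)
      cat_assoc[OF C unit_Hom[OF ob(1)] functor_Hom[OF G Ff(1)] functor_Hom[OF G Fg(1)]] by simp
  also have "\<dots> = Comp C (\<eta> Z) (Comp C g f)"
    using cat_assoc[OF C f unit_Hom[OF ob(2)] functor_Hom[OF G Fg(1)]] Fg(2)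
      cat_assoc[OF C f g unit_Hom[OF ob(4)]] by simp
  finally show "FArr left_adjoint (Comp C g f) = Comp E (FArr left_adjoint g) (FArr left_adjoint f)"
    by (rule FArr_left_adjoint_eqI[OF cat_Comp[OF C f g] cat_Comp[OF E Ff(1) Fg(1)]])
qed

lemma is_left_adjoint_left_adjoint: "is_left_adjoint C E left_adjoint"
proof -
  let ?\<phi> = "\<lambda>X Y h. Comp C (FArr G h) (\<eta> X)"
  have "bij_betw (?\<phi> X Y) (Hom E (L X) Y) (Hom C X (FOb G Y))" if X: "X \<in> Ob C" and Y: "Y \<in> Ob E" for X Y
  proof (rule bij_betwI')
    show "(?\<phi> X Y h = ?\<phi> X Y h') = (h = h')" if "h \<in> Hom E (L X) Y" "h' \<in> Hom E (L X) Y" for h h'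
      using transpose_eqI[OF X that] by blast
    show "?\<phi> X Y h \<in> Hom C X (FOb G Y)" if "h \<in> Hom E (L X) Y" for h
      by (rule cat_Comp[OF C unit_Hom[OF X] functor_Hom[OF G that]])
    show "\<exists>h\<in>Hom E (L X) Y. g = ?\<phi> X Y h" if "g \<in> Hom C X (FOb G Y)" for g
      using transpose_ex1[OF Y that] by blast
  qed
  moreover have "?\<phi> X' Y' (Comp E g (Comp E h (FArr left_adjoint f)))
      = Comp C (FArr G g) (Comp C (?\<phi> X Y h) f)"
    if f: "f \<in> Hom C X' X" and g: "g \<in> Hom E Y Y'" and h: "h \<in> Hom E (L X) Y" for X X' Y Y' f g h
  proof -
    note Ff = FArr_left_adjoint[OF f] and ob = cat_Hom_Ob[OF C f]
    note units = unit_Hom[OF ob(1)] unit_Hom[OF ob(2)]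
    note GH = functor_Hom[OF G Ff(1)] functor_Hom[OF G g] functor_Hom[OF G h]
    have hf: "Comp E h (FArr left_adjoint f) \<in> Hom E (L X') Y" by (rule cat_Comp[OF E Ff(1) h])
    have "?\<phi> X' Y' (Comp E g (Comp E h (FArr left_adjoint f)))
        = Comp C (FArr G g) (?\<phi> X' Y (Comp E h (FArr left_adjoint f)))"
      using functor_Comp[OF G hf g] cat_assoc[OF C units(1) functor_Hom[OF G hf] GH(2)] by simp
    also have "?\<phi> X' Y (Comp E h (FArr left_adjoint f)) = Comp C (FArr G h) (Comp C (\<eta> X) f)"
      using functor_Comp[OF G Ff(1) h] cat_assoc[OF C units(1) GH(1) GH(3)] Ff(2) by simp
    also have "\<dots> = Comp C (?\<phi> X Y h) f" by (rule cat_assoc[OF C f units(2) GH(3)])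
    finally show ?thesis .
  qed
  ultimately have "is_left_adjoint_of C E left_adjoint G"
    unfolding is_left_adjoint_of_def FOb_left_adjoint by (intro exI[of _ ?\<phi>]) blast
  then show ?thesis
    unfolding is_left_adjoint_def using is_functor_left_adjoint G by blast
qed

end

section \<open>Preservation of colimits and uniqueness\<close>

lemma colimit_cocone: "is_colimit J C D c l \<Longrightarrow> is_cocone J C D c l"
  by (simp add: is_colimit_def)

lemma colimit_ex1:
  "is_colimit J C D c l \<Longrightarrow> is_cocone J C D d m \<Longrightarrow>
     \<exists>!h. h \<in> Hom C c d \<and> (\<forall>i\<in>Ob J. Comp C h (l i) = m i)"
  by (simp add: is_colimit_def)

lemma cocone_Hom: "is_cocone J C D c l \<Longrightarrow> i \<in> Ob J \<Longrightarrow> l i \<in> Hom C (FOb D i) c"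
  by (simp add: is_cocone_def)

lemma cocone_commute: "is_cocone J C D c l \<Longrightarrow> f \<in> Hom J i j \<Longrightarrow> Comp C (l j) (FArr D f) = l i"
  unfolding is_cocone_def by blast

lemma cocone_postcomp:
  assumes C: "is_category C" and J: "is_category J" and D: "is_functor J C D"
    and l: "is_cocone J C D c l" and h: "h \<in> Hom C c d"
  shows "is_cocone J C D d (\<lambda>i. Comp C h (l i))"
  unfolding is_cocone_def
proof (intro conjI ballI allI)
  show "d \<in> Ob C" by (rule cat_Hom_Ob(2)[OF C h])
  show "Comp C h (l i) \<in> Hom C (FOb D i) d" if "i \<in> Ob J" for i
    by (rule cat_Comp[OF C cocone_Hom[OF l that] h])
  show "Comp C (Comp C h (l j)) (FArr D f) = Comp C h (l i)" if f: "f \<in> Hom J i j" for i j f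
    using cat_assoc[OF C functor_Hom[OF D f] cocone_Hom[OF l cat_Hom_Ob(2)[OF J f]] h]
      cocone_commute[OF l f] by simp
qed

lemma colimit_eqI:
  assumes C: "is_category C" and J: "is_category J" and D: "is_functor J C D"
    and l: "is_colimit J C D c l" and h: "h \<in> Hom C c d" and h': "h' \<in> Hom C c d"
    and eq: "\<And>i. i \<in> Ob J \<Longrightarrow> Comp C h (l i) = Comp C h' (l i)"
  shows "h = h'"
  using colimit_ex1[OF l cocone_postcomp[OF C J D colimit_cocone[OF l] h']] h h' eq by blast

lemma is_functor_fctr_comp:
  assumes F: "is_functor A B F" and G: "is_functor B C G"
  shows "is_functor A C (fctr_comp G F)"
  unfolding is_functor_def fctr_comp_def fctr.simps
proof (intro conjI ballI allI)
  show "FOb G (FOb F X) \<in> Ob C" if "X \<in> Ob A" for X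
    by (rule functor_Ob[OF G functor_Ob[OF F that]])
  show "FArr G (FArr F f) \<in> Hom C (FOb G (FOb F X)) (FOb G (FOb F Y))" if "f \<in> Hom A X Y" for X Y f
    by (rule functor_Hom[OF G functor_Hom[OF F that]])
  show "FArr G (FArr F (Id A X)) = Id C (FOb G (FOb F X))" if "X \<in> Ob A" for X
    using functor_Id[OF F that] functor_Id[OF G functor_Ob[OF F that]] by simp
  show "FArr G (FArr F (Comp A g f)) = Comp C (FArr G (FArr F g)) (FArr G (FArr F f))"
    if "f \<in> Hom A X Y" "g \<in> Hom A Y Z" for X Y Z f g
    using functor_Comp[OF F that] functor_Comp[OF G functor_Hom[OF F that(1)] functor_Hom[OF F that(2)]] by simp
qed

lemma functor_cocone:
  assumes J: "is_category J" and D: "is_functor J C D" and F: "is_functor C E F"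
    and l: "is_cocone J C D c l"
  shows "is_cocone J E (fctr_comp F D) (FOb F c) (\<lambda>i. FArr F (l i))"
  unfolding is_cocone_def fctr_comp_def fctr.simps
proof (intro conjI ballI allI)
  show "FOb F c \<in> Ob E" using functor_Ob[OF F] l by (simp add: is_cocone_def)
  show "FArr F (l i) \<in> Hom E (FOb F (FOb D i)) (FOb F c)" if "i \<in> Ob J" for i
    by (rule functor_Hom[OF F cocone_Hom[OF l that]])
  show "Comp E (FArr F (l j)) (FArr F (FArr D f)) = FArr F (l i)" if f: "f \<in> Hom J i j" for i j f
    using functor_Comp[OF F functor_Hom[OF D f] cocone_Hom[OF l cat_Hom_Ob(2)[OF J f]]]
      cocone_commute[OF l f] by simp
qed

text \<open>
  A cocone in the target on the image diagram transposes to a cocone in the source on the original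
  diagram, and the factorizations of the two correspond under the adjunction bijection.
\<close>

theorem left_adjoint_preserves_colimits:
  assumes C: "is_category C" and E: "is_category E" and F: "is_left_adjoint C E F"
  shows "preserves_colimits U C E F"
  unfolding preserves_colimits_def
proof (intro allI impI)
  fix J :: "('e, 'e) category" and D c l
  assume "is_category J \<and> Ob J \<in> U \<and> Arr J \<in> U \<and> is_functor J C D \<and> is_colimit J C D c l"
  then have J: "is_category J" and D: "is_functor J C D" and colim: "is_colimit J C D c l" by auto
  from F obtain G \<phi> where Ff: "is_functor C E F" and G: "is_functor E C G"
    and bij: "\<And>X Y. X \<in> Ob C \<Longrightarrow> Y \<in> Ob E \<Longrightarrow> bij_betw (\<phi> X Y) (Hom E (FOb F X) Y) (Hom C X (FOb G Y))"
    and nat: "\<And>X X' Y Y' f g h. X \<in> Ob C \<Longrightarrow> X' \<in> Ob C \<Longrightarrow> Y \<in> Ob E \<Longrightarrow> Y' \<in> Ob E \<Longrightarrow>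
       f \<in> Hom C X' X \<Longrightarrow> g \<in> Hom E Y Y' \<Longrightarrow> h \<in> Hom E (FOb F X) Y \<Longrightarrow>
       \<phi> X' Y' (Comp E g (Comp E h (FArr F f))) = Comp C (FArr G g) (Comp C (\<phi> X Y h) f)"
    unfolding is_left_adjoint_def is_left_adjoint_of_def by metis
  have \<phi>_Hom: "\<phi> X Y h \<in> Hom C X (FOb G Y)"
    if "X \<in> Ob C" "Y \<in> Ob E" "h \<in> Hom E (FOb F X) Y" for X Y h
    using bij_betwE[OF bij[OF that(1,2)]] that(3) by blast
  have \<phi>_comp: "\<phi> X' Y (Comp E h (FArr F f)) = Comp C (\<phi> X Y h) f"
    if f: "f \<in> Hom C X' X" and Y: "Y \<in> Ob E" and h: "h \<in> Hom E (FOb F X) Y" for X X' Y f h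
  proof -
    note ob = cat_Hom_Ob[OF C f]
    show ?thesis
      using nat[OF ob(2,1) Y Y f cat_Id[OF E Y] h] functor_Id[OF G Y]
        cat_Id_Comp[OF E cat_Comp[OF E functor_Hom[OF Ff f] h]]
        cat_Id_Comp[OF C cat_Comp[OF C f \<phi>_Hom[OF ob(2) Y h]]] by simp
  qed
  have l: "l i \<in> Hom C (FOb D i) c" if "i \<in> Ob J" for i
    by (rule cocone_Hom[OF colimit_cocone[OF colim] that])
  have c: "c \<in> Ob C" using colim by (simp add: is_colimit_def is_cocone_def)
  show "is_colimit J E (fctr_comp F D) (FOb F c) (\<lambda>i. FArr F (l i))"
    unfolding is_colimit_def
  proof (intro conjI allI impI)
    show "is_cocone J E (fctr_comp F D) (FOb F c) (\<lambda>i. FArr F (l i))"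
      by (rule functor_cocone[OF J D Ff colimit_cocone[OF colim]])
    fix d m assume m: "is_cocone J E (fctr_comp F D) d m"
    have d: "d \<in> Ob E" using m by (simp add: is_cocone_def)
    have mi: "m i \<in> Hom E (FOb F (FOb D i)) d" if "i \<in> Ob J" for i
      using cocone_Hom[OF m that] by (simp add: fctr_comp_def)
    let ?n = "\<lambda>i. \<phi> (FOb D i) d (m i)"
    have n: "is_cocone J C D (FOb G d) ?n"
      unfolding is_cocone_def
    proof (intro conjI ballI allI)
      show "FOb G d \<in> Ob C" by (rule functor_Ob[OF G d])
      show "?n i \<in> Hom C (FOb D i) (FOb G d)" if "i \<in> Ob J" for i
        by (rule \<phi>_Hom[OF functor_Ob[OF D that] d mi[OF that]])
      show "Comp C (?n j) (FArr D f) = ?n i" if f: "f \<in> Hom J i j" for i j f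
        using \<phi>_comp[OF functor_Hom[OF D f] d mi[OF cat_Hom_Ob(2)[OF J f]]]
          cocone_commute[OF m f] by (simp add: fctr_comp_def)
    qed
    \<comment> \<open>Transposition turns factorizations through the image cocone into factorizations
      through the given colimit.\<close>
    have factor: "(\<forall>i\<in>Ob J. Comp E h (FArr F (l i)) = m i) \<longleftrightarrow>
        (\<forall>i\<in>Ob J. Comp C (\<phi> c d h) (l i) = ?n i)" if h: "h \<in> Hom E (FOb F c) d" for h
    proof (rule ball_cong[OF refl])
      fix i assume i: "i \<in> Ob J"
      have "Comp E h (FArr F (l i)) \<in> Hom E (FOb F (FOb D i)) d"
        by (rule cat_Comp[OF E functor_Hom[OF Ff l[OF i]] h])
      then have "Comp E h (FArr F (l i)) = m i \<longleftrightarrow> \<phi> (FOb D i) d (Comp E h (FArr F (l i))) = ?n i"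
        using bij_betw_imp_inj_on[OF bij[OF functor_Ob[OF D i] d]] mi[OF i] by (metis inj_onD)
      then show "Comp E h (FArr F (l i)) = m i \<longleftrightarrow> Comp C (\<phi> c d h) (l i) = ?n i"
        using \<phi>_comp[OF l[OF i] d h] by simp
    qed
    obtain k where k: "k \<in> Hom C c (FOb G d)" "\<forall>i\<in>Ob J. Comp C k (l i) = ?n i"
      and k_unique: "\<And>k'. k' \<in> Hom C c (FOb G d) \<Longrightarrow> \<forall>i\<in>Ob J. Comp C k' (l i) = ?n i \<Longrightarrow> k' = k"
      using colimit_ex1[OF colim n] by blast
    obtain h where h: "h \<in> Hom E (FOb F c) d" "\<phi> c d h = k"
      using bij[OF c d] k(1) by (metis bij_betw_imp_surj_on imageE)
    show "\<exists>!h. h \<in> Hom E (FOb F c) d \<and> (\<forall>i\<in>Ob J. Comp E h (FArr F (l i)) = m i)"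
    proof (rule ex1I[of _ h])
      show "h \<in> Hom E (FOb F c) d \<and> (\<forall>i\<in>Ob J. Comp E h (FArr F (l i)) = m i)"
        using factor h k by simp
      fix h' assume h': "h' \<in> Hom E (FOb F c) d \<and> (\<forall>i\<in>Ob J. Comp E h' (FArr F (l i)) = m i)"
      then have "\<phi> c d h' = k" using factor k_unique \<phi>_Hom[OF c d] by blast
      then show "h' = h" using bij_betw_imp_inj_on[OF bij[OF c d]] h h' by (metis inj_onD)
    qed
  qed
qed

lemma colimit_cong:
  assumes J: "is_category J"
    and Ob: "\<And>i. i \<in> Ob J \<Longrightarrow> FOb D i = FOb D' i"
    and Arr: "\<And>i j f. f \<in> Hom J i j \<Longrightarrow> FArr D f = FArr D' f"
  shows "is_colimit J C D c l = is_colimit J C D' c l"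
proof -
  have "is_cocone J C D c l = is_cocone J C D' c l" for c l
    unfolding is_cocone_def using Ob Arr by auto
  then show ?thesis unfolding is_colimit_def by simp
qed

text \<open>
  Both functors send \<open>X\<close> to a colimit of one and the same diagram, which gives a unique comparison
  isomorphism compatible with the colimit cocones. The last hypothesis says that a map \<open>X \<rightarrow> Y\<close> carries the
  cocone of \<open>X\<close> into that of \<open>Y\<close>; so naturality of the comparison can be checked on the cocone.
\<close>

theorem naturally_isomorphic_if_agree_on_dense:
  fixes C :: "('o, 'a) category" and E :: "('p, 'b) category"
    and J :: "'o \<Rightarrow> ('j, 'k) category"
  assumes C: "is_category C" and E: "is_category E"
    and T: "is_functor C E T" and T': "is_functor C E T'"
    and J: "\<And>X. X \<in> Ob C \<Longrightarrow> is_category (J X)"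
    and D: "\<And>X. X \<in> Ob C \<Longrightarrow> is_functor (J X) C (D X)"
    and l: "\<And>X. X \<in> Ob C \<Longrightarrow> is_cocone (J X) C (D X) X (l X)"
    and colim: "\<And>X. X \<in> Ob C \<Longrightarrow>
      is_colimit (J X) E (fctr_comp T (D X)) (FOb T X) (\<lambda>i. FArr T (l X i))"
    and colim': "\<And>X. X \<in> Ob C \<Longrightarrow>
      is_colimit (J X) E (fctr_comp T' (D X)) (FOb T' X) (\<lambda>i. FArr T' (l X i))"
    and agree_Ob: "\<And>X i. X \<in> Ob C \<Longrightarrow> i \<in> Ob (J X) \<Longrightarrow> FOb T (FOb (D X) i) = FOb T' (FOb (D X) i)"
    and agree_Arr: "\<And>X i j f. X \<in> Ob C \<Longrightarrow> f \<in> Hom (J X) i j \<Longrightarrow>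
      FArr T (FArr (D X) f) = FArr T' (FArr (D X) f)"
    and natural: "\<And>X Y f i. f \<in> Hom C X Y \<Longrightarrow> i \<in> Ob (J X) \<Longrightarrow>
      \<exists>j\<in>Ob (J Y). FOb (D Y) j = FOb (D X) i \<and> l Y j = Comp C f (l X i)"
  shows "naturally_isomorphic C E T T'"
proof -
  have TD: "is_functor (J X) E (fctr_comp T (D X))" if "X \<in> Ob C" for X
    by (rule is_functor_fctr_comp[OF D[OF that] T])
  have T'D: "is_functor (J X) E (fctr_comp T' (D X))" if "X \<in> Ob C" for X
    by (rule is_functor_fctr_comp[OF D[OF that] T'])
  have colim'': "is_colimit (J X) E (fctr_comp T (D X)) (FOb T' X) (\<lambda>i. FArr T' (l X i))"
    if X: "X \<in> Ob C" for X
    using colim'[OF X] colimit_cong[OF J[OF X], of "fctr_comp T (D X)" "fctr_comp T' (D X)"]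
      agree_Ob[OF X] agree_Arr[OF X] by (simp add: fctr_comp_def)
  have "\<exists>t. t \<in> Hom E (FOb T X) (FOb T' X) \<and>
      (\<forall>i\<in>Ob (J X). Comp E t (FArr T (l X i)) = FArr T' (l X i))" if X: "X \<in> Ob C" for X
    using colimit_ex1[OF colim[OF X] colimit_cocone[OF colim''[OF X]]] by blast
  then obtain t where t: "\<And>X. X \<in> Ob C \<Longrightarrow> t X \<in> Hom E (FOb T X) (FOb T' X)"
    and tl: "\<And>X i. X \<in> Ob C \<Longrightarrow> i \<in> Ob (J X) \<Longrightarrow> Comp E (t X) (FArr T (l X i)) = FArr T' (l X i)"
    by metis
  have lX: "l X i \<in> Hom C (FOb (D X) i) X" if "X \<in> Ob C" "i \<in> Ob (J X)" for X i
    by (rule cocone_Hom[OF l[OF that(1)] that(2)])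
  have iso: "is_iso E (FOb T X) (FOb T' X) (t X)" if X: "X \<in> Ob C" for X
  proof -
    obtain s where s: "s \<in> Hom E (FOb T' X) (FOb T X)"
      and sl: "\<And>i. i \<in> Ob (J X) \<Longrightarrow> Comp E s (FArr T' (l X i)) = FArr T (l X i)"
      using colimit_ex1[OF colim''[OF X] colimit_cocone[OF colim[OF X]]] by blast
    have "Comp E s (t X) = Id E (FOb T X)"
    proof (rule colimit_eqI[OF E J[OF X] TD[OF X] colim[OF X]])
      show "Comp E s (t X) \<in> Hom E (FOb T X) (FOb T X)" by (rule cat_Comp[OF E t[OF X] s])
      show "Id E (FOb T X) \<in> Hom E (FOb T X) (FOb T X)"
        by (rule cat_Id[OF E functor_Ob[OF T X]])
      fix i assume i: "i \<in> Ob (J X)"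
      note Tl = functor_Hom[OF T lX[OF X i]]
      show "Comp E (Comp E s (t X)) (FArr T (l X i)) = Comp E (Id E (FOb T X)) (FArr T (l X i))"
        using cat_assoc[OF E Tl t[OF X] s] tl[OF X i] sl[OF i] cat_Id_Comp[OF E Tl] by simp
    qed
    moreover have "Comp E (t X) s = Id E (FOb T' X)"
    proof (rule colimit_eqI[OF E J[OF X] T'D[OF X] colim'[OF X]])
      show "Comp E (t X) s \<in> Hom E (FOb T' X) (FOb T' X)" by (rule cat_Comp[OF E s t[OF X]])
      show "Id E (FOb T' X) \<in> Hom E (FOb T' X) (FOb T' X)"
        by (rule cat_Id[OF E functor_Ob[OF T' X]])
      fix i assume i: "i \<in> Ob (J X)"
      note Tl = functor_Hom[OF T' lX[OF X i]]
      show "Comp E (Comp E (t X) s) (FArr T' (l X i)) = Comp E (Id E (FOb T' X)) (FArr T' (l X i))"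
        using cat_assoc[OF E Tl s t[OF X]] tl[OF X i] sl[OF i] cat_Id_Comp[OF E Tl] by simp
    qed
    ultimately show ?thesis unfolding is_iso_def using t[OF X] s by blast
  qed
  have "Comp E (t Y) (FArr T f) = Comp E (FArr T' f) (t X)" if f: "f \<in> Hom C X Y" for X Y f
  proof -
    note X = cat_Hom_Ob(1)[OF C f] and Y = cat_Hom_Ob(2)[OF C f]
    show ?thesis
    proof (rule colimit_eqI[OF E J[OF X] TD[OF X] colim[OF X]])
      show "Comp E (t Y) (FArr T f) \<in> Hom E (FOb T X) (FOb T' Y)"
        by (rule cat_Comp[OF E functor_Hom[OF T f] t[OF Y]])
      show "Comp E (FArr T' f) (t X) \<in> Hom E (FOb T X) (FOb T' Y)"
        by (rule cat_Comp[OF E t[OF X] functor_Hom[OF T' f]])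
      fix i assume i: "i \<in> Ob (J X)"
      obtain j where j: "j \<in> Ob (J Y)" "l Y j = Comp C f (l X i)" using natural[OF f i] by blast
      note li = lX[OF X i]
      have "Comp E (Comp E (t Y) (FArr T f)) (FArr T (l X i)) = Comp E (t Y) (FArr T (l Y j))"
        using cat_assoc[OF E functor_Hom[OF T li] functor_Hom[OF T f] t[OF Y]]
          functor_Comp[OF T li f] j(2) by simp
      also have "\<dots> = FArr T' (Comp C f (l X i))" using tl[OF Y j(1)] j(2) by simp
      also have "\<dots> = Comp E (FArr T' f) (Comp E (t X) (FArr T (l X i)))"
        using functor_Comp[OF T' li f] tl[OF X i] by simp
      also have "\<dots> = Comp E (Comp E (FArr T' f) (t X)) (FArr T (l X i))"
        by (rule cat_assoc[OF E functor_Hom[OF T li] t[OF X] functor_Hom[OF T' f]])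
      finally show "Comp E (Comp E (t Y) (FArr T f)) (FArr T (l X i))
        = Comp E (Comp E (FArr T' f) (t X)) (FArr T (l X i))" .
    qed
  qed
  with iso show ?thesis unfolding naturally_isomorphic_def by blast
qed

section \<open>The category of weak higher dimensional transition systems\<close>

definition wmap_comp ::
  "'e whdts \<Rightarrow> ('e \<Rightarrow> 'e) \<times> ('e \<Rightarrow> 'e) \<Rightarrow> ('e \<Rightarrow> 'e) \<times> ('e \<Rightarrow> 'e) \<Rightarrow> ('e \<Rightarrow> 'e) \<times> ('e \<Rightarrow> 'e)" where
  "wmap_comp X g f = (compose (States X) (fst g) (fst f), compose (Actions X) (snd g) (snd f))"

definition wmap_id :: "'e whdts \<Rightarrow> ('e \<Rightarrow> 'e) \<times> ('e \<Rightarrow> 'e)" where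
  "wmap_id X = (\<lambda>s\<in>States X. s, \<lambda>u\<in>Actions X. u)"

lemma Hom_WHDTS:
  "h \<in> Hom (WHDTS U \<Sigma>) X Y \<longleftrightarrow>
     (\<exists>f. h = (X, f, Y) \<and> is_whdts U \<Sigma> X \<and> is_whdts U \<Sigma> Y \<and> whdts_map X Y f)"
  by (auto simp: Hom_def WHDTS_def)

lemma Ob_WHDTS: "X \<in> Ob (WHDTS U \<Sigma>) \<longleftrightarrow> is_whdts U \<Sigma> X"
  by (simp add: WHDTS_def)

lemma Comp_WHDTS: "Comp (WHDTS U \<Sigma>) (Y, g, Z) (X, f, Y') = (X, wmap_comp X g f, Z)"
  by (simp add: WHDTS_def wmap_comp_def)

lemma Id_WHDTS: "Id (WHDTS U \<Sigma>) X = (X, wmap_id X, X)"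
  by (simp add: WHDTS_def wmap_id_def)

lemma compose_Id_right: "f \<in> extensional A \<Longrightarrow> compose A f (\<lambda>x\<in>A. x) = f"
  by (auto simp: compose_def extensional_def)

lemma compose_Id_left: "f \<in> A \<rightarrow>\<^sub>E B \<Longrightarrow> compose A (\<lambda>x\<in>B. x) f = f"
  by (rule ext) (auto simp: compose_def PiE_iff extensional_def)

lemma compose_compose:
  "f \<in> A \<rightarrow> B \<Longrightarrow> compose A h (compose A g f) = compose A (compose B h g) f"
  by (rule ext) (auto simp: compose_def)

lemma whdts_mapD:
  assumes "whdts_map X Y f"
  shows "fst f \<in> States X \<rightarrow>\<^sub>E States Y" "snd f \<in> Actions X \<rightarrow>\<^sub>E Actions Y"
    "u \<in> Actions X \<Longrightarrow> Labelling Y (snd f u) = Labelling X u"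
    "(\<alpha>, us, \<beta>) \<in> Trans X \<Longrightarrow> (fst f \<alpha>, map (snd f) us, fst f \<beta>) \<in> Trans Y"
  using assms by (auto simp: whdts_map_def)

lemma whdts_Trans:
  assumes "is_whdts U \<Sigma> X" "(\<alpha>, us, \<beta>) \<in> Trans X"
  shows "\<alpha> \<in> States X" "\<beta> \<in> States X" "us \<noteq> []" "set us \<subseteq> Actions X"
  using assms unfolding is_whdts_def by blast+

lemma wmap_comp_id_right: "whdts_map X Y f \<Longrightarrow> wmap_comp X f (wmap_id X) = f"
  using whdts_mapD(1,2)[of X Y f]
  by (simp add: wmap_comp_def wmap_id_def compose_Id_right PiE_iff)

lemma wmap_comp_id_left: "whdts_map X Y f \<Longrightarrow> wmap_comp X (wmap_id Y) f = f"
  using whdts_mapD(1,2)[of X Y f]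
  by (simp add: wmap_comp_def wmap_id_def compose_Id_left)

lemma wmap_comp_assoc:
  "whdts_map W X f \<Longrightarrow> wmap_comp W h (wmap_comp W g f) = wmap_comp W (wmap_comp X h g) f"
  using whdts_mapD(1,2)[of W X f] by (simp add: wmap_comp_def compose_compose PiE_iff Pi_iff)

lemma whdts_map_id: "is_whdts U \<Sigma> X \<Longrightarrow> whdts_map X X (wmap_id X)"
  using whdts_Trans[of U \<Sigma> X]
  by (auto simp: whdts_map_def wmap_id_def map_idI subset_iff cong: map_cong)

lemma whdts_map_comp:
  assumes X: "is_whdts U \<Sigma> X" and f: "whdts_map X Y f" and g: "whdts_map Y Z g"
  shows "whdts_map X Z (wmap_comp X g f)"
  unfolding whdts_map_def
proof (intro conjI ballI)
  note F = whdts_mapD[OF f] and G = whdts_mapD[OF g]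
  show "fst (wmap_comp X g f) \<in> States X \<rightarrow>\<^sub>E States Z"
    "snd (wmap_comp X g f) \<in> Actions X \<rightarrow>\<^sub>E Actions Z"
    using F(1,2) G(1,2) by (auto simp: wmap_comp_def compose_def)
  show "Labelling Z (snd (wmap_comp X g f) u) = Labelling X u" if "u \<in> Actions X" for u
    using PiE_mem[OF F(2) that] F(3) G(3) that by (simp add: wmap_comp_def compose_def)
  fix t assume t: "t \<in> Trans X"
  obtain \<alpha> us \<beta> where t_eq: "t = (\<alpha>, us, \<beta>)" by (metis prod_cases3)
  note wf = whdts_Trans[OF X t[unfolded t_eq]]
  have "map (snd (wmap_comp X g f)) us = map (snd g) (map (snd f) us)"
    using wf(4) by (auto simp: wmap_comp_def compose_def)
  moreover have "fst (wmap_comp X g f) \<alpha> = fst g (fst f \<alpha>)" "fst (wmap_comp X g f) \<beta> = fst g (fst f \<beta>)"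
    using wf(1,2) by (simp_all add: wmap_comp_def compose_def)
  ultimately show "case t of (\<alpha>, us, \<beta>) \<Rightarrow>
      (fst (wmap_comp X g f) \<alpha>, map (snd (wmap_comp X g f)) us, fst (wmap_comp X g f) \<beta>) \<in> Trans Z"
    unfolding t_eq prod.case using G(4)[OF F(4)[OF t[unfolded t_eq]]] by (simp only:)
qed

lemma is_category_WHDTS: "is_category (WHDTS U \<Sigma>)"
  unfolding is_category_def
proof (intro conjI allI ballI)
  fix h assume "h \<in> Arr (WHDTS U \<Sigma>)"
  then show "Dom (WHDTS U \<Sigma>) h \<in> Ob (WHDTS U \<Sigma>)" "Cod (WHDTS U \<Sigma>) h \<in> Ob (WHDTS U \<Sigma>)"
    by (auto simp: WHDTS_def)
next
  fix X assume "X \<in> Ob (WHDTS U \<Sigma>)"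
  then show "Id (WHDTS U \<Sigma>) X \<in> Hom (WHDTS U \<Sigma>) X X"
    by (simp add: Hom_WHDTS Ob_WHDTS Id_WHDTS whdts_map_id)
next
  fix X Y Z f g assume "f \<in> Hom (WHDTS U \<Sigma>) X Y" "g \<in> Hom (WHDTS U \<Sigma>) Y Z"
  then obtain p q where fg: "f = (X, p, Y)" "g = (Y, q, Z)" and XZ: "is_whdts U \<Sigma> X" "is_whdts U \<Sigma> Z"
    and m: "whdts_map X Y p" "whdts_map Y Z q"
    unfolding Hom_WHDTS by blast
  show "Comp (WHDTS U \<Sigma>) g f \<in> Hom (WHDTS U \<Sigma>) X Z"
    unfolding Hom_WHDTS fg Comp_WHDTS using XZ whdts_map_comp[OF XZ(1) m] by blast
next
  fix X Y f assume "f \<in> Hom (WHDTS U \<Sigma>) X Y"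
  then show "Comp (WHDTS U \<Sigma>) f (Id (WHDTS U \<Sigma>) X) = f"
    "Comp (WHDTS U \<Sigma>) (Id (WHDTS U \<Sigma>) Y) f = f"
    by (auto simp: Hom_WHDTS Comp_WHDTS Id_WHDTS wmap_comp_id_right wmap_comp_id_left)
next
  fix W X Y Z f g h
  assume "f \<in> Hom (WHDTS U \<Sigma>) W X" "g \<in> Hom (WHDTS U \<Sigma>) X Y" "h \<in> Hom (WHDTS U \<Sigma>) Y Z"
  then show "Comp (WHDTS U \<Sigma>) h (Comp (WHDTS U \<Sigma>) g f) = Comp (WHDTS U \<Sigma>) (Comp (WHDTS U \<Sigma>) h g) f"
    by (auto simp: Hom_WHDTS Comp_WHDTS wmap_comp_assoc)
qed

section \<open>Cocompleteness of weak higher dimensional transition systems\<close>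

lemma universe_UN: "universe U \<Longrightarrow> A \<in> U \<Longrightarrow> (\<And>i. i \<in> A \<Longrightarrow> X i \<in> U) \<Longrightarrow> (\<Union>i\<in>A. X i) \<in> U"
  unfolding universe_def by blast

lemma universe_image: "universe U \<Longrightarrow> A \<in> U \<Longrightarrow> f ` A \<in> U"
  unfolding universe_def by blast

lemma universe_subset: "universe U \<Longrightarrow> A \<in> U \<Longrightarrow> B \<subseteq> A \<Longrightarrow> B \<in> U"
  unfolding universe_def by blast

definition set_cocone ::
  "('j, 'k) category \<Rightarrow> ('j \<Rightarrow> 'e set) \<Rightarrow> ('k \<Rightarrow> 'e \<Rightarrow> 'e) \<Rightarrow> ('j \<Rightarrow> 'e \<Rightarrow> 'c) \<Rightarrow> bool" where
  "set_cocone J A d m \<longleftrightarrow> (\<forall>i j. \<forall>f\<in>Hom J i j. \<forall>x\<in>A i. m j (d f x) = m i x)"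

text \<open>
  The colimit of sets is the disjoint union of the \<open>A i\<close> modulo an equivalence relation. Instead of
  generating this relation from the transition maps, two elements are identified as soon as all compatible families
  agree on them, which makes the factorization of families immediate. A class is represented by
  the code of a chosen member.
\<close>

lemma set_colimit:
  fixes J :: "('x elem, 'x elem) category" and d :: "'x elem \<Rightarrow> 'x elem \<Rightarrow> 'x elem"
  assumes U: "universe U" and J: "Ob J \<in> U" and A: "\<And>i. i \<in> Ob J \<Longrightarrow> A i \<in> U"
  obtains q where "(\<Union>i\<in>Ob J. q i ` A i) \<in> U" and "set_cocone J A d q"
    and "\<And>m :: 'x elem \<Rightarrow> 'x elem \<Rightarrow> 'x elem. set_cocone J A d m \<Longrightarrow>
       \<exists>g. \<forall>i\<in>Ob J. \<forall>x\<in>A i. g (q i x) = m i x"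
proof -
  define same :: "'x elem \<times> 'x elem \<Rightarrow> 'x elem \<times> 'x elem \<Rightarrow> bool" where
    "same p r \<longleftrightarrow> (\<forall>m :: 'x elem \<Rightarrow> 'x elem \<Rightarrow> 'x elem. set_cocone J A d m \<longrightarrow>
       m (fst p) (snd p) = m (fst r) (snd r))" for p r
  define pick where "pick i x = (SOME p. same p (i, x))" for i x
  define q where "q i x = Word [fst (pick i x), snd (pick i x)]" for i x
  have pick: "same (pick i x) (i, x)" for i x
    unfolding pick_def by (rule someI[of _ "(i, x)"]) (simp add: same_def)
  show thesis
  proof (rule that)
    show "(\<Union>i\<in>Ob J. q i ` A i) \<in> U" by (intro universe_UN[OF U J] universe_image[OF U] A)
    show "set_cocone J A d q"
      unfolding set_cocone_def
    proof (intro allI ballI)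
      fix i j f x assume "f \<in> Hom J i j" "x \<in> A i"
      then have "same p (j, d f x) \<longleftrightarrow> same p (i, x)" for p
        by (auto simp: same_def set_cocone_def)
      then show "q j (d f x) = q i x" by (simp add: q_def pick_def)
    qed
    fix m :: "'x elem \<Rightarrow> 'x elem \<Rightarrow> 'x elem" assume m: "set_cocone J A d m"
    let ?g = "\<lambda>w. case w of Word ws \<Rightarrow> m (ws ! 0) (ws ! 1)"
    have "?g (q i x) = m i x" for i x
      using pick[of i x] m by (simp add: same_def q_def)
    then show "\<exists>g. \<forall>i\<in>Ob J. \<forall>x\<in>A i. g (q i x) = m i x" by (intro exI[of _ ?g]) simp
  qed
qed

inductive_set generated_transitions ::
  "('e \<times> 'e list \<times> 'e) set \<Rightarrow> ('e \<times> 'e list \<times> 'e) set" for B where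
  base: "t \<in> B \<Longrightarrow> t \<in> generated_transitions B"
| multiset: "(\<alpha>, us, \<beta>) \<in> generated_transitions B \<Longrightarrow> length us \<ge> 2 \<Longrightarrow>
    \<sigma> permutes {..<length us} \<Longrightarrow> (\<alpha>, permute_list \<sigma> us, \<beta>) \<in> generated_transitions B"
| coherence: "(\<alpha>, us, \<beta>) \<in> generated_transitions B \<Longrightarrow>
    (\<alpha>, take p us, \<nu>1) \<in> generated_transitions B \<Longrightarrow>
    (\<nu>1, drop p us, \<beta>) \<in> generated_transitions B \<Longrightarrow>
    (\<alpha>, take (p + q) us, \<nu>2) \<in> generated_transitions B \<Longrightarrow>
    (\<nu>2, drop (p + q) us, \<beta>) \<in> generated_transitions B \<Longrightarrow>
    length us \<ge> 3 \<Longrightarrow> p \<ge> 1 \<Longrightarrow> q \<ge> 1 \<Longrightarrow> p + q < length us \<Longrightarrow>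
    (\<nu>1, take q (drop p us), \<nu>2) \<in> generated_transitions B"

lemma generated_transitions_subset:
  assumes "t \<in> generated_transitions B"
    and "B \<subseteq> {(\<alpha>, us, \<beta>). \<alpha> \<in> S \<and> \<beta> \<in> S \<and> us \<noteq> [] \<and> set us \<subseteq> L}"
  shows "t \<in> {(\<alpha>, us, \<beta>). \<alpha> \<in> S \<and> \<beta> \<in> S \<and> us \<noteq> [] \<and> set us \<subseteq> L}"
  using assms(1)
proof induction
  case (base t)
  then show ?case using assms(2) by blast
next
  case (multiset \<alpha> us \<beta> \<sigma>)
  then show ?case by (auto simp: set_permute_list simp flip: length_greater_0_conv)
next
  case (coherence \<alpha> us \<beta> p \<nu>1 q \<nu>2)
  have "set (take q (drop p us)) \<subseteq> set us" by (meson order_trans set_drop_subset set_take_subset)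
  then show ?case using coherence by auto
qed

lemma is_whdts_multiset:
  "is_whdts U \<Sigma> X \<Longrightarrow> (\<alpha>, us, \<beta>) \<in> Trans X \<Longrightarrow> length us \<ge> 2 \<Longrightarrow> \<sigma> permutes {..<length us} \<Longrightarrow>
     (\<alpha>, permute_list \<sigma> us, \<beta>) \<in> Trans X"
  unfolding is_whdts_def by blast

lemma is_whdts_coherence:
  "is_whdts U \<Sigma> X \<Longrightarrow> (\<alpha>, us, \<beta>) \<in> Trans X \<Longrightarrow>
     (\<alpha>, take p us, \<nu>1) \<in> Trans X \<Longrightarrow> (\<nu>1, drop p us, \<beta>) \<in> Trans X \<Longrightarrow>
     (\<alpha>, take (p + q) us, \<nu>2) \<in> Trans X \<Longrightarrow> (\<nu>2, drop (p + q) us, \<beta>) \<in> Trans X \<Longrightarrow>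
     length us \<ge> 3 \<Longrightarrow> p \<ge> 1 \<Longrightarrow> q \<ge> 1 \<Longrightarrow> p + q < length us \<Longrightarrow>
     (\<nu>1, take q (drop p us), \<nu>2) \<in> Trans X"
  unfolding is_whdts_def by (elim conjE) blast

text \<open>
  Maps out of a colimit need only be checked on the generating transitions: both closure
  conditions are preserved by applying a map entrywise.
\<close>

lemma generated_transitions_map:
  assumes "t \<in> generated_transitions B" and Y: "is_whdts U \<Sigma> Y"
    and B: "\<And>\<alpha> us \<beta>. (\<alpha>, us, \<beta>) \<in> B \<Longrightarrow> (f \<alpha>, map g us, f \<beta>) \<in> Trans Y"
  shows "case t of (\<alpha>, us, \<beta>) \<Rightarrow> (f \<alpha>, map g us, f \<beta>) \<in> Trans Y"
  using assms(1)
proof induction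
  case (base t)
  then show ?case using B by (cases t) auto
next
  case (multiset \<alpha> us \<beta> \<sigma>)
  then show ?case
    using is_whdts_multiset[OF Y, of "f \<alpha>" "map g us" "f \<beta>" \<sigma>] by (simp add: permute_list_map)
next
  case (coherence \<alpha> us \<beta> p \<nu>1 q \<nu>2)
  then show ?case
    using is_whdts_coherence[OF Y, of "f \<alpha>" "map g us" "f \<beta>" p "f \<nu>1" q "f \<nu>2"]
    by (simp add: take_map drop_map)
qed

text \<open>
  The labelling of the colimit exists because labels form a cocone on the diagram of sets of
  actions. The transitions are those generated by the images of the transitions in the diagram.
\<close>

theorem WHDTS_cocomplete:
  fixes J :: "('x elem, 'x elem) category" and \<Sigma> :: "'x elem set"
  assumes U: "universe U" and J: "is_category J" and JU: "Ob J \<in> U"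
    and D: "is_functor J (WHDTS U \<Sigma>) D"
  shows "\<exists>X l. is_colimit J (WHDTS U \<Sigma>) D X l"
proof -
  let ?W = "WHDTS U \<Sigma>"
  define dm where "dm f = fst (snd (FArr D f))" for f
  have DW: "is_whdts U \<Sigma> (FOb D i)" if "i \<in> Ob J" for i
    using functor_Ob[OF D that] by (simp add: Ob_WHDTS)
  have Df: "FArr D f = (FOb D i, dm f, FOb D j)" "whdts_map (FOb D i) (FOb D j) (dm f)"
    if "f \<in> Hom J i j" for f i j
    using functor_Hom[OF D that] by (auto simp: Hom_WHDTS dm_def)
  have U_States: "States (FOb D i) \<in> U" and U_Actions: "Actions (FOb D i) \<in> U" if "i \<in> Ob J" for i
    using DW[OF that] by (auto simp: is_whdts_def)
  obtain qs where Qs: "(\<Union>i\<in>Ob J. qs i ` States (FOb D i)) \<in> U"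
    and qs: "set_cocone J (\<lambda>i. States (FOb D i)) (\<lambda>f. fst (dm f)) qs"
    and qs_factor: "\<And>m :: 'x elem \<Rightarrow> 'x elem \<Rightarrow> 'x elem.
       set_cocone J (\<lambda>i. States (FOb D i)) (\<lambda>f. fst (dm f)) m \<Longrightarrow>
       \<exists>g. \<forall>i\<in>Ob J. \<forall>x\<in>States (FOb D i). g (qs i x) = m i x"
    using set_colimit[where A = "\<lambda>i. States (FOb D i)" and d = "\<lambda>f. fst (dm f)", OF U JU U_States] by blast
  obtain qa where Qa: "(\<Union>i\<in>Ob J. qa i ` Actions (FOb D i)) \<in> U"
    and qa: "set_cocone J (\<lambda>i. Actions (FOb D i)) (\<lambda>f. snd (dm f)) qa"
    and qa_factor: "\<And>m :: 'x elem \<Rightarrow> 'x elem \<Rightarrow> 'x elem.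
       set_cocone J (\<lambda>i. Actions (FOb D i)) (\<lambda>f. snd (dm f)) m \<Longrightarrow>
       \<exists>g. \<forall>i\<in>Ob J. \<forall>x\<in>Actions (FOb D i). g (qa i x) = m i x"
    using set_colimit[where A = "\<lambda>i. Actions (FOb D i)" and d = "\<lambda>f. snd (dm f)", OF U JU U_Actions] by blast
  have "set_cocone J (\<lambda>i. Actions (FOb D i)) (\<lambda>f. snd (dm f)) (\<lambda>i. Labelling (FOb D i))"
    unfolding set_cocone_def using whdts_mapD(3)[OF Df(2)] by blast
  then obtain lab where lab: "lab (qa i u) = Labelling (FOb D i) u"
    if "i \<in> Ob J" "u \<in> Actions (FOb D i)" for i u
    using qa_factor by meson
  define S where "S = (\<Union>i\<in>Ob J. qs i ` States (FOb D i))"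
  define L where "L = (\<Union>i\<in>Ob J. qa i ` Actions (FOb D i))"
  define B where "B = {(qs i \<alpha>, map (qa i) us, qs i \<beta>) | i \<alpha> us \<beta>. i \<in> Ob J \<and> (\<alpha>, us, \<beta>) \<in> Trans (FOb D i)}"
  define X where "X = \<lparr>States = S, Actions = L, Labelling = (\<lambda>u\<in>L. lab u),
    Trans = generated_transitions B\<rparr>"
  define lm where "lm i = (\<lambda>s\<in>States (FOb D i). qs i s, \<lambda>u\<in>Actions (FOb D i). qa i u)" for i
  define l where "l i = (FOb D i, lm i, X)" for i
  have sel: "States X = S" "Actions X = L" "Labelling X = (\<lambda>u\<in>L. lab u)"
    "Trans X = generated_transitions B"
    by (simp_all add: X_def)
  have BSL: "B \<subseteq> {(\<alpha>, us, \<beta>). \<alpha> \<in> S \<and> \<beta> \<in> S \<and> us \<noteq> [] \<and> set us \<subseteq> L}"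
    using whdts_Trans[OF DW] by (fastforce simp: B_def S_def L_def)
  have X: "is_whdts U \<Sigma> X"
    unfolding is_whdts_def sel
  proof (intro conjI allI impI)
    show "S \<in> U" "L \<in> U" using Qs Qa by (simp_all add: S_def L_def)
    have "Labelling (FOb D i) u \<in> \<Sigma>" if "i \<in> Ob J" "u \<in> Actions (FOb D i)" for i u
      using DW[OF that(1)] that(2) unfolding is_whdts_def by blast
    then show "(\<lambda>u\<in>L. lab u) \<in> L \<rightarrow>\<^sub>E \<Sigma>" using lab by (auto simp: L_def)
    show "generated_transitions B \<subseteq> {(\<alpha>, us, \<beta>). \<alpha> \<in> S \<and> \<beta> \<in> S \<and> us \<noteq> [] \<and> set us \<subseteq> L}"
      using generated_transitions_subset[OF _ BSL] by blast
    show "(\<alpha>, permute_list \<sigma> us, \<beta>) \<in> generated_transitions B"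
      if "2 \<le> length us \<and> \<sigma> permutes {..<length us} \<and> (\<alpha>, us, \<beta>) \<in> generated_transitions B"
      for \<alpha> us \<beta> \<sigma> using that by (auto intro: generated_transitions.multiset)
    show "(\<nu>1, take q (drop p us), \<nu>2) \<in> generated_transitions B"
      if "3 \<le> length us \<and> 1 \<le> p \<and> 1 \<le> q \<and> p + q < length us \<and>
        (\<alpha>, us, \<beta>) \<in> generated_transitions B \<and> (\<alpha>, take p us, \<nu>1) \<in> generated_transitions B \<and>
        (\<nu>1, drop p us, \<beta>) \<in> generated_transitions B \<and>
        (\<alpha>, take (p + q) us, \<nu>2) \<in> generated_transitions B \<and>
        (\<nu>2, drop (p + q) us, \<beta>) \<in> generated_transitions B"
      for \<alpha> us \<beta> p q \<nu>1 \<nu>2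
      using that generated_transitions.coherence[of \<alpha> us \<beta> B p \<nu>1 q \<nu>2] by blast
  qed
  have lm: "whdts_map (FOb D i) X (lm i)" if i: "i \<in> Ob J" for i
    unfolding whdts_map_def
  proof (intro conjI ballI)
    show "fst (lm i) \<in> States (FOb D i) \<rightarrow>\<^sub>E States X" "snd (lm i) \<in> Actions (FOb D i) \<rightarrow>\<^sub>E Actions X"
      using i by (auto simp: lm_def sel S_def L_def)
    show "Labelling X (snd (lm i) u) = Labelling (FOb D i) u" if "u \<in> Actions (FOb D i)" for u
    proof -
      have "qa i u \<in> L" using i that by (auto simp: L_def)
      then show ?thesis using lab[OF i that] that by (simp add: lm_def sel)
    qed
    fix t assume t: "t \<in> Trans (FOb D i)"
    obtain \<alpha> us \<beta> where t_eq: "t = (\<alpha>, us, \<beta>)" by (metis prod_cases3)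
    note wf = whdts_Trans[OF DW[OF i] t[unfolded t_eq]]
    have "map (snd (lm i)) us = map (qa i) us" using wf(4) by (auto simp: lm_def)
    moreover have "(qs i \<alpha>, map (qa i) us, qs i \<beta>) \<in> B" using i t t_eq by (auto simp: B_def)
    moreover have "fst (lm i) \<alpha> = qs i \<alpha>" "fst (lm i) \<beta> = qs i \<beta>" using wf(1,2) by (simp_all add: lm_def)
    ultimately show "case t of (\<alpha>, us, \<beta>) \<Rightarrow> (fst (lm i) \<alpha>, map (snd (lm i)) us, fst (lm i) \<beta>) \<in> Trans X"
      unfolding t_eq prod.case sel by (simp only: generated_transitions.base)
  qed
  have cocone: "is_cocone J ?W D X l"
    unfolding is_cocone_def
  proof (intro conjI ballI allI)
    show "X \<in> Ob ?W" using X by (simp add: Ob_WHDTS)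
    show "l i \<in> Hom ?W (FOb D i) X" if "i \<in> Ob J" for i
      using lm[OF that] DW[OF that] X by (simp add: Hom_WHDTS l_def)
    show "Comp ?W (l j) (FArr D f) = l i" if f: "f \<in> Hom J i j" for i j f
    proof -
      note m = whdts_mapD(1,2)[OF Df(2)[OF f]]
      have "compose (States (FOb D i)) (fst (lm j)) (fst (dm f)) = fst (lm i)"
        using m(1) qs f by (intro ext) (auto simp: compose_def lm_def set_cocone_def)
      moreover have "compose (Actions (FOb D i)) (snd (lm j)) (snd (dm f)) = snd (lm i)"
        using m(2) qa f by (intro ext) (auto simp: compose_def lm_def set_cocone_def)
      ultimately show ?thesis by (simp add: Df(1)[OF f] l_def Comp_WHDTS wmap_comp_def)
    qed
  qed
  have "is_colimit J ?W D X l"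
    unfolding is_colimit_def
  proof (intro conjI allI impI cocone)
    fix Y m assume m: "is_cocone J ?W D Y m"
    have Y: "is_whdts U \<Sigma> Y" using m by (simp add: is_cocone_def Ob_WHDTS)
    define mm where "mm i = fst (snd (m i))" for i
    have mi: "m i = (FOb D i, mm i, Y)" "whdts_map (FOb D i) Y (mm i)" if "i \<in> Ob J" for i
      using cocone_Hom[OF m that] by (auto simp: Hom_WHDTS mm_def)
    have mf: "wmap_comp (FOb D i) (mm j) (dm f) = mm i" if f: "f \<in> Hom J i j" for i j f
      using cocone_commute[OF m f] mi(1)[OF cat_Hom_Ob(1)[OF J f]] mi(1)[OF cat_Hom_Ob(2)[OF J f]]
      by (simp add: Df(1)[OF f] Comp_WHDTS)
    have "set_cocone J (\<lambda>i. States (FOb D i)) (\<lambda>f. fst (dm f)) (\<lambda>i. fst (mm i))"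
      unfolding set_cocone_def
    proof (intro allI ballI)
      fix i j f s assume "f \<in> Hom J i j" "s \<in> States (FOb D i)"
      then show "fst (mm j) (fst (dm f) s) = fst (mm i) s"
        using arg_cong[OF mf, of f i j "\<lambda>g. fst g s"] by (simp add: wmap_comp_def compose_def)
    qed
    then obtain gs where gs: "gs (qs i s) = fst (mm i) s"
      if "i \<in> Ob J" "s \<in> States (FOb D i)" for i s
      using qs_factor by meson
    have "set_cocone J (\<lambda>i. Actions (FOb D i)) (\<lambda>f. snd (dm f)) (\<lambda>i. snd (mm i))"
      unfolding set_cocone_def
    proof (intro allI ballI)
      fix i j f s assume "f \<in> Hom J i j" "s \<in> Actions (FOb D i)"
      then show "snd (mm j) (snd (dm f) s) = snd (mm i) s"
        using arg_cong[OF mf, of f i j "\<lambda>g. snd g s"] by (simp add: wmap_comp_def compose_def)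
    qed
    then obtain ga where ga: "ga (qa i u) = snd (mm i) u"
      if "i \<in> Ob J" "u \<in> Actions (FOb D i)" for i u
      using qa_factor by meson
    define h where "h = (\<lambda>s\<in>S. gs s, \<lambda>u\<in>L. ga u)"
    have h: "whdts_map X Y h"
      unfolding whdts_map_def
    proof (intro conjI ballI)
      show "fst h \<in> States X \<rightarrow>\<^sub>E States Y"
        using gs PiE_mem[OF whdts_mapD(1)[OF mi(2)]] by (auto simp: h_def sel S_def)
      show "snd h \<in> Actions X \<rightarrow>\<^sub>E Actions Y"
        using ga PiE_mem[OF whdts_mapD(2)[OF mi(2)]] by (auto simp: h_def sel L_def)
      fix u assume "u \<in> Actions X"
      then obtain i v where iv: "i \<in> Ob J" "v \<in> Actions (FOb D i)" "u = qa i v" and u: "u \<in> L"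
        by (auto simp: sel L_def)
      show "Labelling Y (snd h u) = Labelling X u"
        using u ga[OF iv(1,2)] lab[OF iv(1,2)] whdts_mapD(3)[OF mi(2)[OF iv(1)] iv(2)]
        by (simp add: h_def sel iv(3))
    next
      fix t assume t: "t \<in> Trans X"
      have "(fst h \<alpha>, map (snd h) us, fst h \<beta>) \<in> Trans Y" if "(\<alpha>, us, \<beta>) \<in> B" for \<alpha> us \<beta>
      proof -
        obtain i \<alpha>' us' \<beta>' where i: "i \<in> Ob J" and tr: "(\<alpha>', us', \<beta>') \<in> Trans (FOb D i)"
          and eq: "\<alpha> = qs i \<alpha>'" "us = map (qa i) us'" "\<beta> = qs i \<beta>'"
          using \<open>(\<alpha>, us, \<beta>) \<in> B\<close> by (auto simp: B_def)
        note wf = whdts_Trans[OF DW[OF i] tr]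
        have "qs i s \<in> S" if "s \<in> States (FOb D i)" for s using i that by (auto simp: S_def)
        moreover have "qa i u \<in> L" if "u \<in> Actions (FOb D i)" for u using i that by (auto simp: L_def)
        ultimately have "fst h \<alpha> = fst (mm i) \<alpha>'" "fst h \<beta> = fst (mm i) \<beta>'"
          "map (snd h) us = map (snd (mm i)) us'"
          using wf gs[OF i] ga[OF i] by (auto simp: h_def eq)
        then show ?thesis using whdts_mapD(4)[OF mi(2)[OF i] tr] by simp
      qed
      from generated_transitions_map[OF t[unfolded sel] Y this]
      show "case t of (\<alpha>, us, \<beta>) \<Rightarrow> (fst h \<alpha>, map (snd h) us, fst h \<beta>) \<in> Trans Y" .
    qed
    have factor: "wmap_comp (FOb D i) k (lm i) = mm i \<longleftrightarrow>
        (\<forall>s\<in>States (FOb D i). fst k (qs i s) = gs (qs i s)) \<and>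
        (\<forall>u\<in>Actions (FOb D i). snd k (qa i u) = ga (qa i u))" if i: "i \<in> Ob J" for i k
    proof -
      note mp = whdts_mapD(1,2)[OF mi(2)[OF i]]
      have "compose (States (FOb D i)) (fst k) (fst (lm i)) = fst (mm i) \<longleftrightarrow>
          (\<forall>s\<in>States (FOb D i). fst k (qs i s) = gs (qs i s))"
        using mp(1) gs[OF i] by (auto simp: fun_eq_iff compose_def lm_def PiE_iff extensional_def)
      moreover have "compose (Actions (FOb D i)) (snd k) (snd (lm i)) = snd (mm i) \<longleftrightarrow>
          (\<forall>u\<in>Actions (FOb D i). snd k (qa i u) = ga (qa i u))"
        using mp(2) ga[OF i] by (auto simp: fun_eq_iff compose_def lm_def PiE_iff extensional_def)
      ultimately show ?thesis by (simp add: wmap_comp_def prod_eq_iff)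
    qed
    show "\<exists>!h. h \<in> Hom ?W X Y \<and> (\<forall>i\<in>Ob J. Comp ?W h (l i) = m i)"
    proof (rule ex1I[of _ "(X, h, Y)"])
      have "wmap_comp (FOb D i) h (lm i) = mm i" if "i \<in> Ob J" for i
        unfolding factor[OF that] using that by (auto simp: h_def S_def L_def)
      then show "(X, h, Y) \<in> Hom ?W X Y \<and> (\<forall>i\<in>Ob J. Comp ?W (X, h, Y) (l i) = m i)"
        using X Y h mi(1) by (simp add: Hom_WHDTS l_def Comp_WHDTS)
    next
      fix h' assume h': "h' \<in> Hom ?W X Y \<and> (\<forall>i\<in>Ob J. Comp ?W h' (l i) = m i)"
      then obtain k where k: "h' = (X, k, Y)" "whdts_map X Y k" by (auto simp: Hom_WHDTS)
      have eq: "wmap_comp (FOb D i) k (lm i) = mm i" if "i \<in> Ob J" for i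
        using h' mi(1)[OF that] that by (auto simp: k(1) l_def Comp_WHDTS)
      note kp = whdts_mapD(1,2)[OF k(2), unfolded sel]
      have "fst k = fst h"
        using kp(1) eq factor by (intro ext) (auto simp: h_def S_def PiE_iff extensional_def restrict_def)
      moreover have "snd k = snd h"
        using kp(2) eq factor by (intro ext) (auto simp: h_def L_def PiE_iff extensional_def restrict_def)
      ultimately show "h' = (X, h, Y)" by (simp add: k(1) prod_eq_iff)
    qed
  qed
  then show ?thesis by blast
qed

section \<open>The category of labelled symmetric precubical sets\<close>

lemma Hom_LSPSET:
  "h \<in> Hom (LSPSET U \<Sigma>) X Y \<longleftrightarrow>
     (\<exists>\<phi>. h = (X, \<phi>, Y) \<and> is_lspset U \<Sigma> X \<and> is_lspset U \<Sigma> Y \<and> lspset_map X Y \<phi>)"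
  by (auto simp: Hom_def LSPSET_def)

lemma Ob_LSPSET: "X \<in> Ob (LSPSET U \<Sigma>) \<longleftrightarrow> is_lspset U \<Sigma> X"
  by (simp add: LSPSET_def)

lemma Comp_LSPSET: "Comp (LSPSET U \<Sigma>) (Y, \<psi>, Z) (X, \<phi>, Y') = (X, spset_comp (fst X) \<psi> \<phi>, Z)"
  by (simp add: LSPSET_def)

lemma Id_LSPSET: "Id (LSPSET U \<Sigma>) X = (X, spset_id (fst X), X)"
  by (simp add: LSPSET_def)

lemma spset_mapD:
  assumes "spset_map K K' \<phi>"
  shows "\<phi> n \<in> Cells K n \<rightarrow>\<^sub>E Cells K' n"
    "x \<in> Cells K n \<Longrightarrow> \<phi> n x \<in> Cells K' n"
    "cube_map m n f \<Longrightarrow> x \<in> Cells K n \<Longrightarrow> \<phi> m (Act K m n f x) = Act K' m n f (\<phi> n x)"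
  using assms unfolding spset_map_def by blast+

lemma spsetD:
  assumes "is_spset U K"
  shows "Cells K n \<in> U"
    "cube_map m n f \<Longrightarrow> x \<in> Cells K n \<Longrightarrow> Act K m n f x \<in> Cells K m"
    "x \<in> Cells K n \<Longrightarrow> Act K n n (\<lambda>\<epsilon>\<in>cube n. \<epsilon>) x = x"
    "cube_map l m g \<Longrightarrow> cube_map m n f \<Longrightarrow> x \<in> Cells K n \<Longrightarrow>
      Act K l n (compose (cube l) f g) x = Act K l m g (Act K m n f x)"
  using assms unfolding is_spset_def by (blast, blast, simp, simp add: compose_def)

lemma lspset_mapD:
  assumes "lspset_map X Y \<phi>"
  shows "spset_map (fst X) (fst Y) \<phi>"
    "x \<in> Cells (fst X) n \<Longrightarrow> snd Y n (\<phi> n x) = snd X n x"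
proof -
  show "spset_map (fst X) (fst Y) \<phi>" using assms by (simp add: lspset_map_def)
  have "spset_comp (fst X) (snd Y) \<phi> n x = snd X n x" using assms by (simp add: lspset_map_def)
  then show "x \<in> Cells (fst X) n \<Longrightarrow> snd Y n (\<phi> n x) = snd X n x"
    by (simp add: spset_comp_def compose_def)
qed

lemma lspset_mapI:
  assumes "spset_map (fst X) (fst Y) \<phi>" and X: "is_lspset U \<Sigma> X"
    and "\<And>n x. x \<in> Cells (fst X) n \<Longrightarrow> snd Y n (\<phi> n x) = snd X n x"
  shows "lspset_map X Y \<phi>"
proof -
  have "snd X n \<in> extensional (Cells (fst X) n)" for n
    using X unfolding is_lspset_def spset_map_def by (auto simp: PiE_iff)
  then have "spset_comp (fst X) (snd Y) \<phi> = snd X"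
    using assms(3) by (intro ext) (auto simp: spset_comp_def compose_def extensional_def)
  then show ?thesis using assms(1) by (simp add: lspset_map_def)
qed

lemma spset_map_comp:
  assumes "spset_map K K' \<phi>" "spset_map K' K'' \<psi>" "is_spset U K"
  shows "spset_map K K'' (spset_comp K \<psi> \<phi>)"
  unfolding spset_map_def
proof (intro conjI allI impI ballI)
  show "spset_comp K \<psi> \<phi> n \<in> Cells K n \<rightarrow>\<^sub>E Cells K'' n" for n
    using spset_mapD(2)[OF assms(1)] spset_mapD(2)[OF assms(2)]
    by (auto simp: spset_comp_def compose_def)
  show "spset_comp K \<psi> \<phi> m (Act K m n f x) = Act K'' m n f (spset_comp K \<psi> \<phi> n x)"
    if "cube_map m n f" "x \<in> Cells K n" for m n f x
    using that spset_mapD(2,3)[OF assms(1)] spset_mapD(3)[OF assms(2)] spsetD(2)[OF assms(3)]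
    by (simp add: spset_comp_def compose_def)
qed

lemma lspset_map_comp:
  assumes X: "is_lspset U \<Sigma> X" and f: "lspset_map X Y \<phi>" and g: "lspset_map Y Z \<psi>"
  shows "lspset_map X Z (spset_comp (fst X) \<psi> \<phi>)"
proof (rule lspset_mapI[OF _ X])
  show "spset_map (fst X) (fst Z) (spset_comp (fst X) \<psi> \<phi>)"
    using X by (intro spset_map_comp[OF lspset_mapD(1)[OF f] lspset_mapD(1)[OF g], of U])
      (simp add: is_lspset_def)
  show "snd Z n (spset_comp (fst X) \<psi> \<phi> n x) = snd X n x" if "x \<in> Cells (fst X) n" for n x
    using that lspset_mapD(2)[OF f] lspset_mapD(2)[OF g] spset_mapD(2)[OF lspset_mapD(1)[OF f]]
    by (simp add: spset_comp_def compose_def)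
qed

lemma lspset_map_id:
  assumes X: "is_lspset U \<Sigma> X" shows "lspset_map X X (spset_id (fst X))"
proof (rule lspset_mapI[OF _ X])
  have "is_spset U (fst X)" using X by (simp add: is_lspset_def)
  then show "spset_map (fst X) (fst X) (spset_id (fst X))"
    using spsetD(2)[of U "fst X"] by (auto simp: spset_map_def spset_id_def)
qed (simp add: spset_id_def)

lemma is_category_LSPSET: "is_category (LSPSET U \<Sigma>)"
  unfolding is_category_def
proof (intro conjI allI ballI)
  fix h assume "h \<in> Arr (LSPSET U \<Sigma>)"
  then show "Dom (LSPSET U \<Sigma>) h \<in> Ob (LSPSET U \<Sigma>)" "Cod (LSPSET U \<Sigma>) h \<in> Ob (LSPSET U \<Sigma>)"
    by (auto simp: LSPSET_def)
next
  fix X assume "X \<in> Ob (LSPSET U \<Sigma>)"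
  then show "Id (LSPSET U \<Sigma>) X \<in> Hom (LSPSET U \<Sigma>) X X"
    unfolding Hom_LSPSET Ob_LSPSET Id_LSPSET using lspset_map_id by blast
next
  fix X Y Z f g assume "f \<in> Hom (LSPSET U \<Sigma>) X Y" "g \<in> Hom (LSPSET U \<Sigma>) Y Z"
  then obtain \<phi> \<psi> where fg: "f = (X, \<phi>, Y)" "g = (Y, \<psi>, Z)" and XZ: "is_lspset U \<Sigma> X" "is_lspset U \<Sigma> Z"
    and m: "lspset_map X Y \<phi>" "lspset_map Y Z \<psi>"
    unfolding Hom_LSPSET by blast
  show "Comp (LSPSET U \<Sigma>) g f \<in> Hom (LSPSET U \<Sigma>) X Z"
    unfolding Hom_LSPSET fg Comp_LSPSET using XZ lspset_map_comp[OF XZ(1) m] by blast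
next
  fix X Y f assume "f \<in> Hom (LSPSET U \<Sigma>) X Y"
  then obtain \<phi> where f: "f = (X, \<phi>, Y)" "lspset_map X Y \<phi>" unfolding Hom_LSPSET by blast
  note \<phi> = spset_mapD(1)[OF lspset_mapD(1)[OF f(2)]]
  have "spset_comp (fst X) \<phi> (spset_id (fst X)) = \<phi>" "spset_comp (fst X) (spset_id (fst Y)) \<phi> = \<phi>"
    using \<phi> by (auto simp: spset_comp_def spset_id_def compose_Id_left compose_Id_right PiE_iff)
  then show "Comp (LSPSET U \<Sigma>) f (Id (LSPSET U \<Sigma>) X) = f"
    "Comp (LSPSET U \<Sigma>) (Id (LSPSET U \<Sigma>) Y) f = f"
    by (simp_all add: f(1) Comp_LSPSET Id_LSPSET)
next
  fix W X Y Z f g h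
  assume "f \<in> Hom (LSPSET U \<Sigma>) W X" "g \<in> Hom (LSPSET U \<Sigma>) X Y" "h \<in> Hom (LSPSET U \<Sigma>) Y Z"
  then obtain \<phi> \<psi> \<chi> where fgh: "f = (W, \<phi>, X)" "g = (X, \<psi>, Y)" "h = (Y, \<chi>, Z)"
    and \<phi>: "lspset_map W X \<phi>"
    unfolding Hom_LSPSET by blast
  have \<phi>_n: "\<phi> n \<in> Cells (fst W) n \<rightarrow> Cells (fst X) n" for n
    using spset_mapD(2)[OF lspset_mapD(1)[OF \<phi>]] by blast
  show "Comp (LSPSET U \<Sigma>) h (Comp (LSPSET U \<Sigma>) g f) = Comp (LSPSET U \<Sigma>) (Comp (LSPSET U \<Sigma>) h g) f"
    unfolding fgh Comp_LSPSET spset_comp_def by (simp only: compose_compose[OF \<phi>_n])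
qed

section \<open>The cubes as weak higher dimensional transition systems\<close>

definition cube_action :: "'x elem list \<Rightarrow> nat \<Rightarrow> 'x elem" where
  "cube_action a i = Indexed (a ! (i - 1)) i"

text \<open>
  The conditions \<open>\<epsilon>\<^sub>i \<le> \<epsilon>'\<^sub>i\<close> for all \<open>i\<close> and \<open>\<epsilon>\<^sub>i \<noteq> \<epsilon>'\<^sub>i\<close> exactly for \<open>i\<close> in the list together say that \<open>\<epsilon>'\<close>
  arises from \<open>\<epsilon>\<close> by raising the listed coordinates from \<open>0\<close> to \<open>1\<close>.
\<close>

definition cube_step :: "nat \<Rightarrow> bool list \<Rightarrow> nat list \<Rightarrow> bool list \<Rightarrow> bool" where
  "cube_step n \<epsilon> is \<epsilon>' \<longleftrightarrow>
     \<epsilon> \<in> cube n \<and> \<epsilon>' \<in> cube n \<and> is \<noteq> [] \<and> distinct is \<and> set is \<subseteq> {1..n} \<and>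
     (\<forall>i\<in>{1..n}. \<epsilon>' ! (i - 1) \<longleftrightarrow> \<epsilon> ! (i - 1) \<or> i \<in> set is) \<and>
     (\<forall>i\<in>set is. \<not> \<epsilon> ! (i - 1))"

lemma inj_cube_action: "inj (cube_action a)"
  by (auto simp: inj_def cube_action_def)

lemma States_cube_whdts: "States (cube_whdts a) = Vertex ` cube (length a)"
  by (simp add: cube_whdts_def)

lemma Actions_cube_whdts: "Actions (cube_whdts a) = cube_action a ` {1..length a}"
  by (auto simp: cube_whdts_def cube_action_def)

lemma Labelling_cube_whdts:
  "i \<in> {1..length a} \<Longrightarrow> Labelling (cube_whdts a) (cube_action a i) = a ! (i - 1)"
  by (auto simp: cube_whdts_def cube_action_def)

lemma Trans_cube_whdts:
  "t \<in> Trans (cube_whdts a) \<longleftrightarrow>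
     (\<exists>\<epsilon> is \<epsilon>'. t = (Vertex \<epsilon>, map (cube_action a) is, Vertex \<epsilon>') \<and> cube_step (length a) \<epsilon> is \<epsilon>')"
proof -
  have "(\<forall>i\<in>{1..n}. \<epsilon> ! (i - 1) \<le> \<epsilon>' ! (i - 1)) \<and> (\<forall>i\<in>{1..n}. \<epsilon> ! (i - 1) \<noteq> \<epsilon>' ! (i - 1) \<longleftrightarrow> i \<in> set is) \<longleftrightarrow>
      (\<forall>i\<in>{1..n}. \<epsilon>' ! (i - 1) \<longleftrightarrow> \<epsilon> ! (i - 1) \<or> i \<in> set is) \<and> (\<forall>i\<in>set is. \<not> \<epsilon> ! (i - 1))"
    if "set is \<subseteq> {1..n}" for n and "is" :: "nat list" and \<epsilon> \<epsilon>' :: "bool list"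
    using that by (auto simp only: le_bool_def subset_iff)
  then have "cube_step n \<epsilon> is \<epsilon>' \<longleftrightarrow>
     \<epsilon> \<in> cube n \<and> \<epsilon>' \<in> cube n \<and> is \<noteq> [] \<and> distinct is \<and> set is \<subseteq> {1..n} \<and>
     (\<forall>i\<in>{1..n}. \<epsilon> ! (i - 1) \<le> \<epsilon>' ! (i - 1)) \<and>
     (\<forall>i\<in>{1..n}. \<epsilon> ! (i - 1) \<noteq> \<epsilon>' ! (i - 1) \<longleftrightarrow> i \<in> set is)" for n "is" \<epsilon> \<epsilon>'
    unfolding cube_step_def by blast
  then show ?thesis
    unfolding cube_whdts_def whdts.simps cube_action_def mem_Collect_eq by (simp only:)
qed

lemma Trans_cube_whdts_iff:
  "(Vertex \<epsilon>, map (cube_action a) is, Vertex \<epsilon>') \<in> Trans (cube_whdts a) \<longleftrightarrow> cube_step (length a) \<epsilon> is \<epsilon>'"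
  unfolding Trans_cube_whdts by (auto simp: inj_map_eq_map[OF inj_cube_action])

lemma Trans_cube_whdts_cases:
  assumes "(\<alpha>, us, \<beta>) \<in> Trans (cube_whdts a)"
  obtains \<epsilon> "is" \<epsilon>' where "\<alpha> = Vertex \<epsilon>" "us = map (cube_action a) is" "\<beta> = Vertex \<epsilon>'"
    "cube_step (length a) \<epsilon> is \<epsilon>'"
  using assms unfolding Trans_cube_whdts by blast

lemma cube_step_permute:
  "cube_step n \<epsilon> is \<epsilon>' \<Longrightarrow> \<sigma> permutes {..<length is} \<Longrightarrow> cube_step n \<epsilon> (permute_list \<sigma> is) \<epsilon>'"
  by (auto simp: cube_step_def set_permute_list distinct_permute_list simp flip: length_greater_0_conv)

text \<open>
  The coherence axiom for cubes: the list of the larger step splits into the list of the smaller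
  step and a disjoint remainder, and the latter leads from the intermediate vertex to the final one.
\<close>

lemma cube_step_between:
  assumes 1: "cube_step n \<epsilon> (take p is) \<epsilon>1" and 2: "cube_step n \<epsilon> (take (p + q) is) \<epsilon>2"
    and nonempty: "take q (drop p is) \<noteq> []"
  shows "cube_step n \<epsilon>1 (take q (drop p is)) \<epsilon>2"
proof -
  have d: "distinct (take p is @ take q (drop p is))"
    and s: "set (take (p + q) is) = set (take p is) \<union> set (take q (drop p is))"
    using 2 by (simp_all add: cube_step_def take_add)
  show ?thesis
    using 1 2 nonempty d unfolding cube_step_def s by auto
qed

lemma is_whdts_cube_whdts:
  fixes U :: "'x elem set set"
  assumes U: "universe U" and a: "set a \<subseteq> \<Sigma>"
  shows "is_whdts U \<Sigma> (cube_whdts a)"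
  unfolding is_whdts_def
proof (intro conjI allI impI)
  show "States (cube_whdts a) \<in> U" "Actions (cube_whdts a) \<in> U"
    by (auto intro!: universe_finite[OF U] simp: States_cube_whdts Actions_cube_whdts finite_cube)
  have "Labelling (cube_whdts a) \<in> extensional (Actions (cube_whdts a))"
    by (simp add: cube_whdts_def)
  moreover have "a ! (i - 1) \<in> \<Sigma>" if "i \<in> {1..length a}" for i
    using that a by (auto simp: subset_iff)
  ultimately show "Labelling (cube_whdts a) \<in> Actions (cube_whdts a) \<rightarrow>\<^sub>E \<Sigma>"
    using Labelling_cube_whdts[of _ a] by (auto simp: PiE_iff Actions_cube_whdts)
  show "Trans (cube_whdts a) \<subseteq> {(\<alpha>, us, \<beta>). \<alpha> \<in> States (cube_whdts a) \<and> \<beta> \<in> States (cube_whdts a) \<and>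
      us \<noteq> [] \<and> set us \<subseteq> Actions (cube_whdts a)}"
    by (auto simp: Trans_cube_whdts cube_step_def States_cube_whdts Actions_cube_whdts
        simp del: atLeastAtMost_iff intro!: imageI elim!: subsetD)
next
  fix \<alpha> us \<beta> \<sigma>
  assume *: "2 \<le> length us \<and> \<sigma> permutes {..<length us} \<and> (\<alpha>, us, \<beta>) \<in> Trans (cube_whdts a)"
  then obtain \<epsilon> "is" \<epsilon>' where eq: "\<alpha> = Vertex \<epsilon>" "us = map (cube_action a) is" "\<beta> = Vertex \<epsilon>'"
    and step: "cube_step (length a) \<epsilon> is \<epsilon>'" by (blast elim: Trans_cube_whdts_cases)
  have \<sigma>: "\<sigma> permutes {..<length is}" using * eq by simp
  show "(\<alpha>, permute_list \<sigma> us, \<beta>) \<in> Trans (cube_whdts a)"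
    unfolding eq permute_list_map[OF \<sigma>] Trans_cube_whdts_iff by (rule cube_step_permute[OF step \<sigma>])
next
  fix \<alpha> us \<beta> p q \<nu>1 \<nu>2
  assume *: "3 \<le> length us \<and> 1 \<le> p \<and> 1 \<le> q \<and> p + q < length us \<and> (\<alpha>, us, \<beta>) \<in> Trans (cube_whdts a) \<and>
    (\<alpha>, take p us, \<nu>1) \<in> Trans (cube_whdts a) \<and> (\<nu>1, drop p us, \<beta>) \<in> Trans (cube_whdts a) \<and>
    (\<alpha>, take (p + q) us, \<nu>2) \<in> Trans (cube_whdts a) \<and> (\<nu>2, drop (p + q) us, \<beta>) \<in> Trans (cube_whdts a)"
  then obtain \<epsilon> "is" \<epsilon>' where eq: "\<alpha> = Vertex \<epsilon>" "us = map (cube_action a) is" "\<beta> = Vertex \<epsilon>'"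
    by (blast elim: Trans_cube_whdts_cases)
  obtain \<epsilon>1 where \<epsilon>1: "\<nu>1 = Vertex \<epsilon>1" using * by (blast elim: Trans_cube_whdts_cases)
  obtain \<epsilon>2 where \<epsilon>2: "\<nu>2 = Vertex \<epsilon>2" using * by (blast elim: Trans_cube_whdts_cases)
  have "cube_step (length a) \<epsilon> (take p is) \<epsilon>1" "cube_step (length a) \<epsilon> (take (p + q) is) \<epsilon>2"
    using * unfolding eq \<epsilon>1 \<epsilon>2 take_map Trans_cube_whdts_iff by blast+
  moreover have "take q (drop p is) \<noteq> []" using * by (auto simp: eq)
  ultimately show "(\<nu>1, take q (drop p us), \<nu>2) \<in> Trans (cube_whdts a)"
    unfolding eq \<epsilon>1 \<epsilon>2 take_map drop_map Trans_cube_whdts_iff by (rule cube_step_between)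
qed

lemma cube_map_in: "cube_map m n f \<Longrightarrow> \<epsilon> \<in> cube m \<Longrightarrow> f \<epsilon> \<in> cube n"
  using cube_map_cube by blast

lemma inj_on_position: "cube_map m n f \<Longrightarrow> inj_on (position m n f) {1..m}"
  by (rule inj_onI) (metis position_spec(2) coord.inject)

text \<open>
  Coordinate \<open>j\<close> of \<open>f \<epsilon>\<close> is either a coordinate \<open>i\<close> of \<open>\<epsilon>\<close>, where \<open>j\<close> is the position of \<open>i\<close>, or constant.
  In the second case \<open>j\<close> is not a position, so it is not raised.
\<close>

lemma cube_map_step:
  assumes f: "cube_map m n f" and step: "cube_step m \<epsilon> is \<epsilon>'"
  shows "cube_step n (f \<epsilon>) (map (position m n f) is) (f \<epsilon>')"
proof -
  let ?h = "hat m n f"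
  have h: "coordinates m n f ?h" by (rule hat_coordinates[OF f])
  have nth: "f e ! (j - 1) = coord_value e (?h j)" if "e \<in> cube m" "j \<in> {1..n}" for e j
    using h that by (auto simp: coordinates_def simp del: upt_Suc)
  have ee: "\<epsilon> \<in> cube m" "\<epsilon>' \<in> cube m" and d: "distinct is" and sub: "set is \<subseteq> {1..m}"
    using step by (auto simp: cube_step_def)
  have pos_nth: "f e ! (position m n f i - 1) = e ! (i - 1)" if "e \<in> cube m" "i \<in> {1..m}" for e i
    using nth[OF that(1) position_spec(1)[OF f that(2)]] position_spec(2)[OF f that(2)] by simp
  have "f \<epsilon>' ! (j - 1) \<longleftrightarrow> f \<epsilon> ! (j - 1) \<or> j \<in> position m n f ` set is" if j: "j \<in> {1..n}" for j
  proof -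
    have "?h j \<in> Coord ` {1..m} \<union> {MinusInf, PlusInf}" using h j unfolding coordinates_def by blast
    then consider i where "i \<in> {1..m}" "?h j = Coord i" | "?h j = MinusInf" | "?h j = PlusInf" by blast
    then show ?thesis
    proof cases
      case 1
      have j_eq: "j = position m n f i" by (rule position_spec(3)[OF f 1(1) j 1(2)])
      have "j \<in> position m n f ` set is \<longleftrightarrow> i \<in> set is"
        unfolding j_eq by (rule inj_on_image_mem_iff[OF inj_on_position[OF f] 1(1) sub])
      then show ?thesis
        using step 1(1) unfolding j_eq pos_nth[OF ee(1) 1(1)] pos_nth[OF ee(2) 1(1)] cube_step_def by blast
    next
      case 2
      then have "j \<notin> position m n f ` set is" using position_spec(2)[OF f] sub by force
      then show ?thesis using nth[OF ee(1) j] nth[OF ee(2) j] 2 by simp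
    next
      case 3
      then show ?thesis using nth[OF ee(1) j] nth[OF ee(2) j] by simp
    qed
  qed
  moreover have "\<not> f \<epsilon> ! (position m n f i - 1)" if "i \<in> set is" for i
  proof -
    have i: "i \<in> {1..m}" using that sub by blast
    show ?thesis using step that unfolding pos_nth[OF ee(1) i] cube_step_def by blast
  qed
  moreover have "distinct (map (position m n f) is)"
    using d inj_on_subset[OF inj_on_position[OF f] sub] by (simp add: distinct_map)
  moreover have "position m n f ` set is \<subseteq> {1..n}" using position_spec(1)[OF f] sub by blast
  ultimately show ?thesis
    using cube_map_in[OF f] ee step by (simp add: cube_step_def)
qed

definition cube_fun ::
  "'x elem list \<Rightarrow> 'x elem list \<Rightarrow> (bool list \<Rightarrow> bool list) \<Rightarrow> ('x elem \<Rightarrow> 'x elem) \<times> ('x elem \<Rightarrow> 'x elem)" where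
  "cube_fun a b f = fst (snd (cube_whdts_map a b f))"

lemma cube_whdts_map_eq: "cube_whdts_map a b f = (cube_whdts a, cube_fun a b f, cube_whdts b)"
  by (simp add: cube_fun_def cube_whdts_map_def)

lemma fst_cube_fun: "fst (cube_fun a b f) = (\<lambda>s\<in>Vertex ` cube (length a). case s of Vertex \<epsilon> \<Rightarrow> Vertex (f \<epsilon>))"
  by (simp add: cube_fun_def cube_whdts_map_def States_cube_whdts)

lemma snd_cube_fun_extensional: "snd (cube_fun a b f) \<in> extensional (Actions (cube_whdts a))"
  by (simp add: cube_fun_def cube_whdts_map_def)

lemma nth_word_act:
  assumes "i \<in> {1..m}" shows "word_act m n f b ! (i - 1) = b ! (position m n f i - 1)"
  using assms by (cases i) (auto simp: word_act_def simp del: upt_Suc)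

lemma length_word_act [simp]: "length (word_act m n f b) = m"
  by (simp add: word_act_def)

lemma snd_cube_fun:
  assumes "i \<in> {1..m}" "length b = n"
  shows "snd (cube_fun (word_act m n f b) b f) (cube_action (word_act m n f b) i)
    = cube_action b (position m n f i)"
  using assms imageI[of i "{1..m}" "cube_action (word_act m n f b)"]
  by (simp add: cube_fun_def cube_whdts_map_def Actions_cube_whdts)
     (simp add: cube_action_def nth_word_act del: One_nat_def)

lemma whdts_map_cube_fun:
  assumes f: "cube_map m n f" and b: "length b = n"
  shows "whdts_map (cube_whdts (word_act m n f b)) (cube_whdts b) (cube_fun (word_act m n f b) b f)"
    (is "whdts_map ?A ?B ?f")
  unfolding whdts_map_def
proof (intro conjI ballI)
  show "fst ?f \<in> States ?A \<rightarrow>\<^sub>E States ?B"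
    using cube_map_in[OF f] b by (auto simp: fst_cube_fun States_cube_whdts)
  show "snd ?f \<in> Actions ?A \<rightarrow>\<^sub>E Actions ?B"
    using snd_cube_fun_extensional[of "word_act m n f b" b f] snd_cube_fun[OF _ b] position_spec(1)[OF f] b
    by (auto simp: PiE_iff Actions_cube_whdts simp del: atLeastAtMost_iff)
  fix u assume "u \<in> Actions ?A"
  then obtain i where i: "i \<in> {1..m}" "u = cube_action (word_act m n f b) i"
    by (auto simp: Actions_cube_whdts)
  show "Labelling ?B (snd ?f u) = Labelling ?A u"
    unfolding i(2) snd_cube_fun[OF i(1) b]
    using i(1) position_spec(1)[OF f i(1)] b
    by (simp add: Labelling_cube_whdts nth_word_act del: One_nat_def)
next
  fix t assume "t \<in> Trans ?A"
  then obtain \<epsilon> "is" \<epsilon>' where t: "t = (Vertex \<epsilon>, map (cube_action (word_act m n f b)) is, Vertex \<epsilon>')"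
    and step: "cube_step m \<epsilon> is \<epsilon>'" unfolding Trans_cube_whdts by auto
  have "map (snd ?f) (map (cube_action (word_act m n f b)) is) = map (cube_action b) (map (position m n f) is)"
    using step snd_cube_fun[OF _ b] by (auto simp: cube_step_def)
  moreover have "fst ?f (Vertex \<epsilon>) = Vertex (f \<epsilon>)" "fst ?f (Vertex \<epsilon>') = Vertex (f \<epsilon>')"
    using step by (auto simp: cube_step_def fst_cube_fun)
  ultimately show "case t of (\<alpha>, us, \<beta>) \<Rightarrow> (fst ?f \<alpha>, map (snd ?f) us, fst ?f \<beta>) \<in> Trans ?B"
    unfolding t prod.case using cube_map_step[OF f step] Trans_cube_whdts_iff b by metis
qed

lemma cube_fun_comp:
  assumes g: "cube_map l m g" and f: "cube_map m n f" and b: "length b = n"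
    and a: "a = word_act m n f b" and a': "a' = word_act l m g a"
  shows "wmap_comp (cube_whdts a') (cube_fun a b f) (cube_fun a' a g) = cube_fun a' b (compose (cube l) f g)"
proof (rule prod_eqI)
  have a'': "a' = word_act l n (compose (cube l) f g) b"
    by (simp add: a a' word_act_comp[OF g f])
  have l: "length a = m" "length a' = l" by (simp_all add: a a')
  show "fst (wmap_comp (cube_whdts a') (cube_fun a b f) (cube_fun a' a g)) = fst (cube_fun a' b (compose (cube l) f g))"
    using cube_map_in[OF g]
    by (intro ext) (auto simp: wmap_comp_def compose_def fst_cube_fun States_cube_whdts l)
  show "snd (wmap_comp (cube_whdts a') (cube_fun a b f) (cube_fun a' a g)) = snd (cube_fun a' b (compose (cube l) f g))"
    (is "?p = ?q")
  proof (rule extensionalityI[of _ "Actions (cube_whdts a')"])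
    show "?p \<in> extensional (Actions (cube_whdts a'))" by (simp add: wmap_comp_def)
    show "?q \<in> extensional (Actions (cube_whdts a'))" by (rule snd_cube_fun_extensional)
    fix u assume u: "u \<in> Actions (cube_whdts a')"
    then obtain i where i: "i \<in> {1..l}" "u = cube_action a' i" by (auto simp: Actions_cube_whdts l)
    have "snd (cube_fun a' a g) u = cube_action a (position l m g i)"
      unfolding i(2) a' by (rule snd_cube_fun[OF i(1) l(1)])
    moreover have "snd (cube_fun a b f) (cube_action a (position l m g i)) = cube_action b (position m n f (position l m g i))"
      unfolding a by (rule snd_cube_fun[OF position_spec(1)[OF g i(1)] b])
    moreover have "?q u = cube_action b (position l n (compose (cube l) f g) i)"
      unfolding i(2) a'' by (rule snd_cube_fun[OF i(1) b])
    ultimately show "?p u = ?q u"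
      using u position_comp[OF g f i(1)] by (simp add: wmap_comp_def compose_def)
  qed
qed

lemma cube_fun_id:
  assumes n: "length a = n" shows "cube_fun a a (\<lambda>\<epsilon>\<in>cube n. \<epsilon>) = wmap_id (cube_whdts a)"
proof (rule prod_eqI)
  show "fst (cube_fun a a (\<lambda>\<epsilon>\<in>cube n. \<epsilon>)) = fst (wmap_id (cube_whdts a))"
    by (intro ext) (auto simp: fst_cube_fun wmap_id_def States_cube_whdts n)
  show "snd (cube_fun a a (\<lambda>\<epsilon>\<in>cube n. \<epsilon>)) = snd (wmap_id (cube_whdts a))" (is "?p = ?q")
  proof (rule extensionalityI[of _ "Actions (cube_whdts a)"])
    show "?p \<in> extensional (Actions (cube_whdts a))" by (rule snd_cube_fun_extensional)
    show "?q \<in> extensional (Actions (cube_whdts a))" by (simp add: wmap_id_def)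
    fix u assume u: "u \<in> Actions (cube_whdts a)"
    then obtain i where i: "i \<in> {1..n}" "u = cube_action a i" by (auto simp: Actions_cube_whdts n)
    have "word_act n n (\<lambda>\<epsilon>\<in>cube n. \<epsilon>) a = a" using word_act_id[of a] by (simp add: n)
    then have "?p u = cube_action a (position n n (\<lambda>\<epsilon>\<in>cube n. \<epsilon>) i)"
      using snd_cube_fun[OF i(1) n, of "\<lambda>\<epsilon>\<in>cube n. \<epsilon>"] i(2) by simp
    then show "?p u = ?q u" using u i position_id[OF i(1)] by (simp add: wmap_id_def)
  qed
qed

section \<open>The nerve of a weak higher dimensional transition system\<close>

text \<open>
  The cells of the nerve have to be elements of the type \<open>'x elem\<close>, so a map from the cube on \<open>a\<close> is coded
  by the tables of its values on vertices and on actions, together with the word \<open>a\<close>. As cubes are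
  finite, all tables into a small set form a small set even though power sets of small sets
  may be large.
\<close>

definition cell_code ::
  "'x elem list \<Rightarrow> ('x elem \<Rightarrow> 'x elem) \<times> ('x elem \<Rightarrow> 'x elem) \<Rightarrow> 'x elem" where
  "cell_code a g =
     Word [Word (map (\<lambda>\<epsilon>. fst g (Vertex \<epsilon>)) (List.n_lists (length a) [False, True])),
           Word (map (\<lambda>i. snd g (cube_action a i)) [1..<Suc (length a)]),
           Word a]"

definition cell_word :: "'x elem \<Rightarrow> 'x elem list" where
  "cell_word x = (case x of Word ws \<Rightarrow> (case ws ! 2 of Word a \<Rightarrow> a))"

text \<open>
  The target of a map is not part of its code. It is left open here, since the code determines the
  values of the map and hence the map.
\<close>

definition cell_map :: "'x elem \<Rightarrow> ('x elem \<Rightarrow> 'x elem) \<times> ('x elem \<Rightarrow> 'x elem)" where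
  "cell_map x = (SOME g. (\<exists>Y. whdts_map (cube_whdts (cell_word x)) Y g) \<and> cell_code (cell_word x) g = x)"

lemma cell_word_code [simp]: "cell_word (cell_code a g) = a"
  by (simp add: cell_word_def cell_code_def)

lemma cell_code_inject:
  assumes g: "whdts_map (cube_whdts a) Y g" and h: "whdts_map (cube_whdts a) Z h"
    and eq: "cell_code a g = cell_code a h"
  shows "g = h"
proof (rule prod_eqI)
  have "set (List.n_lists (length a) [False, True]) = cube (length a)"
    by (auto simp: set_n_lists cube_def)
  then have s: "fst g (Vertex \<epsilon>) = fst h (Vertex \<epsilon>)" if "\<epsilon> \<in> cube (length a)" for \<epsilon>
    using eq that by (simp add: cell_code_def)
  have t: "snd g (cube_action a i) = snd h (cube_action a i)" if "i \<in> {1..length a}" for i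
    using eq that by (simp add: cell_code_def del: upt_Suc)
  show "fst g = fst h"
    by (rule extensionalityI[of _ "States (cube_whdts a)"])
       (use whdts_mapD(1)[OF g] whdts_mapD(1)[OF h] s in \<open>auto simp: PiE_iff States_cube_whdts\<close>)
  show "snd g = snd h"
    by (rule extensionalityI[of _ "Actions (cube_whdts a)"])
       (use whdts_mapD(2)[OF g] whdts_mapD(2)[OF h] t in \<open>auto simp: PiE_iff Actions_cube_whdts\<close>)
qed

lemma cell_map_code [simp]:
  assumes g: "whdts_map (cube_whdts a) Y g" shows "cell_map (cell_code a g) = g"
  unfolding cell_map_def cell_word_code
proof (rule some_equality)
  show "(\<exists>Y. whdts_map (cube_whdts a) Y g) \<and> cell_code a g = cell_code a g" using g by blast
  show "h = g" if "(\<exists>Y. whdts_map (cube_whdts a) Y h) \<and> cell_code a h = cell_code a g" for h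
    using that cell_code_inject[OF _ g] by blast
qed

definition nerve_cells :: "'x elem set \<Rightarrow> 'x elem whdts \<Rightarrow> nat \<Rightarrow> 'x elem set" where
  "nerve_cells \<Sigma> Y n =
     {cell_code a g | a g. length a = n \<and> set a \<subseteq> \<Sigma> \<and> whdts_map (cube_whdts a) Y g}"

definition restrict_cell :: "nat \<Rightarrow> nat \<Rightarrow> (bool list \<Rightarrow> bool list) \<Rightarrow> 'x elem \<Rightarrow> 'x elem" where
  "restrict_cell m n f x =
     (let a = cell_word x; b = word_act m n f a
      in cell_code b (wmap_comp (cube_whdts b) (cell_map x) (cube_fun b a f)))"

definition nerve :: "'x elem set \<Rightarrow> 'x elem whdts \<Rightarrow> 'x elem lspset" where
  "nerve \<Sigma> Y =
     (\<lparr>Cells = nerve_cells \<Sigma> Y,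
       Act = (\<lambda>m n f. if cube_map m n f then (\<lambda>x\<in>nerve_cells \<Sigma> Y n. restrict_cell m n f x) else undefined)\<rparr>,
      (\<lambda>n. \<lambda>x\<in>nerve_cells \<Sigma> Y n. Word (cell_word x)))"

definition nerve_functor ::
  "'x elem set \<Rightarrow> ('x elem whdts, 'x elem whdts_arrow, 'x elem lspset, 'x elem lspset_arrow) fctr" where
  "nerve_functor \<Sigma> =
     \<lparr>FOb = nerve \<Sigma>,
      FArr = (\<lambda>(Y, k, Z). (nerve \<Sigma> Y,
        (\<lambda>n. \<lambda>x\<in>nerve_cells \<Sigma> Y n.
           cell_code (cell_word x) (wmap_comp (cube_whdts (cell_word x)) k (cell_map x))),
        nerve \<Sigma> Z))\<rparr>"

lemma nerve_cellsE:
  assumes "x \<in> nerve_cells \<Sigma> Y n"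
  obtains a g where "x = cell_code a g" "length a = n" "set a \<subseteq> \<Sigma>" "whdts_map (cube_whdts a) Y g"
  using assms unfolding nerve_cells_def by blast

lemma restrict_cell_code:
  "whdts_map (cube_whdts a) Y g \<Longrightarrow> restrict_cell m n f (cell_code a g) =
     cell_code (word_act m n f a)
       (wmap_comp (cube_whdts (word_act m n f a)) g (cube_fun (word_act m n f a) a f))"
  by (simp add: restrict_cell_def Let_def)

lemma universe_Un: 
  fixes U :: "'x elem set set"
  assumes U: "universe U" and "A \<in> U" "B \<in> U" shows "A \<union> B \<in> U"
proof -
  \<comment> \<open>Any two distinct elements serve as indices.\<close>
  have "(\<Union>i\<in>{Word [], Vertex [] :: 'x elem}. if i = Word [] then A else B) \<in> U"
    using assms by (intro universe_UN[OF U universe_finite[OF U]]) auto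
  then show ?thesis by (simp add: Un_commute)
qed

text \<open>
  The codes are triples of words of fixed lengths over small sets.
\<close>

lemma nerve_cells_small:
  assumes U: "universe U" and \<Sigma>: "\<Sigma> \<in> U" and Y: "is_whdts U \<Sigma> Y"
  shows "nerve_cells \<Sigma> Y n \<in> U"
proof -
  let ?S = "Word ` {w. length w = 2 ^ n \<and> set w \<subseteq> States Y}"
  let ?A = "Word ` {w. length w = n \<and> set w \<subseteq> Actions Y}"
  let ?L = "Word ` {w. length w = n \<and> set w \<subseteq> \<Sigma>}"
  have "States Y \<in> U" "Actions Y \<in> U" using Y by (auto simp: is_whdts_def)
  then have "Word ` {w. length w = 3 \<and> set w \<subseteq> ?S \<union> (?A \<union> ?L)} \<in> U"
    by (intro universe_words[OF U] universe_Un[OF U] \<Sigma>)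
  moreover have "nerve_cells \<Sigma> Y n \<subseteq> Word ` {w. length w = 3 \<and> set w \<subseteq> ?S \<union> (?A \<union> ?L)}"
  proof
    fix x assume "x \<in> nerve_cells \<Sigma> Y n"
    then obtain a g where x: "x = cell_code a g" and a: "length a = n" "set a \<subseteq> \<Sigma>"
      and g: "whdts_map (cube_whdts a) Y g" by (rule nerve_cellsE)
    have "fst g (Vertex \<epsilon>) \<in> States Y" if "\<epsilon> \<in> set (List.n_lists n [False, True])" for \<epsilon>
      using PiE_mem[OF whdts_mapD(1)[OF g]] that a(1) by (auto simp: States_cube_whdts cube_def set_n_lists)
    then have "Word (map (\<lambda>\<epsilon>. fst g (Vertex \<epsilon>)) (List.n_lists (length a) [False, True])) \<in> ?S"
      using a(1) by (intro imageI) (auto simp: length_n_lists numeral_2_eq_2)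
    moreover have "snd g (cube_action a i) \<in> Actions Y" if "i \<in> {1..n}" for i
      using PiE_mem[OF whdts_mapD(2)[OF g]] that a(1) by (auto simp: Actions_cube_whdts)
    then have "Word (map (\<lambda>i. snd g (cube_action a i)) [1..<Suc (length a)]) \<in> ?A"
      using a(1) by (intro imageI) (auto simp del: upt_Suc)
    moreover have "Word a \<in> ?L" using a by blast
    ultimately show "x \<in> Word ` {w. length w = 3 \<and> set w \<subseteq> ?S \<union> (?A \<union> ?L)}"
      unfolding x cell_code_def by (intro imageI) simp
  qed
  ultimately show ?thesis by (rule universe_subset[OF U])
qed

lemma Cells_nerve: "Cells (fst (nerve \<Sigma> Y)) = nerve_cells \<Sigma> Y"
  by (simp add: nerve_def)

lemma Act_nerve:
  "cube_map m n f \<Longrightarrow> x \<in> nerve_cells \<Sigma> Y n \<Longrightarrow> Act (fst (nerve \<Sigma> Y)) m n f x = restrict_cell m n f x"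
  by (simp add: nerve_def)

lemma snd_nerve: "x \<in> nerve_cells \<Sigma> Y n \<Longrightarrow> snd (nerve \<Sigma> Y) n x = Word (cell_word x)"
  by (simp add: nerve_def)

lemma restrict_cell_in:
  fixes U :: "'x elem set set" and \<Sigma> :: "'x elem set"
  assumes U: "universe U" and f: "cube_map m n f" and x: "x \<in> nerve_cells \<Sigma> Y n"
  shows "restrict_cell m n f x \<in> nerve_cells \<Sigma> Y m"
proof -
  obtain a g where x: "x = cell_code a g" and a: "length a = n" "set a \<subseteq> \<Sigma>"
    and g: "whdts_map (cube_whdts a) Y g" using x by (rule nerve_cellsE)
  have b: "set (word_act m n f a) \<subseteq> \<Sigma>" using word_act_in[OF f a] by simp
  have "whdts_map (cube_whdts (word_act m n f a)) Y
      (wmap_comp (cube_whdts (word_act m n f a)) g (cube_fun (word_act m n f a) a f))"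
    by (rule whdts_map_comp[OF is_whdts_cube_whdts[OF U b] whdts_map_cube_fun[OF f a(1)] g])
  then show ?thesis
    unfolding x restrict_cell_code[OF g] nerve_cells_def using b length_word_act by blast
qed

lemma restrict_cell_comp:
  fixes U :: "'x elem set set" and \<Sigma> :: "'x elem set"
  assumes U: "universe U" and g: "cube_map l m g" and f: "cube_map m n f" and x: "x \<in> nerve_cells \<Sigma> Y n"
  shows "restrict_cell l n (compose (cube l) f g) x = restrict_cell l m g (restrict_cell m n f x)"
proof -
  obtain a k where x: "x = cell_code a k" and a: "length a = n" "set a \<subseteq> \<Sigma>"
    and k: "whdts_map (cube_whdts a) Y k" using x by (rule nerve_cellsE)
  define b c where "b = word_act m n f a" and "c = word_act l m g b"
  have b: "set b \<subseteq> \<Sigma>" "length b = m" using word_act_in[OF f a] by (simp_all add: b_def)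
  have c: "set c \<subseteq> \<Sigma>" using word_act_in[OF g b(2,1)] by (simp add: c_def)
  have c': "c = word_act l n (compose (cube l) f g) a" by (simp add: b_def c_def word_act_comp[OF g f])
  have f': "whdts_map (cube_whdts b) (cube_whdts a) (cube_fun b a f)"
    unfolding b_def by (rule whdts_map_cube_fun[OF f a(1)])
  have g': "whdts_map (cube_whdts c) (cube_whdts b) (cube_fun c b g)"
    unfolding c_def by (rule whdts_map_cube_fun[OF g b(2)])
  have kf: "whdts_map (cube_whdts b) Y (wmap_comp (cube_whdts b) k (cube_fun b a f))"
    by (rule whdts_map_comp[OF is_whdts_cube_whdts[OF U b(1)] f' k])
  have "restrict_cell l m g (restrict_cell m n f x)
      = cell_code c (wmap_comp (cube_whdts c) (wmap_comp (cube_whdts b) k (cube_fun b a f)) (cube_fun c b g))"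
    unfolding x restrict_cell_code[OF k] b_def[symmetric] restrict_cell_code[OF kf] c_def[symmetric] ..
  also have "\<dots> = cell_code c (wmap_comp (cube_whdts c) k (cube_fun c a (compose (cube l) f g)))"
    unfolding wmap_comp_assoc[OF g', symmetric] cube_fun_comp[OF g f a(1) b_def c_def] ..
  also have "\<dots> = restrict_cell l n (compose (cube l) f g) x"
    unfolding x restrict_cell_code[OF k] c'[symmetric] ..
  finally show ?thesis by simp
qed

lemma restrict_cell_id:
  assumes x: "x \<in> nerve_cells \<Sigma> Y n"
  shows "restrict_cell n n (\<lambda>\<epsilon>\<in>cube n. \<epsilon>) x = x"
proof -
  obtain a k where x: "x = cell_code a k" and a: "length a = n" "set a \<subseteq> \<Sigma>"
    and k: "whdts_map (cube_whdts a) Y k" using x by (rule nerve_cellsE)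
  have "word_act n n (\<lambda>\<epsilon>\<in>cube n. \<epsilon>) a = a" using word_act_id[of a] by (simp add: a)
  then show ?thesis
    by (simp add: x restrict_cell_code[OF k] cube_fun_id[OF a(1)] wmap_comp_id_right[OF k])
qed

lemma is_lspset_nerve:
  assumes U: "universe U" and \<Sigma>: "\<Sigma> \<in> U" and Y: "is_whdts U \<Sigma> Y"
  shows "is_lspset U \<Sigma> (nerve \<Sigma> Y)"
  unfolding is_lspset_def
proof
  show "is_spset U (fst (nerve \<Sigma> Y))"
    unfolding is_spset_def Cells_nerve
  proof (intro conjI allI impI)
    show "nerve_cells \<Sigma> Y n \<in> U" for n by (rule nerve_cells_small[OF U \<Sigma> Y])
    show "Act (fst (nerve \<Sigma> Y)) m n f \<in> nerve_cells \<Sigma> Y n \<rightarrow>\<^sub>E nerve_cells \<Sigma> Y m"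
      if "cube_map m n f" for m n f
      using restrict_cell_in[OF U that] that by (auto simp: nerve_def)
    show "Act (fst (nerve \<Sigma> Y)) m n f = undefined" if "\<not> cube_map m n f" for m n f
      using that by (simp add: nerve_def)
    show "Act (fst (nerve \<Sigma> Y)) n n (\<lambda>\<epsilon>\<in>cube n. \<epsilon>) = (\<lambda>x\<in>nerve_cells \<Sigma> Y n. x)" for n
      using cube_map_id[of n] restrict_cell_id[of _ \<Sigma> Y n] by (auto simp: nerve_def)
    show "Act (fst (nerve \<Sigma> Y)) l n (compose (cube l) g f) =
        compose (nerve_cells \<Sigma> Y n) (Act (fst (nerve \<Sigma> Y)) l m f) (Act (fst (nerve \<Sigma> Y)) m n g)"
      if "cube_map l m f \<and> cube_map m n g" for l m n f g
      using that cube_map_comp[of l m f n g] restrict_cell_comp[OF U, of l m f n g _ \<Sigma> Y]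
        restrict_cell_in[OF U, of m n g _ \<Sigma> Y]
      by (intro ext) (simp add: nerve_def compose_def)
  qed
  show "spset_map (fst (nerve \<Sigma> Y)) (bang \<Sigma>) (snd (nerve \<Sigma> Y))"
    unfolding spset_map_def Cells_nerve
  proof (intro conjI allI impI ballI)
    show "snd (nerve \<Sigma> Y) n \<in> nerve_cells \<Sigma> Y n \<rightarrow>\<^sub>E Cells (bang \<Sigma>) n" for n
      by (auto simp: nerve_def bang_def elim!: nerve_cellsE)
    fix m n f x assume f: "cube_map m n f" and x: "x \<in> nerve_cells \<Sigma> Y n"
    obtain a g where x_eq: "x = cell_code a g" and a: "length a = n" "set a \<subseteq> \<Sigma>"
      and g: "whdts_map (cube_whdts a) Y g" using x by (rule nerve_cellsE)
    show "snd (nerve \<Sigma> Y) m (Act (fst (nerve \<Sigma> Y)) m n f x) = Act (bang \<Sigma>) m n f (snd (nerve \<Sigma> Y) n x)"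
      unfolding Act_nerve[OF f x] snd_nerve[OF x] snd_nerve[OF restrict_cell_in[OF U f x]]
      using f a by (simp add: x_eq restrict_cell_code[OF g] bang_def)
  qed
qed

section \<open>Maps into a nerve\<close>

definition label :: "'x elem lspset \<Rightarrow> nat \<Rightarrow> 'x elem \<Rightarrow> 'x elem list" where
  "label X n x = (case snd X n x of Word w \<Rightarrow> w)"

lemma
  assumes X: "is_lspset U \<Sigma> X" and x: "x \<in> Cells (fst X) n"
  shows snd_eq_label: "snd X n x = Word (label X n x)"
    and length_label: "length (label X n x) = n"
    and set_label: "set (label X n x) \<subseteq> \<Sigma>"
    and label_Act: "cube_map m n f \<Longrightarrow> label X m (Act (fst X) m n f x) = word_act m n f (label X n x)"
proof -
  have s: "spset_map (fst X) (bang \<Sigma>) (snd X)" using X by (simp add: is_lspset_def)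
  have "snd X n x \<in> Word ` {w. length w = n \<and> set w \<subseteq> \<Sigma>}"
    using spset_mapD(2)[OF s x] by (simp add: bang_def)
  then show 1: "snd X n x = Word (label X n x)" "length (label X n x) = n" "set (label X n x) \<subseteq> \<Sigma>"
    by (auto simp: label_def)
  show "label X m (Act (fst X) m n f x) = word_act m n f (label X n x)" if f: "cube_map m n f"
    using spset_mapD(3)[OF s f x] f 1(2,3) by (simp add: 1(1) bang_def label_def[of X m])
qed

lemma label_lspset_map:
  "lspset_map X Y \<phi> \<Longrightarrow> x \<in> Cells (fst X) n \<Longrightarrow> label Y n (\<phi> n x) = label X n x"
  by (simp add: label_def lspset_mapD(2))

text \<open>
  A map from \<open>X\<close> to the nerve of \<open>Y\<close>, with cells of the nerve replaced by the maps that they code.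
\<close>

definition cube_family ::
  "'x elem lspset \<Rightarrow> 'x elem whdts \<Rightarrow> (nat \<Rightarrow> 'x elem \<Rightarrow> ('x elem \<Rightarrow> 'x elem) \<times> ('x elem \<Rightarrow> 'x elem)) \<Rightarrow> bool" where
  "cube_family X Y k \<longleftrightarrow>
     (\<forall>n. \<forall>x\<in>Cells (fst X) n. whdts_map (cube_whdts (label X n x)) Y (k n x)) \<and>
     (\<forall>m n f. cube_map m n f \<longrightarrow> (\<forall>x\<in>Cells (fst X) n.
        k m (Act (fst X) m n f x) =
          wmap_comp (cube_whdts (word_act m n f (label X n x))) (k n x)
            (cube_fun (word_act m n f (label X n x)) (label X n x) f)))"

definition classify ::
  "'x elem lspset \<Rightarrow> (nat \<Rightarrow> 'x elem \<Rightarrow> ('x elem \<Rightarrow> 'x elem) \<times> ('x elem \<Rightarrow> 'x elem)) \<Rightarrow> nat \<Rightarrow> 'x elem \<Rightarrow> 'x elem" where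
  "classify X k = (\<lambda>n. \<lambda>x\<in>Cells (fst X) n. cell_code (label X n x) (k n x))"

lemma cube_familyD:
  assumes "cube_family X Y k"
  shows "x \<in> Cells (fst X) n \<Longrightarrow> whdts_map (cube_whdts (label X n x)) Y (k n x)"
    and "cube_map m n f \<Longrightarrow> x \<in> Cells (fst X) n \<Longrightarrow> k m (Act (fst X) m n f x) =
      wmap_comp (cube_whdts (word_act m n f (label X n x))) (k n x)
        (cube_fun (word_act m n f (label X n x)) (label X n x) f)"
  using assms unfolding cube_family_def by blast+

lemma lspset_map_classify:
  assumes U: "universe U" and X: "is_lspset U \<Sigma> X" and k: "cube_family X Y k"
  shows "lspset_map X (nerve \<Sigma> Y) (classify X k)"
proof (rule lspset_mapI[OF _ X])
  have cell: "cell_code (label X n x) (k n x) \<in> nerve_cells \<Sigma> Y n" if "x \<in> Cells (fst X) n" for n x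
    unfolding nerve_cells_def
    using cube_familyD(1)[OF k that] length_label[OF X that] set_label[OF X that] by blast
  have K: "is_spset U (fst X)" using X by (simp add: is_lspset_def)
  show "spset_map (fst X) (fst (nerve \<Sigma> Y)) (classify X k)"
    unfolding spset_map_def Cells_nerve
  proof (intro conjI allI impI ballI)
    show "classify X k n \<in> Cells (fst X) n \<rightarrow>\<^sub>E nerve_cells \<Sigma> Y n" for n
      using cell by (auto simp: classify_def)
    fix m n f x assume f: "cube_map m n f" and x: "x \<in> Cells (fst X) n"
    show "classify X k m (Act (fst X) m n f x) = Act (fst (nerve \<Sigma> Y)) m n f (classify X k n x)"
      using spsetD(2)[OF K f x] x
      by (simp add: classify_def Act_nerve[OF f cell[OF x]] label_Act[OF X x f]
          restrict_cell_code[OF cube_familyD(1)[OF k x]] cube_familyD(2)[OF k f x])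
  qed
  show "snd (nerve \<Sigma> Y) n (classify X k n x) = snd X n x" if "x \<in> Cells (fst X) n" for n x
    using that by (simp add: classify_def snd_nerve[OF cell[OF that]] snd_eq_label[OF X that])
qed

text \<open>
  Together with \<open>lspset_map_classify\<close> this identifies the maps from \<open>X\<close> to the nerve of \<open>Y\<close> with the families of
  cubes in \<open>Y\<close> indexed by the cells of \<open>X\<close>.
\<close>

lemma lspset_map_nerve:
  assumes U: "universe U" and X: "is_lspset U \<Sigma> X" and \<phi>: "lspset_map X (nerve \<Sigma> Y) \<phi>"
  shows "cube_family X Y (\<lambda>n x. cell_map (\<phi> n x))" and "classify X (\<lambda>n x. cell_map (\<phi> n x)) = \<phi>"
proof -
  note s = lspset_mapD(1)[OF \<phi>]
  have K: "is_spset U (fst X)" using X by (simp add: is_lspset_def)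
  have \<phi>_cell: "\<phi> n x \<in> nerve_cells \<Sigma> Y n" if "x \<in> Cells (fst X) n" for n x
    using spset_mapD(2)[OF s that] by (simp add: Cells_nerve)
  have word: "cell_word (\<phi> n x) = label X n x" if "x \<in> Cells (fst X) n" for n x
    using lspset_mapD(2)[OF \<phi> that, symmetric] snd_nerve[OF \<phi>_cell[OF that]] by (simp add: label_def)
  have code: "whdts_map (cube_whdts (label X n x)) Y (cell_map (\<phi> n x))"
    "\<phi> n x = cell_code (label X n x) (cell_map (\<phi> n x))" if x: "x \<in> Cells (fst X) n" for n x
  proof -
    obtain a g where ag: "\<phi> n x = cell_code a g" "whdts_map (cube_whdts a) Y g"
      using \<phi>_cell[OF x] by (rule nerve_cellsE)
    have "a = label X n x" using word[OF x] by (simp add: ag(1))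
    then show "whdts_map (cube_whdts (label X n x)) Y (cell_map (\<phi> n x))"
      "\<phi> n x = cell_code (label X n x) (cell_map (\<phi> n x))" using ag cell_map_code[OF ag(2)] by simp_all
  qed
  show "cube_family X Y (\<lambda>n x. cell_map (\<phi> n x))"
    unfolding cube_family_def
  proof (intro conjI allI impI ballI)
    show "whdts_map (cube_whdts (label X n x)) Y (cell_map (\<phi> n x))" if "x \<in> Cells (fst X) n" for n x
      by (rule code(1)[OF that])
    fix m n f x assume f: "cube_map m n f" and x: "x \<in> Cells (fst X) n"
    let ?a = "label X n x" and ?b = "word_act m n f (label X n x)"
    have fx: "Act (fst X) m n f x \<in> Cells (fst X) m" by (rule spsetD(2)[OF K f x])
    have "cell_code ?b (cell_map (\<phi> m (Act (fst X) m n f x))) = restrict_cell m n f (\<phi> n x)"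
      using code(2)[OF fx] spset_mapD(3)[OF s f x]
      by (simp add: label_Act[OF X x f] Act_nerve[OF f \<phi>_cell[OF x]])
    then have eq: "cell_code ?b (cell_map (\<phi> m (Act (fst X) m n f x)))
        = cell_code ?b (wmap_comp (cube_whdts ?b) (cell_map (\<phi> n x)) (cube_fun ?b ?a f))"
      by (simp add: restrict_cell_def word[OF x] Let_def)
    have lhs: "whdts_map (cube_whdts ?b) Y (cell_map (\<phi> m (Act (fst X) m n f x)))"
      using code(1)[OF fx] by (simp add: label_Act[OF X x f])
    show "cell_map (\<phi> m (Act (fst X) m n f x))
        = wmap_comp (cube_whdts ?b) (cell_map (\<phi> n x)) (cube_fun ?b ?a f)"
      using cell_code_inject[OF lhs whdts_map_comp[OF is_whdts_cube_whdts[OF U] whdts_map_cube_fun[OF f length_label[OF X x]] code(1)[OF x]] eq]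
        word_act_in(2)[OF f length_label[OF X x] set_label[OF X x]] by simp
  qed
  show "classify X (\<lambda>n x. cell_map (\<phi> n x)) = \<phi>"
  proof (intro ext)
    fix n x
    show "classify X (\<lambda>n x. cell_map (\<phi> n x)) n x = \<phi> n x"
      using code(2)[of x n] spset_mapD(1)[OF s, of n] by (auto simp: classify_def PiE_iff extensional_def)
  qed
qed

lemma nerve_arrow_classify:
  assumes X: "is_lspset U \<Sigma> X" and k: "cube_family X Y k"
  shows "Comp (LSPSET U \<Sigma>) (FArr (nerve_functor \<Sigma>) (Y, h, Z)) (X, classify X k, nerve \<Sigma> Y)
    = (X, classify X (\<lambda>n x. wmap_comp (cube_whdts (label X n x)) h (k n x)), nerve \<Sigma> Z)"
proof -
  have "cell_code (label X n x) (k n x) \<in> nerve_cells \<Sigma> Y n" if "x \<in> Cells (fst X) n" for n x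
    unfolding nerve_cells_def
    using cube_familyD(1)[OF k that] length_label[OF X that] set_label[OF X that] by blast
  then show ?thesis
    using cell_map_code[OF cube_familyD(1)[OF k]]
    by (auto simp: nerve_functor_def Comp_LSPSET spset_comp_def compose_def classify_def fun_eq_iff)
qed

lemma cube_family_postcomp:
  assumes U: "universe U" and X: "is_lspset U \<Sigma> X" and k: "cube_family X Y k" and h: "whdts_map Y Z h"
  shows "cube_family X Z (\<lambda>n x. wmap_comp (cube_whdts (label X n x)) h (k n x))"
  unfolding cube_family_def
proof (intro conjI allI impI ballI)
  show "whdts_map (cube_whdts (label X n x)) Z (wmap_comp (cube_whdts (label X n x)) h (k n x))"
    if x: "x \<in> Cells (fst X) n" for n x
    by (rule whdts_map_comp[OF is_whdts_cube_whdts[OF U set_label[OF X x]] cube_familyD(1)[OF k x] h])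
  fix m n f x assume f: "cube_map m n f" and x: "x \<in> Cells (fst X) n"
  show "wmap_comp (cube_whdts (label X m (Act (fst X) m n f x))) h (k m (Act (fst X) m n f x)) =
      wmap_comp (cube_whdts (word_act m n f (label X n x)))
        (wmap_comp (cube_whdts (label X n x)) h (k n x))
        (cube_fun (word_act m n f (label X n x)) (label X n x) f)"
    unfolding label_Act[OF X x f] cube_familyD(2)[OF k f x]
    by (rule wmap_comp_assoc[OF whdts_map_cube_fun[OF f length_label[OF X x]]])
qed

lemma classify_inject:
  assumes "cube_family X Y k" "cube_family X Y k'"
  shows "classify X k = classify X k' \<longleftrightarrow> (\<forall>n. \<forall>x\<in>Cells (fst X) n. k n x = k' n x)"
proof
  assume eq: "classify X k = classify X k'"
  show "\<forall>n. \<forall>x\<in>Cells (fst X) n. k n x = k' n x"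
  proof (intro allI ballI)
    fix n x assume x: "x \<in> Cells (fst X) n"
    have "classify X k n x = classify X k' n x" by (simp add: eq)
    then show "k n x = k' n x"
      using x cell_code_inject[OF cube_familyD(1)[OF assms(1) x] cube_familyD(1)[OF assms(2) x]]
      by (simp add: classify_def)
  qed
qed (auto simp: classify_def fun_eq_iff)

text \<open>
  Under this identification, composing with the nerve of \<open>h\<close> composes each member of the family
  with \<open>h\<close>.
\<close>

lemma universal_arrow_nerveI:
  fixes U :: "'x elem set set"
  assumes U: "universe U" and X: "is_lspset U \<Sigma> X" and L: "is_whdts U \<Sigma> L" and k: "cube_family X L k"
    and nerve_L: "is_lspset U \<Sigma> (nerve \<Sigma> L)"
    and universal: "\<And>Y k'. is_whdts U \<Sigma> Y \<Longrightarrow> cube_family X Y k' \<Longrightarrow>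
      \<exists>!h. whdts_map L Y h \<and>
        (\<forall>n. \<forall>x\<in>Cells (fst X) n. wmap_comp (cube_whdts (label X n x)) h (k n x) = k' n x)"
  shows "universal_arrow (LSPSET U \<Sigma>) (WHDTS U \<Sigma>) (nerve_functor \<Sigma>) X L (X, classify X k, nerve \<Sigma> L)"
proof -
  have nerve_FOb: "FOb (nerve_functor \<Sigma>) = nerve \<Sigma>" by (simp add: nerve_functor_def)
  have "\<exists>!h. h \<in> Hom (WHDTS U \<Sigma>) L Y \<and>
      Comp (LSPSET U \<Sigma>) (FArr (nerve_functor \<Sigma>) h) (X, classify X k, nerve \<Sigma> L) = g"
    if Y: "is_whdts U \<Sigma> Y" and g: "g \<in> Hom (LSPSET U \<Sigma>) X (nerve \<Sigma> Y)" for Y g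
  proof -
    obtain \<phi> where g_eq: "g = (X, \<phi>, nerve \<Sigma> Y)" and \<phi>: "lspset_map X (nerve \<Sigma> Y) \<phi>"
      using g unfolding Hom_LSPSET by blast
    note k' = lspset_map_nerve[OF U X \<phi>]
    have iff: "Comp (LSPSET U \<Sigma>) (FArr (nerve_functor \<Sigma>) (L, h, Y)) (X, classify X k, nerve \<Sigma> L) = g \<longleftrightarrow>
        (\<forall>n. \<forall>x\<in>Cells (fst X) n. wmap_comp (cube_whdts (label X n x)) h (k n x) = cell_map (\<phi> n x))"
      if h: "whdts_map L Y h" for h
      unfolding nerve_arrow_classify[OF X k] g_eq
      using classify_inject[OF cube_family_postcomp[OF U X k h] k'(1)] k'(2) by simp
    obtain h where h: "whdts_map L Y h"
      "\<forall>n. \<forall>x\<in>Cells (fst X) n. wmap_comp (cube_whdts (label X n x)) h (k n x) = cell_map (\<phi> n x)"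
      and h_unique: "\<And>h'. whdts_map L Y h' \<Longrightarrow>
        \<forall>n. \<forall>x\<in>Cells (fst X) n. wmap_comp (cube_whdts (label X n x)) h' (k n x) = cell_map (\<phi> n x) \<Longrightarrow> h' = h"
      using universal[OF Y k'(1)] by (elim ex1E) blast
    show ?thesis
    proof (rule ex1I[of _ "(L, h, Y)"])
      show "(L, h, Y) \<in> Hom (WHDTS U \<Sigma>) L Y \<and>
          Comp (LSPSET U \<Sigma>) (FArr (nerve_functor \<Sigma>) (L, h, Y)) (X, classify X k, nerve \<Sigma> L) = g"
        using iff[OF h(1)] h L Y by (simp add: Hom_WHDTS)
      fix h' assume h': "h' \<in> Hom (WHDTS U \<Sigma>) L Y \<and>
          Comp (LSPSET U \<Sigma>) (FArr (nerve_functor \<Sigma>) h') (X, classify X k, nerve \<Sigma> L) = g"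
      then obtain p where "h' = (L, p, Y)" "whdts_map L Y p" unfolding Hom_WHDTS by blast
      then show "h' = (L, h, Y)" using h' iff h_unique by blast
    qed
  qed
  then show ?thesis
    unfolding universal_arrow_def nerve_FOb Ob_WHDTS Hom_LSPSET[of "(X, classify X k, nerve \<Sigma> L)"]
    by (intro conjI ballI) (use X L nerve_L lspset_map_classify[OF U X k] in \<open>auto simp: Ob_WHDTS\<close>)
qed

lemma classify_cong:
  "(\<And>n x. x \<in> Cells (fst X) n \<Longrightarrow> k n x = k' n x) \<Longrightarrow> classify X k = classify X k'"
  by (auto simp: classify_def fun_eq_iff)

text \<open>
  The nerve of \<open>h\<close> classifies the family obtained by composing the universal family with \<open>h\<close>, so that
  functoriality reduces to associativity.
\<close>

theorem is_functor_nerve: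
  fixes U :: "'x elem set set"
  assumes U: "universe U" and \<Sigma>: "\<Sigma> \<in> U"
  shows "is_functor (WHDTS U \<Sigma>) (LSPSET U \<Sigma>) (nerve_functor \<Sigma>)"
proof -
  note N = is_lspset_nerve[OF U \<Sigma>]
  \<comment> \<open>The family of cubes in \<open>Y\<close> classified by the identity of the nerve of \<open>Y\<close>.\<close>
  define k where "k Y n x = cell_map (spset_id (fst (nerve \<Sigma> Y)) n x)" for Y :: "'x elem whdts" and n x
  have k: "cube_family (nerve \<Sigma> Y) Y (k Y)"
    and k_id: "classify (nerve \<Sigma> Y) (k Y) = spset_id (fst (nerve \<Sigma> Y))"
    if "is_whdts U \<Sigma> Y" for Y
    using lspset_map_nerve[OF U N[OF that] lspset_map_id[OF N[OF that]]] by (simp_all add: k_def[abs_def])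
  have FArr_eq: "FArr (nerve_functor \<Sigma>) (Y, h, Z) = (nerve \<Sigma> Y,
      classify (nerve \<Sigma> Y) (\<lambda>n x. wmap_comp (cube_whdts (label (nerve \<Sigma> Y) n x)) h (k Y n x)), nerve \<Sigma> Z)"
    for Y h Z
    by (auto simp: nerve_functor_def classify_def Cells_nerve label_def snd_nerve k_def spset_id_def fun_eq_iff)
  show ?thesis
    unfolding is_functor_def
  proof (intro conjI ballI allI)
    fix Y assume "Y \<in> Ob (WHDTS U \<Sigma>)"
    then have Y: "is_whdts U \<Sigma> Y" by (simp add: Ob_WHDTS)
    show "FOb (nerve_functor \<Sigma>) Y \<in> Ob (LSPSET U \<Sigma>)"
      using N[OF Y] by (simp add: nerve_functor_def Ob_LSPSET)
    have "classify (nerve \<Sigma> Y) (\<lambda>n x. wmap_comp (cube_whdts (label (nerve \<Sigma> Y) n x)) (wmap_id Y) (k Y n x))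
        = classify (nerve \<Sigma> Y) (k Y)"
      by (rule classify_cong) (rule wmap_comp_id_left[OF cube_familyD(1)[OF k[OF Y]]])
    then show "FArr (nerve_functor \<Sigma>) (Id (WHDTS U \<Sigma>) Y) = Id (LSPSET U \<Sigma>) (FOb (nerve_functor \<Sigma>) Y)"
      unfolding Id_WHDTS FArr_eq Id_LSPSET by (simp add: k_id[OF Y] nerve_functor_def)
  next
    fix Y Z h assume "h \<in> Hom (WHDTS U \<Sigma>) Y Z"
    then obtain p where p: "h = (Y, p, Z)" "is_whdts U \<Sigma> Y" "is_whdts U \<Sigma> Z" "whdts_map Y Z p"
      unfolding Hom_WHDTS by blast
    show "FArr (nerve_functor \<Sigma>) h \<in> Hom (LSPSET U \<Sigma>) (FOb (nerve_functor \<Sigma>) Y) (FOb (nerve_functor \<Sigma>) Z)"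
      unfolding p(1) FArr_eq Hom_LSPSET
      using N[OF p(2)] N[OF p(3)] lspset_map_classify[OF U N[OF p(2)] cube_family_postcomp[OF U N[OF p(2)] k[OF p(2)] p(4)]]
      by (simp add: nerve_functor_def)
  next
    fix W Y Z f g assume "f \<in> Hom (WHDTS U \<Sigma>) W Y" "g \<in> Hom (WHDTS U \<Sigma>) Y Z"
    then obtain p q where f: "f = (W, p, Y)" "is_whdts U \<Sigma> W" "whdts_map W Y p" and g: "g = (Y, q, Z)"
      unfolding Hom_WHDTS by blast
    note kW = k[OF f(2)]
    have "classify (nerve \<Sigma> W) (\<lambda>n x. wmap_comp (cube_whdts (label (nerve \<Sigma> W) n x)) (wmap_comp W q p) (k W n x))
      = classify (nerve \<Sigma> W) (\<lambda>n x. wmap_comp (cube_whdts (label (nerve \<Sigma> W) n x)) q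
          (wmap_comp (cube_whdts (label (nerve \<Sigma> W) n x)) p (k W n x)))"
      by (rule classify_cong) (rule wmap_comp_assoc[OF cube_familyD(1)[OF kW], symmetric])
    then show "FArr (nerve_functor \<Sigma>) (Comp (WHDTS U \<Sigma>) g f)
        = Comp (LSPSET U \<Sigma>) (FArr (nerve_functor \<Sigma>) g) (FArr (nerve_functor \<Sigma>) f)"
      unfolding f(1) g Comp_WHDTS FArr_eq[of W]
        nerve_arrow_classify[OF N[OF f(2)] cube_family_postcomp[OF U N[OF f(2)] kW f(3)]] by simp
  qed
qed

section \<open>Labelled cubes and the Yoneda lemma\<close>

lemma Cells_labelled_cube: "Cells (fst (labelled_cube a)) m = CubeMap ` {f. cube_map m (length a) f}"
  by (simp add: labelled_cube_def representable_def)

lemma Act_labelled_cube: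
  "cube_map l m g \<Longrightarrow> cube_map m (length a) f \<Longrightarrow>
     Act (fst (labelled_cube a)) l m g (CubeMap f) = CubeMap (compose (cube l) f g)"
  by (simp add: labelled_cube_def representable_def)

lemma label_labelled_cube:
  "cube_map m (length a) f \<Longrightarrow> label (labelled_cube a) m (CubeMap f) = word_act m (length a) f a"
  by (simp add: label_def labelled_cube_def representable_def)

lemma compose_cube_map_id: "cube_map m n f \<Longrightarrow> compose (cube m) f (\<lambda>\<epsilon>\<in>cube m. \<epsilon>) = f"
  using cube_map_cube by (auto intro!: compose_Id_right simp: PiE_iff)

lemma compose_id_cube_map: "cube_map m n f \<Longrightarrow> compose (cube m) (\<lambda>\<epsilon>\<in>cube n. \<epsilon>) f = f"
  using cube_map_cube by (auto intro!: compose_Id_left)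

lemma compose_cube_map_assoc:
  "cube_map k l f \<Longrightarrow> compose (cube k) h (compose (cube k) g f) = compose (cube k) (compose (cube l) h g) f"
  using cube_map_cube by (blast intro: compose_compose)

lemma is_lspset_labelled_cube:
  fixes U :: "'x elem set set"
  assumes U: "universe U" and a: "set a \<subseteq> \<Sigma>"
  shows "is_lspset U \<Sigma> (labelled_cube a)"
proof -
  let ?n = "length a"
  have K: "fst (labelled_cube a) = representable ?n" by (simp add: labelled_cube_def)
  have "is_spset U (representable ?n :: 'x elem spset)"
    unfolding is_spset_def
  proof (intro conjI allI impI)
    show "Cells (representable ?n :: 'x elem spset) m \<in> U" for m
      by (simp add: representable_def universe_finite[OF U] finite_cube_maps)
    show "Act (representable ?n :: 'x elem spset) l m g \<in> Cells (representable ?n) m \<rightarrow>\<^sub>E Cells (representable ?n) l"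
      if "cube_map l m g" for l m g
      using that by (auto simp: representable_def intro!: cube_map_comp)
    show "Act (representable ?n :: 'x elem spset) l m g = undefined" if "\<not> cube_map l m g" for l m g
      using that by (simp add: representable_def)
    show "Act (representable ?n :: 'x elem spset) m m (\<lambda>\<epsilon>\<in>cube m. \<epsilon>) = (\<lambda>x\<in>Cells (representable ?n) m. x)" for m
      using cube_map_id[of m] by (auto simp: representable_def fun_eq_iff compose_cube_map_id)
    show "Act (representable ?n :: 'x elem spset) k m (compose (cube k) h g)
        = compose (Cells (representable ?n) m) (Act (representable ?n) k l g) (Act (representable ?n) l m h)"
      if "cube_map k l g \<and> cube_map l m h" for k l m g h
      using that cube_map_comp[of k l g m h] cube_map_comp[of l m h ?n]
      by (auto simp: representable_def fun_eq_iff compose_def[of "_ ` _"] compose_cube_map_assoc)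
  qed
  moreover have "spset_map (representable ?n) (bang \<Sigma>) (snd (labelled_cube a))"
    unfolding spset_map_def
  proof (intro conjI allI impI ballI)
    show "snd (labelled_cube a) m \<in> Cells (representable ?n) m \<rightarrow>\<^sub>E Cells (bang \<Sigma>) m" for m
      using word_act_in[OF _ refl a] by (auto simp: labelled_cube_def bang_def representable_def)
    fix l m g x assume g: "cube_map l m g" and x: "x \<in> Cells (representable ?n :: 'x elem spset) m"
    then obtain f where f: "x = CubeMap f" "cube_map m ?n f" by (auto simp: representable_def)
    show "snd (labelled_cube a) l (Act (representable ?n) l m g x) = Act (bang \<Sigma>) l m g (snd (labelled_cube a) m x)"
      using g f cube_map_comp[OF g f(2)] word_act_in[OF f(2) refl a]
      by (simp add: labelled_cube_def bang_def representable_def word_act_comp)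
  qed
  ultimately show ?thesis by (simp add: is_lspset_def K)
qed

text \<open>
  The map from the cube \<open>\<box>\<^sub>S[n]\<close> to \<open>X\<close> that corresponds to the \<open>n\<close>-cell \<open>x\<close> by the Yoneda lemma.
\<close>

definition yoneda :: "'x elem lspset \<Rightarrow> nat \<Rightarrow> 'x elem \<Rightarrow> nat \<Rightarrow> 'x elem \<Rightarrow> 'x elem" where
  "yoneda X n x = (\<lambda>m. \<lambda>z\<in>CubeMap ` {f. cube_map m n f}. case z of CubeMap f \<Rightarrow> Act (fst X) m n f x)"

lemma yoneda_CubeMap: "cube_map m n f \<Longrightarrow> yoneda X n x m (CubeMap f) = Act (fst X) m n f x"
  by (simp add: yoneda_def)

lemma lspset_map_yoneda:
  fixes U :: "'x elem set set" and \<Sigma> :: "'x elem set"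
  assumes U: "universe U" and X: "is_lspset U \<Sigma> X" and x: "x \<in> Cells (fst X) n"
  shows "lspset_map (labelled_cube (label X n x)) X (yoneda X n x)"
proof -
  let ?a = "label X n x"
  have K: "is_spset U (fst X)" using X by (simp add: is_lspset_def)
  note n = length_label[OF X x]
  show ?thesis
  proof (rule lspset_mapI[OF _ is_lspset_labelled_cube[OF U set_label[OF X x]]])
    show "spset_map (fst (labelled_cube ?a)) (fst X) (yoneda X n x)"
      unfolding spset_map_def Cells_labelled_cube n
    proof (intro conjI allI impI ballI)
      show "yoneda X n x m \<in> CubeMap ` {f. cube_map m n f} \<rightarrow>\<^sub>E Cells (fst X) m" for m
        using spsetD(2)[OF K _ x] by (auto simp: yoneda_def)
      fix l m g and z :: "'x elem" assume g: "cube_map l m g" and "z \<in> CubeMap ` {f. cube_map m n f}"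
      then obtain f where f: "z = CubeMap f" "cube_map m n f" by blast
      show "yoneda X n x l (Act (fst (labelled_cube ?a)) l m g z) = Act (fst X) l m g (yoneda X n x m z)"
        using g f cube_map_comp[OF g f(2)]
        by (simp add: Act_labelled_cube n yoneda_CubeMap spsetD(4)[OF K g f(2) x])
    qed
    fix m z assume "z \<in> Cells (fst (labelled_cube ?a)) m"
    then obtain f where f: "z = CubeMap f" "cube_map m n f" by (auto simp: Cells_labelled_cube n)
    have "snd (labelled_cube ?a) m z = Word (word_act m n f ?a)"
      using f by (simp add: labelled_cube_def representable_def n)
    then show "snd X m (yoneda X n x m z) = snd (labelled_cube ?a) m z"
      using snd_eq_label[OF X spsetD(2)[OF K f(2) x]] label_Act[OF X x f(2)]
      by (simp add: f(1) yoneda_CubeMap[OF f(2)])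
  qed
qed

lemma yoneda_id:
  assumes X: "is_lspset U \<Sigma> X" and x: "x \<in> Cells (fst X) n"
  shows "yoneda X n x n (CubeMap (\<lambda>\<epsilon>\<in>cube n. \<epsilon>)) = x"
  unfolding yoneda_CubeMap[OF cube_map_id] using spsetD(3)[of U "fst X" x n] X x by (simp add: is_lspset_def)

lemma lspset_map_labelled_cube_eq_yoneda:
  assumes \<phi>: "lspset_map (labelled_cube a) Z \<phi>" and n: "length a = n"
  shows "\<phi> = yoneda Z n (\<phi> n (CubeMap (\<lambda>\<epsilon>\<in>cube n. \<epsilon>)))"
proof (intro ext)
  note s = lspset_mapD(1)[OF \<phi>]
  fix m z
  show "\<phi> m z = yoneda Z n (\<phi> n (CubeMap (\<lambda>\<epsilon>\<in>cube n. \<epsilon>))) m z"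
  proof (cases "z \<in> CubeMap ` {f. cube_map m n f}")
    case True
    then obtain f where f: "z = CubeMap f" "cube_map m n f" by blast
    have id: "CubeMap (\<lambda>\<epsilon>\<in>cube n. \<epsilon>) \<in> Cells (fst (labelled_cube a)) n"
      using cube_map_id by (simp add: Cells_labelled_cube n)
    have "Act (fst (labelled_cube a)) m n f (CubeMap (\<lambda>\<epsilon>\<in>cube n. \<epsilon>)) = CubeMap f"
      using Act_labelled_cube[OF f(2), of a "\<lambda>\<epsilon>\<in>cube n. \<epsilon>"] cube_map_id[of n]
      by (simp add: n compose_id_cube_map[OF f(2)])
    then show ?thesis
      using spset_mapD(3)[OF s f(2) id] by (simp add: f(1) yoneda_CubeMap[OF f(2)])
  next
    case False
    then show ?thesis
      using spset_mapD(1)[OF s, of m] by (auto simp: yoneda_def Cells_labelled_cube n PiE_iff extensional_def)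
  qed
qed

text \<open>
  Naturality of the Yoneda correspondence. Taking for \<open>x\<close> a cell \<open>CubeMap f\<close> of a cube, it describes the
  composition of the maps of cubes and the restriction of cells.
\<close>

lemma spset_comp_yoneda:
  assumes X: "is_lspset U \<Sigma> X" and \<phi>: "lspset_map X Z \<phi>" and x: "x \<in> Cells (fst X) n" and n: "length a = n"
  shows "spset_comp (fst (labelled_cube a)) \<phi> (yoneda X n x) = yoneda Z n (\<phi> n x)"
proof (intro ext)
  fix m z
  show "spset_comp (fst (labelled_cube a)) \<phi> (yoneda X n x) m z = yoneda Z n (\<phi> n x) m z"
    using spset_mapD(3)[OF lspset_mapD(1)[OF \<phi>] _ x, of m]
    by (auto simp: spset_comp_def compose_def Cells_labelled_cube n yoneda_def)
qed

text \<open>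
  The identity of \<open>[n]\<close> is a map to \<open>[p]\<close> only if \<open>n = p\<close>, and then its label in the labelled cube is
  the word itself.
\<close>

lemma labelled_cube_inject:
  assumes "labelled_cube a = labelled_cube b" shows "a = b"
proof -
  let ?id = "\<lambda>a. \<lambda>\<epsilon>\<in>cube (length a). \<epsilon>"
  have mem: "CubeMap (?id a) \<in> Cells (fst (labelled_cube a)) (length a)" for a :: "'x elem list"
    using cube_map_id by (simp add: Cells_labelled_cube)
  have "CubeMap (?id a) \<in> Cells (fst (labelled_cube b)) (length a)" using mem[of a] assms by simp
  then have "cube_map (length a) (length b) (?id a)" by (auto simp: Cells_labelled_cube)
  then have "?id a (replicate (length a) False) \<in> cube (length b)"
    by (rule cube_map_in) (simp add: cube_def)
  then have len: "length a = length b" by (simp add: cube_def)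
  have "label (labelled_cube a) (length a) (CubeMap (?id a)) = a" for a :: "'x elem list"
    unfolding label_labelled_cube[OF cube_map_id] by (rule word_act_id)
  from this[of a] this[of b] show ?thesis unfolding assms len by (rule trans[OF sym])
qed

section \<open>The category of cells\<close>

text \<open>
  The category of elements of the presheaf: an arrow from an \<open>m\<close>-cell to an \<open>n\<close>-cell \<open>y\<close> is a map
  \<open>f : [m] \<rightarrow> [n]\<close> along which \<open>y\<close> restricts to the \<open>m\<close>-cell. Objects and arrows are coded in \<open>'x elem\<close>, because
  preservation of colimits is about index categories with objects and arrows of that type.
\<close>

definition cells_category :: "'x elem lspset \<Rightarrow> ('x elem, 'x elem) category" where
  "cells_category X =
     \<lparr>Ob = (\<Union>n. (\<lambda>x. Indexed x n) ` Cells (fst X) n),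
      Arr = (\<Union>m. \<Union>n. \<Union>y\<in>Cells (fst X) n.
        (\<lambda>f. Word [Indexed (Act (fst X) m n f y) m, CubeMap f, Indexed y n]) ` {f. cube_map m n f}),
      Dom = (\<lambda>w. case w of Word ws \<Rightarrow> ws ! 0),
      Cod = (\<lambda>w. case w of Word ws \<Rightarrow> ws ! 2),
      Id = (\<lambda>i. case i of Indexed x n \<Rightarrow> Word [i, CubeMap (\<lambda>\<epsilon>\<in>cube n. \<epsilon>), i]),
      Comp = (\<lambda>w v. case w of Word ws \<Rightarrow> case v of Word vs \<Rightarrow>
        case ws ! 1 of CubeMap g \<Rightarrow> case vs ! 1 of CubeMap f \<Rightarrow> case vs ! 0 of Indexed x m \<Rightarrow>
          Word [vs ! 0, CubeMap (compose (cube m) g f), ws ! 2])\<rparr>"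

definition cell_arrow :: "'x elem lspset \<Rightarrow> nat \<Rightarrow> nat \<Rightarrow> (bool list \<Rightarrow> bool list) \<Rightarrow> 'x elem \<Rightarrow> 'x elem" where
  "cell_arrow X m n f y = Word [Indexed (Act (fst X) m n f y) m, CubeMap f, Indexed y n]"

lemma Ob_cells_category: "i \<in> Ob (cells_category X) \<longleftrightarrow> (\<exists>n. \<exists>x\<in>Cells (fst X) n. i = Indexed x n)"
  by (auto simp: cells_category_def)

lemma Hom_cells_category:
  "w \<in> Hom (cells_category X) i j \<longleftrightarrow>
     (\<exists>m n f. \<exists>y\<in>Cells (fst X) n. cube_map m n f \<and> i = Indexed (Act (fst X) m n f y) m \<and> j = Indexed y n \<and>
        w = cell_arrow X m n f y)"
  by (auto simp: cells_category_def Hom_def cell_arrow_def)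

lemma Comp_cells_category:
  assumes X: "is_lspset U \<Sigma> X" and "cube_map l m g" "cube_map m n f" "y \<in> Cells (fst X) n"
  shows "Comp (cells_category X) (cell_arrow X m n f y) (cell_arrow X l m g (Act (fst X) m n f y))
    = cell_arrow X l n (compose (cube l) f g) y"
  using assms spsetD(4)[of U "fst X" l m g n f y] by (simp add: cells_category_def cell_arrow_def is_lspset_def)

lemma Id_cells_category:
  assumes X: "is_lspset U \<Sigma> X" and "x \<in> Cells (fst X) n"
  shows "Id (cells_category X) (Indexed x n) = cell_arrow X n n (\<lambda>\<epsilon>\<in>cube n. \<epsilon>) x"
  using assms spsetD(3)[of U "fst X" x n] by (simp add: cells_category_def cell_arrow_def is_lspset_def)

lemma is_category_cells_category:
  assumes X: "is_lspset U \<Sigma> X"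
  shows "is_category (cells_category X)"
proof -
  let ?C = "cells_category X"
  have K: "is_spset U (fst X)" using X by (simp add: is_lspset_def)
  note act = spsetD(2)[OF K]
  show ?thesis
    unfolding is_category_def
  proof (intro conjI allI ballI)
    fix w assume "w \<in> Arr ?C"
    then show "Dom ?C w \<in> Ob ?C" "Cod ?C w \<in> Ob ?C"
      using act unfolding Ob_cells_category by (auto simp: cells_category_def)
  next
    fix i assume "i \<in> Ob ?C"
    then obtain n x where x: "x \<in> Cells (fst X) n" "i = Indexed x n" unfolding Ob_cells_category by blast
    show "Id ?C i \<in> Hom ?C i i"
      unfolding Hom_cells_category x(2) Id_cells_category[OF X x(1)]
      using x(1) cube_map_id[of n] spsetD(3)[OF K x(1)] by metis
  next
    fix i j k v w assume "v \<in> Hom ?C i j" "w \<in> Hom ?C j k"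
    then obtain l m n f g y where y: "y \<in> Cells (fst X) n" and gf: "cube_map l m g" "cube_map m n f"
      and v: "v = cell_arrow X l m g (Act (fst X) m n f y)" "i = Indexed (Act (fst X) l m g (Act (fst X) m n f y)) l"
      and w: "w = cell_arrow X m n f y" "k = Indexed y n"
      unfolding Hom_cells_category by auto
    show "Comp ?C w v \<in> Hom ?C i k"
      unfolding v w Comp_cells_category[OF X gf y] spsetD(4)[OF K gf y, symmetric] Hom_cells_category
      using y cube_map_comp[OF gf] by blast
  next
    fix i j w assume "w \<in> Hom ?C i j"
    then obtain m n f y where y: "y \<in> Cells (fst X) n" and f: "cube_map m n f"
      and w: "i = Indexed (Act (fst X) m n f y) m" "j = Indexed y n" "w = cell_arrow X m n f y"
      unfolding Hom_cells_category by blast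
    show "Comp ?C w (Id ?C i) = w"
      unfolding w Id_cells_category[OF X act[OF f y]] Comp_cells_category[OF X cube_map_id f y]
        compose_cube_map_id[OF f] ..
    show "Comp ?C (Id ?C j) w = w"
      using Comp_cells_category[OF X f cube_map_id y]
      unfolding w Id_cells_category[OF X y] compose_id_cube_map[OF f] spsetD(3)[OF K y] .
  next
    fix i j k l u v w
    assume "u \<in> Hom ?C i j" "v \<in> Hom ?C j k" "w \<in> Hom ?C k l"
    then obtain p q r s e f g y where y: "y \<in> Cells (fst X) s"
      and efg: "cube_map p q e" "cube_map q r f" "cube_map r s g"
      and u: "u = cell_arrow X p q e (Act (fst X) q r f (Act (fst X) r s g y))"
      and v: "v = cell_arrow X q r f (Act (fst X) r s g y)" and w: "w = cell_arrow X r s g y"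
      unfolding Hom_cells_category by auto
    note gy = act[OF efg(3) y]
    have u': "u = cell_arrow X p q e (Act (fst X) q s (compose (cube q) g f) y)"
      unfolding u spsetD(4)[OF K efg(2,3) y] ..
    have "Comp ?C w (Comp ?C v u) = cell_arrow X p s (compose (cube p) g (compose (cube p) f e)) y"
      unfolding w v u Comp_cells_category[OF X efg(1,2) gy]
        Comp_cells_category[OF X cube_map_comp[OF efg(1,2)] efg(3) y] ..
    moreover have "Comp ?C (Comp ?C w v) u = cell_arrow X p s (compose (cube p) (compose (cube q) g f) e) y"
      unfolding w v Comp_cells_category[OF X efg(2,3) y] u'
        Comp_cells_category[OF X efg(1) cube_map_comp[OF efg(2,3)] y] ..
    ultimately show "Comp ?C w (Comp ?C v u) = Comp ?C (Comp ?C w v) u"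
      by (simp add: compose_cube_map_assoc[OF efg(1)])
  qed
qed

text \<open>
  A universe contains an infinite set, hence a countably infinite one, which serves as an index set.
\<close>

lemma universe_UN_nat:
  fixes U :: "'e set set" and X :: "nat \<Rightarrow> 'e set"
  assumes U: "universe U" and X: "\<And>n. X n \<in> U" shows "(\<Union>n. X n) \<in> U"
proof -
  obtain A where A: "A \<in> U" "infinite A" using U by (auto simp: universe_def)
  then obtain \<iota> :: "nat \<Rightarrow> 'e" where \<iota>: "inj \<iota>" "range \<iota> \<subseteq> A" using infinite_countable_subset by blast
  have "range \<iota> \<in> U" by (rule universe_subset[OF U A(1) \<iota>(2)])
  then have "(\<Union>i\<in>range \<iota>. X (inv \<iota> i)) \<in> U" using X by (intro universe_UN[OF U])
  then show ?thesis using \<iota>(1) by simp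
qed

lemma cells_category_small:
  assumes U: "universe U" and X: "is_lspset U \<Sigma> X"
  shows "Ob (cells_category X) \<in> U" "Arr (cells_category X) \<in> U"
proof -
  have "Cells (fst X) n \<in> U" for n using X spsetD(1) by (simp add: is_lspset_def is_spset_def)
  then show "Ob (cells_category X) \<in> U" "Arr (cells_category X) \<in> U"
    unfolding cells_category_def category.simps
    by (intro universe_UN_nat[OF U] universe_image[OF U] universe_UN[OF U];
        simp add: universe_finite[OF U] finite_cube_maps)+
qed

section \<open>Labelled cubes are dense\<close>

definition labelled_cube_diagram :: "'x elem lspset \<Rightarrow> ('x elem, 'x elem, 'x elem lspset, 'x elem lspset_arrow) fctr" where
  "labelled_cube_diagram X =
     \<lparr>FOb = (\<lambda>i. case i of Indexed x n \<Rightarrow> labelled_cube (label X n x)),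
      FArr = (\<lambda>w. case w of Word ws \<Rightarrow>
        case ws ! 0 of Indexed x m \<Rightarrow> case ws ! 1 of CubeMap f \<Rightarrow> case ws ! 2 of Indexed y n \<Rightarrow>
          (labelled_cube (label X m x), yoneda (labelled_cube (label X n y)) m (CubeMap f),
           labelled_cube (label X n y)))\<rparr>"

definition cell_inclusion :: "'x elem lspset \<Rightarrow> 'x elem \<Rightarrow> 'x elem lspset_arrow" where
  "cell_inclusion X i = (case i of Indexed x n \<Rightarrow> (labelled_cube (label X n x), yoneda X n x, X))"

lemma FArr_labelled_cube_diagram:
  "FArr (labelled_cube_diagram X) (cell_arrow X m n f y) =
     (labelled_cube (label X m (Act (fst X) m n f y)), yoneda (labelled_cube (label X n y)) m (CubeMap f),
      labelled_cube (label X n y))"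
  by (simp add: labelled_cube_diagram_def cell_arrow_def)

lemma FOb_labelled_cube_diagram:
  "FOb (labelled_cube_diagram X) (Indexed x n) = labelled_cube (label X n x)"
  by (simp add: labelled_cube_diagram_def)

lemma lspset_map_yoneda_cube:
  fixes U :: "'x elem set set" and b :: "'x elem list"
  assumes U: "universe U" and b: "set b \<subseteq> \<Sigma>" and f: "cube_map m (length b) f"
  shows "lspset_map (labelled_cube (word_act m (length b) f b)) (labelled_cube b)
     (yoneda (labelled_cube b) m (CubeMap f))"
  using lspset_map_yoneda[OF U is_lspset_labelled_cube[OF U b], of "CubeMap f" m] f
  by (simp add: Cells_labelled_cube label_labelled_cube)

lemma is_functor_labelled_cube_diagram:
  fixes U :: "'x elem set set"
  assumes U: "universe U" and X: "is_lspset U \<Sigma> X"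
  shows "is_functor (cells_category X) (LSPSET U \<Sigma>) (labelled_cube_diagram X)"
  unfolding is_functor_def
proof (intro conjI ballI allI)
  let ?D = "labelled_cube_diagram X"
  have K: "is_spset U (fst X)" using X by (simp add: is_lspset_def)
  {
    fix i assume "i \<in> Ob (cells_category X)"
    then obtain n x where i: "x \<in> Cells (fst X) n" "i = Indexed x n" unfolding Ob_cells_category by blast
    let ?a = "label X n x"
    have n: "length ?a = n" by (rule length_label[OF X i(1)])
    have a: "is_lspset U \<Sigma> (labelled_cube ?a)" by (rule is_lspset_labelled_cube[OF U set_label[OF X i(1)]])
    show "FOb ?D i \<in> Ob (LSPSET U \<Sigma>)" using a by (simp add: i(2) FOb_labelled_cube_diagram Ob_LSPSET)
    have "spset_id (fst (labelled_cube ?a)) = yoneda (labelled_cube ?a) n (CubeMap (\<lambda>\<epsilon>\<in>cube n. \<epsilon>))"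
      using lspset_map_labelled_cube_eq_yoneda[OF lspset_map_id[OF a] n] cube_map_id[of n]
      by (simp add: spset_id_def Cells_labelled_cube n)
    then show "FArr ?D (Id (cells_category X) i) = Id (LSPSET U \<Sigma>) (FOb ?D i)"
      by (simp add: i(2) Id_cells_category[OF X i(1)] FArr_labelled_cube_diagram FOb_labelled_cube_diagram
          Id_LSPSET spsetD(3)[OF K i(1)])
  }
  {
    fix i j w assume "w \<in> Hom (cells_category X) i j"
    then obtain m n f y where y: "y \<in> Cells (fst X) n" and f: "cube_map m n f"
      and w: "i = Indexed (Act (fst X) m n f y) m" "j = Indexed y n" "w = cell_arrow X m n f y"
      unfolding Hom_cells_category by blast
    have f': "cube_map m (length (label X n y)) f" using f by (simp add: length_label[OF X y])
    show "FArr ?D w \<in> Hom (LSPSET U \<Sigma>) (FOb ?D i) (FOb ?D j)"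
      unfolding w FArr_labelled_cube_diagram FOb_labelled_cube_diagram Hom_LSPSET
      using lspset_map_yoneda_cube[OF U set_label[OF X y] f'] is_lspset_labelled_cube[OF U set_label[OF X y]]
        is_lspset_labelled_cube[OF U set_label[OF X spsetD(2)[OF K f y]]]
      by (simp add: label_Act[OF X y f] length_label[OF X y])
  }
  fix i j k v w assume "v \<in> Hom (cells_category X) i j" "w \<in> Hom (cells_category X) j k"
  then obtain l m n f g y where y: "y \<in> Cells (fst X) n" and gf: "cube_map l m g" "cube_map m n f"
    and v: "v = cell_arrow X l m g (Act (fst X) m n f y)" and w: "w = cell_arrow X m n f y"
    unfolding Hom_cells_category by auto
  let ?a = "label X n y" and ?b = "label X m (Act (fst X) m n f y)"
  let ?c = "label X l (Act (fst X) l m g (Act (fst X) m n f y))"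
  have fy: "Act (fst X) m n f y \<in> Cells (fst X) m" by (rule spsetD(2)[OF K gf(2) y])
  have len: "length ?a = n" "length ?b = m" "length ?c = l"
    using length_label[OF X] spsetD(2)[OF K gf(1) fy] y fy by blast+
  have f': "lspset_map (labelled_cube ?b) (labelled_cube ?a) (yoneda (labelled_cube ?a) m (CubeMap f))"
    using lspset_map_yoneda_cube[OF U set_label[OF X y], of m f] gf(2) by (simp add: len label_Act[OF X y gf(2)])
  have "spset_comp (fst (labelled_cube ?c)) (yoneda (labelled_cube ?a) m (CubeMap f)) (yoneda (labelled_cube ?b) l (CubeMap g))
      = yoneda (labelled_cube ?a) l (CubeMap (compose (cube l) f g))"
    using spset_comp_yoneda[OF is_lspset_labelled_cube[OF U set_label[OF X fy]] f', of "CubeMap g" l ?c] gf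
    by (simp add: len Cells_labelled_cube yoneda_CubeMap Act_labelled_cube)
  then show "FArr ?D (Comp (cells_category X) w v) = Comp (LSPSET U \<Sigma>) (FArr ?D w) (FArr ?D v)"
    unfolding v w Comp_cells_category[OF X gf y] FArr_labelled_cube_diagram Comp_LSPSET
    by (simp add: spsetD(4)[OF K gf y])
qed

text \<open>
  A cocone on the diagram gives a map from the labelled cube of each cell to the vertex \<open>Z\<close>. By the Yoneda lemma
  it is a cell of \<open>Z\<close>, namely the value at the identity, and the compatibility of the cocone says that
  these cells form a map from \<open>X\<close> to \<open>Z\<close>.
\<close>

theorem labelled_cubes_dense:
  fixes U :: "'x elem set set"
  assumes U: "universe U" and X: "is_lspset U \<Sigma> X"
  shows "is_colimit (cells_category X) (LSPSET U \<Sigma>) (labelled_cube_diagram X) X (cell_inclusion X)"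
  unfolding is_colimit_def
proof (intro conjI allI impI)
  let ?D = "labelled_cube_diagram X" and ?J = "cells_category X"
  have K: "is_spset U (fst X)" using X by (simp add: is_lspset_def)
  note act = spsetD(2)[OF K]
  note cubeX = is_lspset_labelled_cube[OF U set_label[OF X]]
  have id: "CubeMap (\<lambda>\<epsilon>\<in>cube n. \<epsilon>) \<in> Cells (fst (labelled_cube (label X n x))) n"
    if "x \<in> Cells (fst X) n" for n x
    using cube_map_id by (simp add: Cells_labelled_cube length_label[OF X that])
  show "is_cocone ?J (LSPSET U \<Sigma>) ?D X (cell_inclusion X)"
    unfolding is_cocone_def
  proof (intro conjI ballI allI)
    show "X \<in> Ob (LSPSET U \<Sigma>)" using X by (simp add: Ob_LSPSET)
    show "cell_inclusion X i \<in> Hom (LSPSET U \<Sigma>) (FOb ?D i) X" if "i \<in> Ob ?J" for i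
      using that cubeX X lspset_map_yoneda[OF U X]
      by (auto simp: Ob_cells_category FOb_labelled_cube_diagram Hom_LSPSET cell_inclusion_def)
    fix i j w assume "w \<in> Hom ?J i j"
    then obtain m n f y where y: "y \<in> Cells (fst X) n" and f: "cube_map m n f"
      and w: "i = Indexed (Act (fst X) m n f y) m" "j = Indexed y n" "w = cell_arrow X m n f y"
      unfolding Hom_cells_category by blast
    have "CubeMap f \<in> Cells (fst (labelled_cube (label X n y))) m"
      using f by (simp add: Cells_labelled_cube length_label[OF X y])
    from spset_comp_yoneda[OF cubeX[OF y] lspset_map_yoneda[OF U X y] this length_label[OF X act[OF f y]]]
    show "Comp (LSPSET U \<Sigma>) (cell_inclusion X j) (FArr ?D w) = cell_inclusion X i"
      unfolding w FArr_labelled_cube_diagram by (simp add: cell_inclusion_def Comp_LSPSET yoneda_CubeMap[OF f])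
  qed
  fix Z \<mu> assume \<mu>: "is_cocone ?J (LSPSET U \<Sigma>) ?D Z \<mu>"
  have Z: "is_lspset U \<Sigma> Z" using \<mu> by (simp add: is_cocone_def Ob_LSPSET)
  define c where "c n x = fst (snd (\<mu> (Indexed x n)))" for n x
  have c: "\<mu> (Indexed x n) = (labelled_cube (label X n x), c n x, Z)"
    and c_map: "lspset_map (labelled_cube (label X n x)) Z (c n x)" if x: "x \<in> Cells (fst X) n" for n x
  proof -
    have "Indexed x n \<in> Ob ?J" using x by (auto simp: Ob_cells_category)
    from cocone_Hom[OF \<mu> this] show "\<mu> (Indexed x n) = (labelled_cube (label X n x), c n x, Z)"
      "lspset_map (labelled_cube (label X n x)) Z (c n x)"
      unfolding FOb_labelled_cube_diagram Hom_LSPSET by (auto simp: c_def)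
  qed
  define h where "h n = (\<lambda>x\<in>Cells (fst X) n. c n x n (CubeMap (\<lambda>\<epsilon>\<in>cube n. \<epsilon>)))" for n
  have h_Z: "h n x \<in> Cells (fst Z) n" if x: "x \<in> Cells (fst X) n" for n x
    using spset_mapD(2)[OF lspset_mapD(1)[OF c_map[OF x]] id[OF x]] x by (simp add: h_def)
  have c_eq: "c n x = yoneda Z n (h n x)" if x: "x \<in> Cells (fst X) n" for n x
    using lspset_map_labelled_cube_eq_yoneda[OF c_map[OF x] length_label[OF X x]] x by (simp add: h_def)
  have h_lspset: "lspset_map X Z h"
  proof (rule lspset_mapI[OF _ X])
    show "spset_map (fst X) (fst Z) h"
      unfolding spset_map_def
    proof (intro conjI allI impI ballI)
      show "h n \<in> Cells (fst X) n \<rightarrow>\<^sub>E Cells (fst Z) n" for n using h_Z[of _ n] by (auto simp: h_def)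
      fix m n f y assume f: "cube_map m n f" and y: "y \<in> Cells (fst X) n"
      have fy: "Act (fst X) m n f y \<in> Cells (fst X) m" by (rule act[OF f y])
      have w: "cell_arrow X m n f y \<in> Hom ?J (Indexed (Act (fst X) m n f y) m) (Indexed y n)"
        unfolding Hom_cells_category using f y by blast
      have fcell: "CubeMap f \<in> Cells (fst (labelled_cube (label X n y))) m"
        using f by (simp add: Cells_labelled_cube length_label[OF X y])
      have "c m (Act (fst X) m n f y) = yoneda Z m (c n y m (CubeMap f))"
        using cocone_commute[OF \<mu> w]
          spset_comp_yoneda[OF cubeX[OF y] c_map[OF y] fcell length_label[OF X fy]]
        by (simp add: c[OF y] c[OF fy] FArr_labelled_cube_diagram Comp_LSPSET)
      moreover have "c n y m (CubeMap f) = Act (fst Z) m n f (h n y)"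
        by (simp add: c_eq[OF y] yoneda_CubeMap[OF f])
      moreover have "Act (fst Z) m n f (h n y) \<in> Cells (fst Z) m"
        using spsetD(2)[of U "fst Z"] Z f h_Z[OF y] by (simp add: is_lspset_def)
      ultimately show "h m (Act (fst X) m n f y) = Act (fst Z) m n f (h n y)"
        using fy yoneda_id[OF Z] by (simp add: h_def[of m])
    qed
    fix n x assume x: "x \<in> Cells (fst X) n"
    have "label (labelled_cube (label X n x)) n (CubeMap (\<lambda>\<epsilon>\<in>cube n. \<epsilon>)) = label X n x"
      using label_labelled_cube[of n "label X n x" "\<lambda>\<epsilon>\<in>cube n. \<epsilon>"] cube_map_id[of n] word_act_id[of "label X n x"]
      by (simp add: length_label[OF X x])
    then have "label Z n (h n x) = label X n x"
      using label_lspset_map[OF c_map[OF x] id[OF x]] x by (simp add: h_def)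
    then show "snd Z n (h n x) = snd X n x" by (simp add: snd_eq_label[OF X x] snd_eq_label[OF Z h_Z[OF x]])
  qed
  have factor: "(\<forall>i\<in>Ob ?J. Comp (LSPSET U \<Sigma>) (X, k, Z) (cell_inclusion X i) = \<mu> i) \<longleftrightarrow> k = h"
    if k: "lspset_map X Z k" for k
  proof -
    have k_Z: "k n x \<in> Cells (fst Z) n" if "x \<in> Cells (fst X) n" for n x
      using spset_mapD(2)[OF lspset_mapD(1)[OF k] that] .
    have "Comp (LSPSET U \<Sigma>) (X, k, Z) (cell_inclusion X (Indexed x n)) = \<mu> (Indexed x n) \<longleftrightarrow> k n x = h n x"
      if x: "x \<in> Cells (fst X) n" for n x
    proof -
      have "Comp (LSPSET U \<Sigma>) (X, k, Z) (cell_inclusion X (Indexed x n)) = \<mu> (Indexed x n)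
          \<longleftrightarrow> yoneda Z n (k n x) = yoneda Z n (h n x)"
        using spset_comp_yoneda[OF X k x length_label[OF X x]]
        by (simp add: c[OF x] c_eq[OF x] cell_inclusion_def Comp_LSPSET)
      also have "\<dots> \<longleftrightarrow> k n x = h n x"
        using yoneda_id[OF Z k_Z[OF x]] yoneda_id[OF Z h_Z[OF x]] by metis
      finally show ?thesis .
    qed
    then have "(\<forall>i\<in>Ob ?J. Comp (LSPSET U \<Sigma>) (X, k, Z) (cell_inclusion X i) = \<mu> i) \<longleftrightarrow>
        (\<forall>n. \<forall>x\<in>Cells (fst X) n. k n x = h n x)"
      unfolding Ball_def Ob_cells_category by blast
    also have "\<dots> \<longleftrightarrow> k = h"
    proof
      assume eq: "\<forall>n. \<forall>x\<in>Cells (fst X) n. k n x = h n x"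
      show "k = h"
      proof
        show "k n = h n" for n
          by (rule PiE_ext[OF spset_mapD(1)[OF lspset_mapD(1)[OF k]]
                spset_mapD(1)[OF lspset_mapD(1)[OF h_lspset]]]) (use eq in blast)
      qed
    qed simp
    finally show ?thesis .
  qed
  show "\<exists>!g. g \<in> Hom (LSPSET U \<Sigma>) X Z \<and> (\<forall>i\<in>Ob ?J. Comp (LSPSET U \<Sigma>) g (cell_inclusion X i) = \<mu> i)"
  proof (rule ex1I[of _ "(X, h, Z)"])
    show "(X, h, Z) \<in> Hom (LSPSET U \<Sigma>) X Z \<and>
        (\<forall>i\<in>Ob ?J. Comp (LSPSET U \<Sigma>) (X, h, Z) (cell_inclusion X i) = \<mu> i)"
      using factor[OF h_lspset] X Z h_lspset by (simp add: Hom_LSPSET)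
    fix g assume g: "g \<in> Hom (LSPSET U \<Sigma>) X Z \<and>
        (\<forall>i\<in>Ob ?J. Comp (LSPSET U \<Sigma>) g (cell_inclusion X i) = \<mu> i)"
    then obtain k where "g = (X, k, Z)" "lspset_map X Z k" unfolding Hom_LSPSET by blast
    then show "g = (X, h, Z)" using factor g by blast
  qed
qed

section \<open>Universal arrows to the nerve functor\<close>

definition cube_diagram :: "'x elem lspset \<Rightarrow> ('x elem, 'x elem, 'x elem whdts, 'x elem whdts_arrow) fctr" where
  "cube_diagram X =
     \<lparr>FOb = (\<lambda>i. case i of Indexed x n \<Rightarrow> cube_whdts (label X n x)),
      FArr = (\<lambda>w. case w of Word ws \<Rightarrow>
        case ws ! 0 of Indexed x m \<Rightarrow> case ws ! 1 of CubeMap f \<Rightarrow> case ws ! 2 of Indexed y n \<Rightarrow>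
          cube_whdts_map (label X m x) (label X n y) f)\<rparr>"

lemma FOb_cube_diagram: "FOb (cube_diagram X) (Indexed x n) = cube_whdts (label X n x)"
  by (simp add: cube_diagram_def)

lemma FArr_cube_diagram:
  "FArr (cube_diagram X) (cell_arrow X m n f y) =
     (cube_whdts (label X m (Act (fst X) m n f y)),
      cube_fun (label X m (Act (fst X) m n f y)) (label X n y) f, cube_whdts (label X n y))"
  by (simp add: cube_diagram_def cell_arrow_def cube_whdts_map_eq)

lemma is_functor_cube_diagram:
  fixes U :: "'x elem set set"
  assumes U: "universe U" and X: "is_lspset U \<Sigma> X"
  shows "is_functor (cells_category X) (WHDTS U \<Sigma>) (cube_diagram X)"
  unfolding is_functor_def
proof (intro conjI ballI allI)
  let ?D = "cube_diagram X"
  have K: "is_spset U (fst X)" using X by (simp add: is_lspset_def)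
  note cubeX = is_whdts_cube_whdts[OF U set_label[OF X]]
  {
    fix i assume "i \<in> Ob (cells_category X)"
    then obtain n x where i: "x \<in> Cells (fst X) n" "i = Indexed x n" unfolding Ob_cells_category by blast
    show "FOb ?D i \<in> Ob (WHDTS U \<Sigma>)" using cubeX[OF i(1)] by (simp add: i(2) FOb_cube_diagram Ob_WHDTS)
    show "FArr ?D (Id (cells_category X) i) = Id (WHDTS U \<Sigma>) (FOb ?D i)"
      by (simp add: i(2) Id_cells_category[OF X i(1)] FArr_cube_diagram FOb_cube_diagram Id_WHDTS
          spsetD(3)[OF K i(1)] cube_fun_id[OF length_label[OF X i(1)]])
  }
  {
    fix i j w assume "w \<in> Hom (cells_category X) i j"
    then obtain m n f y where y: "y \<in> Cells (fst X) n" and f: "cube_map m n f"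
      and w: "i = Indexed (Act (fst X) m n f y) m" "j = Indexed y n" "w = cell_arrow X m n f y"
      unfolding Hom_cells_category by blast
    show "FArr ?D w \<in> Hom (WHDTS U \<Sigma>) (FOb ?D i) (FOb ?D j)"
      unfolding w FArr_cube_diagram FOb_cube_diagram Hom_WHDTS
      using whdts_map_cube_fun[OF f length_label[OF X y]] cubeX[OF y] cubeX[OF spsetD(2)[OF K f y]]
      by (simp add: label_Act[OF X y f])
  }
  fix i j k v w assume "v \<in> Hom (cells_category X) i j" "w \<in> Hom (cells_category X) j k"
  then obtain l m n f g y where y: "y \<in> Cells (fst X) n" and gf: "cube_map l m g" "cube_map m n f"
    and v: "v = cell_arrow X l m g (Act (fst X) m n f y)" and w: "w = cell_arrow X m n f y"
    unfolding Hom_cells_category by auto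
  show "FArr ?D (Comp (cells_category X) w v) = Comp (WHDTS U \<Sigma>) (FArr ?D w) (FArr ?D v)"
    unfolding v w Comp_cells_category[OF X gf y] FArr_cube_diagram Comp_WHDTS
    using cube_fun_comp[OF gf length_label[OF X y] label_Act[OF X y gf(2)]
        label_Act[OF X spsetD(2)[OF K gf(2) y] gf(1)]]
    by (simp add: spsetD(4)[OF K gf y])
qed

lemma cube_family_of_cocone:
  assumes X: "is_lspset U \<Sigma> X" and m: "is_cocone (cells_category X) (WHDTS U \<Sigma>) (cube_diagram X) Y m"
  shows "cube_family X Y (\<lambda>n x. fst (snd (m (Indexed x n))))"
    and "x \<in> Cells (fst X) n \<Longrightarrow>
      m (Indexed x n) = (cube_whdts (label X n x), fst (snd (m (Indexed x n))), Y)"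
proof -
  have K: "is_spset U (fst X)" using X by (simp add: is_lspset_def)
  let ?k = "\<lambda>n x. fst (snd (m (Indexed x n)))"
  have mk: "m (Indexed x n) = (cube_whdts (label X n x), ?k n x, Y)"
    "whdts_map (cube_whdts (label X n x)) Y (?k n x)" if x: "x \<in> Cells (fst X) n" for n x
  proof -
    have "Indexed x n \<in> Ob (cells_category X)" using x by (auto simp: Ob_cells_category)
    from cocone_Hom[OF m this] show "m (Indexed x n) = (cube_whdts (label X n x), ?k n x, Y)"
      "whdts_map (cube_whdts (label X n x)) Y (?k n x)"
      unfolding FOb_cube_diagram Hom_WHDTS by auto
  qed
  show "x \<in> Cells (fst X) n \<Longrightarrow> m (Indexed x n) = (cube_whdts (label X n x), ?k n x, Y)" by (rule mk(1))
  show "cube_family X Y ?k"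
    unfolding cube_family_def
  proof (intro conjI allI impI ballI)
    show "whdts_map (cube_whdts (label X n x)) Y (?k n x)" if "x \<in> Cells (fst X) n" for n x
      by (rule mk(2)[OF that])
    fix p n f x assume f: "cube_map p n f" and x: "x \<in> Cells (fst X) n"
    have w: "cell_arrow X p n f x \<in> Hom (cells_category X) (Indexed (Act (fst X) p n f x) p) (Indexed x n)"
      unfolding Hom_cells_category using f x by blast
    have "Comp (WHDTS U \<Sigma>) (cube_whdts (label X n x), ?k n x, Y) (FArr (cube_diagram X) (cell_arrow X p n f x))
        = (cube_whdts (label X p (Act (fst X) p n f x)), ?k p (Act (fst X) p n f x), Y)"
      unfolding mk(1)[OF x, symmetric] mk(1)[OF spsetD(2)[OF K f x], symmetric] by (rule cocone_commute[OF m w])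
    then show "?k p (Act (fst X) p n f x) = wmap_comp (cube_whdts (word_act p n f (label X n x))) (?k n x)
        (cube_fun (word_act p n f (label X n x)) (label X n x) f)"
      by (simp add: FArr_cube_diagram Comp_WHDTS label_Act[OF X x f])
  qed
qed

text \<open>
  Together with \<open>cube_family_of_cocone\<close> this identifies cocones on the diagram of cubes with families of cubes,
  hence with maps to the nerve.
\<close>

lemma cocone_of_cube_family:
  fixes U :: "'x elem set set"
  assumes U: "universe U" and X: "is_lspset U \<Sigma> X" and Y: "is_whdts U \<Sigma> Y" and k: "cube_family X Y k"
  shows "is_cocone (cells_category X) (WHDTS U \<Sigma>) (cube_diagram X) Y
    (\<lambda>i. case i of Indexed x n \<Rightarrow> (cube_whdts (label X n x), k n x, Y))"
  unfolding is_cocone_def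
proof (intro conjI ballI allI)
  show "Y \<in> Ob (WHDTS U \<Sigma>)" using Y by (simp add: Ob_WHDTS)
  fix i assume "i \<in> Ob (cells_category X)"
  then obtain n x where x: "x \<in> Cells (fst X) n" "i = Indexed x n" unfolding Ob_cells_category by blast
  show "(case i of Indexed x n \<Rightarrow> (cube_whdts (label X n x), k n x, Y)) \<in> Hom (WHDTS U \<Sigma>) (FOb (cube_diagram X) i) Y"
    using Y cube_familyD(1)[OF k x(1)] is_whdts_cube_whdts[OF U set_label[OF X x(1)]]
    by (simp add: x(2) FOb_cube_diagram Hom_WHDTS)
next
  fix i j w assume "w \<in> Hom (cells_category X) i j"
  then obtain m n f y where y: "y \<in> Cells (fst X) n" and f: "cube_map m n f"
    and w: "i = Indexed (Act (fst X) m n f y) m" "j = Indexed y n" "w = cell_arrow X m n f y"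
    unfolding Hom_cells_category by blast
  show "Comp (WHDTS U \<Sigma>) (case j of Indexed x n \<Rightarrow> (cube_whdts (label X n x), k n x, Y)) (FArr (cube_diagram X) w)
      = (case i of Indexed x n \<Rightarrow> (cube_whdts (label X n x), k n x, Y))"
    unfolding w FArr_cube_diagram
    by (simp add: Comp_WHDTS cube_familyD(2)[OF k f y] label_Act[OF X y f])
qed

lemma ex_universal_arrow_nerve:
  fixes U :: "'x elem set set"
  assumes U: "universe U" and \<Sigma>: "\<Sigma> \<in> U" and X: "is_lspset U \<Sigma> X"
  shows "\<exists>L \<eta>. universal_arrow (LSPSET U \<Sigma>) (WHDTS U \<Sigma>) (nerve_functor \<Sigma>) X L \<eta>"
proof -
  let ?J = "cells_category X"
  obtain L l where colim: "is_colimit ?J (WHDTS U \<Sigma>) (cube_diagram X) L l"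
    using WHDTS_cocomplete[OF U is_category_cells_category[OF X] cells_category_small(1)[OF U X]
        is_functor_cube_diagram[OF U X]] by blast
  note cocone = colimit_cocone[OF colim]
  let ?k = "\<lambda>n x. fst (snd (l (Indexed x n)))"
  have L: "is_whdts U \<Sigma> L" using cocone by (simp add: is_cocone_def Ob_WHDTS)
  have "universal_arrow (LSPSET U \<Sigma>) (WHDTS U \<Sigma>) (nerve_functor \<Sigma>) X L (X, classify X ?k, nerve \<Sigma> L)"
  proof (rule universal_arrow_nerveI[OF U X L cube_family_of_cocone(1)[OF X cocone] is_lspset_nerve[OF U \<Sigma> L]])
    fix Y k' assume Y: "is_whdts U \<Sigma> Y" and k': "cube_family X Y k'"
    let ?m = "\<lambda>i. case i of Indexed x n \<Rightarrow> (cube_whdts (label X n x), k' n x, Y)"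
    have factor: "(\<forall>i\<in>Ob ?J. Comp (WHDTS U \<Sigma>) (L, h, Y) (l i) = ?m i) \<longleftrightarrow>
        (\<forall>n. \<forall>x\<in>Cells (fst X) n. wmap_comp (cube_whdts (label X n x)) h (?k n x) = k' n x)" for h
    proof -
      have "Comp (WHDTS U \<Sigma>) (L, h, Y) (l (Indexed x n)) = ?m (Indexed x n) \<longleftrightarrow>
          wmap_comp (cube_whdts (label X n x)) h (?k n x) = k' n x" if x: "x \<in> Cells (fst X) n" for n x
        by (subst cube_family_of_cocone(2)[OF X cocone x]) (simp add: Comp_WHDTS)
      then show ?thesis unfolding Ball_def Ob_cells_category by blast
    qed
    obtain g where g: "g \<in> Hom (WHDTS U \<Sigma>) L Y" "\<forall>i\<in>Ob ?J. Comp (WHDTS U \<Sigma>) g (l i) = ?m i"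
      and g_unique: "\<And>g'. g' \<in> Hom (WHDTS U \<Sigma>) L Y \<Longrightarrow> \<forall>i\<in>Ob ?J. Comp (WHDTS U \<Sigma>) g' (l i) = ?m i \<Longrightarrow> g' = g"
      using colimit_ex1[OF colim cocone_of_cube_family[OF U X Y k']] by (elim ex1E) blast
    obtain h where h: "g = (L, h, Y)" "whdts_map L Y h" using g(1) unfolding Hom_WHDTS by blast
    show "\<exists>!h. whdts_map L Y h \<and>
        (\<forall>n. \<forall>x\<in>Cells (fst X) n. wmap_comp (cube_whdts (label X n x)) h (?k n x) = k' n x)"
    proof (rule ex1I[of _ h])
      show "whdts_map L Y h \<and>
          (\<forall>n. \<forall>x\<in>Cells (fst X) n. wmap_comp (cube_whdts (label X n x)) h (?k n x) = k' n x)"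
        using factor g(2) h by simp
      fix h' assume h': "whdts_map L Y h' \<and>
          (\<forall>n. \<forall>x\<in>Cells (fst X) n. wmap_comp (cube_whdts (label X n x)) h' (?k n x) = k' n x)"
      then have "(L, h', Y) \<in> Hom (WHDTS U \<Sigma>) L Y" using L Y by (simp add: Hom_WHDTS)
      from g_unique[OF this] factor h' show "h' = h" by (simp add: h(1))
    qed
  qed
  then show ?thesis by blast
qed

text \<open>
  The universal family on a labelled cube: the cell \<open>f : [m] \<rightarrow> [n]\<close> goes to the value of the cube functor
  at \<open>f\<close>.
\<close>

definition cube_unit :: "'x elem list \<Rightarrow> nat \<Rightarrow> 'x elem \<Rightarrow> ('x elem \<Rightarrow> 'x elem) \<times> ('x elem \<Rightarrow> 'x elem)" where
  "cube_unit a m z = (case z of CubeMap f \<Rightarrow> cube_fun (word_act m (length a) f a) a f)"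

lemma cube_family_cube_unit:
  fixes a :: "'x elem list"
  shows "cube_family (labelled_cube a) (cube_whdts a) (cube_unit a)"
  unfolding cube_family_def Cells_labelled_cube
proof (intro conjI allI impI ballI)
  let ?n = "length a"
  fix m and z :: "'x elem" assume "z \<in> CubeMap ` {f. cube_map m ?n f}"
  then obtain f where f: "z = CubeMap f" "cube_map m ?n f" by blast
  show "whdts_map (cube_whdts (label (labelled_cube a) m z)) (cube_whdts a) (cube_unit a m z)"
    using whdts_map_cube_fun[OF f(2) refl] by (simp add: f(1) label_labelled_cube[OF f(2)] cube_unit_def)
  fix l g assume g: "cube_map l m g"
  show "cube_unit a l (Act (fst (labelled_cube a)) l m g z) =
      wmap_comp (cube_whdts (word_act l m g (label (labelled_cube a) m z))) (cube_unit a m z)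
        (cube_fun (word_act l m g (label (labelled_cube a) m z)) (label (labelled_cube a) m z) g)"
    unfolding f(1) Act_labelled_cube[OF g f(2)] label_labelled_cube[OF f(2)]
    using cube_fun_comp[OF g f(2) refl refl refl] by (simp add: cube_unit_def word_act_comp[OF g f(2)])
qed

definition cube_unit_arrow :: "'x elem set \<Rightarrow> 'x elem list \<Rightarrow> 'x elem lspset_arrow" where
  "cube_unit_arrow \<Sigma> a =
     (labelled_cube a, classify (labelled_cube a) (cube_unit a), nerve \<Sigma> (cube_whdts a))"

text \<open>
  A compatible family of cubes in \<open>Y\<close> indexed by the cells of a labelled cube is determined by its member at the identity,
  from which the member at \<open>f\<close> is obtained by restriction.
\<close>

lemma universal_arrow_labelled_cube:
  fixes U :: "'x elem set set"
  assumes U: "universe U" and \<Sigma>: "\<Sigma> \<in> U" and a: "set a \<subseteq> \<Sigma>"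
  shows "universal_arrow (LSPSET U \<Sigma>) (WHDTS U \<Sigma>) (nerve_functor \<Sigma>) (labelled_cube a) (cube_whdts a)
    (cube_unit_arrow \<Sigma> a)"
  unfolding cube_unit_arrow_def
proof (rule universal_arrow_nerveI[OF U is_lspset_labelled_cube[OF U a] is_whdts_cube_whdts[OF U a]
      cube_family_cube_unit is_lspset_nerve[OF U \<Sigma> is_whdts_cube_whdts[OF U a]]])
  let ?n = "length a" and ?X = "labelled_cube a"
  let ?id = "\<lambda>\<epsilon>\<in>cube ?n. \<epsilon>"
  fix Y k' assume Y: "is_whdts U \<Sigma> Y" and k': "cube_family ?X Y k'"
  have id: "CubeMap ?id \<in> Cells (fst ?X) ?n" using cube_map_id by (simp add: Cells_labelled_cube)
  have label_id: "label ?X ?n (CubeMap ?id) = a"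
    unfolding label_labelled_cube[OF cube_map_id] by (rule word_act_id)
  have unit_id: "cube_unit a ?n (CubeMap ?id) = wmap_id (cube_whdts a)"
    by (simp add: cube_unit_def word_act_id cube_fun_id)
  let ?h = "k' ?n (CubeMap ?id)"
  show "\<exists>!h. whdts_map (cube_whdts a) Y h \<and>
      (\<forall>m. \<forall>z\<in>Cells (fst ?X) m. wmap_comp (cube_whdts (label ?X m z)) h (cube_unit a m z) = k' m z)"
  proof (rule ex1I[of _ ?h])
    have "wmap_comp (cube_whdts (label ?X m z)) ?h (cube_unit a m z) = k' m z"
      if z: "z \<in> Cells (fst ?X) m" for m z
    proof -
      obtain f where f: "z = CubeMap f" "cube_map m ?n f" using z unfolding Cells_labelled_cube by blast
      show ?thesis
        using cube_familyD(2)[OF k' f(2) id] Act_labelled_cube[OF f(2) cube_map_id]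
        by (simp add: f(1) label_id label_labelled_cube[OF f(2)] cube_unit_def compose_id_cube_map[OF f(2)])
    qed
    then show "whdts_map (cube_whdts a) Y ?h \<and>
        (\<forall>m. \<forall>z\<in>Cells (fst ?X) m. wmap_comp (cube_whdts (label ?X m z)) ?h (cube_unit a m z) = k' m z)"
      using cube_familyD(1)[OF k' id] by (simp add: label_id)
    fix h assume h: "whdts_map (cube_whdts a) Y h \<and>
        (\<forall>m. \<forall>z\<in>Cells (fst ?X) m. wmap_comp (cube_whdts (label ?X m z)) h (cube_unit a m z) = k' m z)"
    then have "wmap_comp (cube_whdts a) h (wmap_id (cube_whdts a)) = ?h" using id label_id unit_id by metis
    then show "h = ?h" using wmap_comp_id_right h by metis
  qed
qed

text \<open>
  A map of labelled cubes is composition with its underlying map \<open>f0\<close> of \<open>\<box>\<^sub>S\<close>, so at a cell \<open>g\<close> both composites are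
  the value of the cube functor at \<open>f0 \<circ> g\<close>.
\<close>

lemma cube_unit_natural:
  fixes U :: "'x elem set set"
  assumes U: "universe U" and a: "set a \<subseteq> \<Sigma>" and b: "set b \<subseteq> \<Sigma>"
    and \<phi>: "(labelled_cube a, \<phi>, labelled_cube b) \<in> Hom (LSPSET U \<Sigma>) (labelled_cube a) (labelled_cube b)"
  defines "f0 \<equiv> underlying_cube_map (length a) \<phi>"
  shows "cube_whdts_map a b f0 \<in> Hom (WHDTS U \<Sigma>) (cube_whdts a) (cube_whdts b)"
    and "Comp (LSPSET U \<Sigma>) (FArr (nerve_functor \<Sigma>) (cube_whdts_map a b f0)) (cube_unit_arrow \<Sigma> a)
      = Comp (LSPSET U \<Sigma>) (cube_unit_arrow \<Sigma> b) (labelled_cube a, \<phi>, labelled_cube b)"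
proof -
  let ?n = "length a" and ?p = "length b"
  have \<phi>_map: "lspset_map (labelled_cube a) (labelled_cube b) \<phi>" using \<phi> by (simp add: Hom_LSPSET)
  have id: "CubeMap (\<lambda>\<epsilon>\<in>cube ?n. \<epsilon>) \<in> Cells (fst (labelled_cube a)) ?n"
    using cube_map_id by (simp add: Cells_labelled_cube)
  have "\<phi> ?n (CubeMap (\<lambda>\<epsilon>\<in>cube ?n. \<epsilon>)) \<in> CubeMap ` {f. cube_map ?n ?p f}"
    using spset_mapD(2)[OF lspset_mapD(1)[OF \<phi>_map] id] by (simp add: Cells_labelled_cube)
  then have f0: "cube_map ?n ?p f0" and \<phi>_id: "\<phi> ?n (CubeMap (\<lambda>\<epsilon>\<in>cube ?n. \<epsilon>)) = CubeMap f0"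
    by (auto simp: f0_def underlying_cube_map_def)
  have \<phi>_eq: "\<phi> = yoneda (labelled_cube b) ?n (CubeMap f0)"
    using lspset_map_labelled_cube_eq_yoneda[OF \<phi>_map refl] by (simp add: \<phi>_id)
  have a_eq: "a = word_act ?n ?p f0 b"
    using label_lspset_map[OF \<phi>_map id] unfolding \<phi>_id label_labelled_cube[OF f0]
      label_labelled_cube[OF cube_map_id] word_act_id by simp
  show "cube_whdts_map a b f0 \<in> Hom (WHDTS U \<Sigma>) (cube_whdts a) (cube_whdts b)"
    using is_whdts_cube_whdts[OF U a] is_whdts_cube_whdts[OF U b] whdts_map_cube_fun[OF f0 refl]
    by (simp add: Hom_WHDTS cube_whdts_map_eq flip: a_eq)
  have "classify (labelled_cube a) (\<lambda>m z. wmap_comp (cube_whdts (label (labelled_cube a) m z))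
        (cube_fun a b f0) (cube_unit a m z)) m z
      = spset_comp (fst (labelled_cube a)) (classify (labelled_cube b) (cube_unit b)) \<phi> m z" for m z
  proof (cases "z \<in> Cells (fst (labelled_cube a)) m")
    case True
    then obtain g where g: "z = CubeMap g" "cube_map m ?n g" by (auto simp: Cells_labelled_cube)
    note fg = cube_map_comp[OF g(2) f0]
    have "\<phi> m z = CubeMap (compose (cube m) f0 g)"
      unfolding \<phi>_eq g(1) yoneda_CubeMap[OF g(2)] by (rule Act_labelled_cube[OF g(2) f0])
    moreover have "word_act m ?p (compose (cube m) f0 g) b = word_act m ?n g a"
      unfolding word_act_comp[OF g(2) f0] a_eq[symmetric] ..
    moreover have "wmap_comp (cube_whdts (word_act m ?n g a)) (cube_fun a b f0) (cube_fun (word_act m ?n g a) a g)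
        = cube_fun (word_act m ?n g a) b (compose (cube m) f0 g)"
      by (rule cube_fun_comp[OF g(2) f0 refl a_eq refl])
    moreover have "CubeMap (compose (cube m) f0 g) \<in> Cells (fst (labelled_cube b)) m"
      using fg by (simp add: Cells_labelled_cube)
    ultimately show ?thesis
      using True label_labelled_cube[OF g(2)] label_labelled_cube[OF fg]
      by (simp add: classify_def spset_comp_def compose_def g(1) cube_unit_def)
  qed (simp add: classify_def spset_comp_def compose_def)
  then have "classify (labelled_cube a) (\<lambda>m z. wmap_comp (cube_whdts (label (labelled_cube a) m z))
        (cube_fun a b f0) (cube_unit a m z))
      = spset_comp (fst (labelled_cube a)) (classify (labelled_cube b) (cube_unit b)) \<phi>" by (intro ext)
  then show "Comp (LSPSET U \<Sigma>) (FArr (nerve_functor \<Sigma>) (cube_whdts_map a b f0)) (cube_unit_arrow \<Sigma> a)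
      = Comp (LSPSET U \<Sigma>) (cube_unit_arrow \<Sigma> b) (labelled_cube a, \<phi>, labelled_cube b)"
    unfolding cube_unit_arrow_def cube_whdts_map_eq
      nerve_arrow_classify[OF is_lspset_labelled_cube[OF U a] cube_family_cube_unit]
    by (simp add: Comp_LSPSET)
qed

section \<open>The realization functor\<close>

lemma cell_inclusion_natural:
  assumes f: "f \<in> Hom (LSPSET U \<Sigma>) X Y" and i: "i \<in> Ob (cells_category X)"
  shows "\<exists>j\<in>Ob (cells_category Y). FOb (labelled_cube_diagram Y) j = FOb (labelled_cube_diagram X) i \<and>
    cell_inclusion Y j = Comp (LSPSET U \<Sigma>) f (cell_inclusion X i)"
proof -
  obtain \<phi> where f_eq: "f = (X, \<phi>, Y)" and X: "is_lspset U \<Sigma> X" and \<phi>: "lspset_map X Y \<phi>"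
    using f unfolding Hom_LSPSET by blast
  obtain n x where x: "x \<in> Cells (fst X) n" "i = Indexed x n" using i unfolding Ob_cells_category by blast
  show ?thesis
  proof (intro bexI conjI)
    show "Indexed (\<phi> n x) n \<in> Ob (cells_category Y)"
      using spset_mapD(2)[OF lspset_mapD(1)[OF \<phi>] x(1)] by (auto simp: Ob_cells_category)
    show "FOb (labelled_cube_diagram Y) (Indexed (\<phi> n x) n) = FOb (labelled_cube_diagram X) i"
      by (simp add: x(2) FOb_labelled_cube_diagram label_lspset_map[OF \<phi> x(1)])
    show "cell_inclusion Y (Indexed (\<phi> n x) n) = Comp (LSPSET U \<Sigma>) f (cell_inclusion X i)"
      by (simp add: f_eq x(2) cell_inclusion_def Comp_LSPSET label_lspset_map[OF \<phi> x(1)]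
          spset_comp_yoneda[OF X \<phi> x(1) length_label[OF X x(1)]])
  qed
qed

text \<open>
  Two extensions have equal composites with the diagram of labelled cubes over the cells of \<open>X\<close>, and
  both preserve its colimit \<open>X\<close>.
\<close>

lemma extension_unique:
  fixes U :: "'x elem set set"
  assumes U: "universe U"
    and T: "is_functor (LSPSET U \<Sigma>) (WHDTS U \<Sigma>) T" "preserves_colimits U (LSPSET U \<Sigma>) (WHDTS U \<Sigma>) T"
      "extends_labelled_cubes U \<Sigma> T"
    and T': "is_functor (LSPSET U \<Sigma>) (WHDTS U \<Sigma>) T'" "preserves_colimits U (LSPSET U \<Sigma>) (WHDTS U \<Sigma>) T'"
      "extends_labelled_cubes U \<Sigma> T'"
  shows "naturally_isomorphic (LSPSET U \<Sigma>) (WHDTS U \<Sigma>) T T'"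
proof (rule naturally_isomorphic_if_agree_on_dense[OF is_category_LSPSET is_category_WHDTS T(1) T'(1),
      where J = cells_category and D = labelled_cube_diagram and l = cell_inclusion])
  fix X assume "X \<in> Ob (LSPSET U \<Sigma>)"
  then have X: "is_lspset U \<Sigma> X" by (simp add: Ob_LSPSET)
  note J = is_category_cells_category[OF X] and small = cells_category_small[OF U X]
  note D = is_functor_labelled_cube_diagram[OF U X] and dense = labelled_cubes_dense[OF U X]
  show "is_category (cells_category X)" by (rule J)
  show "is_functor (cells_category X) (LSPSET U \<Sigma>) (labelled_cube_diagram X)" by (rule D)
  show "is_cocone (cells_category X) (LSPSET U \<Sigma>) (labelled_cube_diagram X) X (cell_inclusion X)"
    by (rule colimit_cocone[OF dense])
  show "is_colimit (cells_category X) (WHDTS U \<Sigma>) (fctr_comp T (labelled_cube_diagram X)) (FOb T X)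
      (\<lambda>i. FArr T (cell_inclusion X i))"
    using T(2) J small D dense unfolding preserves_colimits_def by blast
  show "is_colimit (cells_category X) (WHDTS U \<Sigma>) (fctr_comp T' (labelled_cube_diagram X)) (FOb T' X)
      (\<lambda>i. FArr T' (cell_inclusion X i))"
    using T'(2) J small D dense unfolding preserves_colimits_def by blast
  show "FOb T (FOb (labelled_cube_diagram X) i) = FOb T' (FOb (labelled_cube_diagram X) i)"
    if "i \<in> Ob (cells_category X)" for i
  proof -
    obtain n x where x: "x \<in> Cells (fst X) n" "i = Indexed x n" using \<open>i \<in> _\<close> unfolding Ob_cells_category by blast
    show ?thesis
      using T(3) T'(3) set_label[OF X x(1)]
      by (simp add: x(2) FOb_labelled_cube_diagram extends_labelled_cubes_def)
  qed
  show "FArr T (FArr (labelled_cube_diagram X) w) = FArr T' (FArr (labelled_cube_diagram X) w)"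
    if w: "w \<in> Hom (cells_category X) i j" for i j w
  proof -
    obtain m n f y where y: "y \<in> Cells (fst X) n" and f: "cube_map m n f"
      and w_eq: "i = Indexed (Act (fst X) m n f y) m" "j = Indexed y n" "w = cell_arrow X m n f y"
      using w unfolding Hom_cells_category by blast
    have "set (label X m (Act (fst X) m n f y)) \<subseteq> \<Sigma>"
      using set_label[OF X] spsetD(2)[of U "fst X", OF _ f y] X by (simp add: is_lspset_def)
    then show ?thesis
      using functor_Hom[OF D w] T(3) T'(3) set_label[OF X y]
      unfolding w_eq FArr_labelled_cube_diagram FOb_labelled_cube_diagram extends_labelled_cubes_def
      by simp
  qed
qed (rule cell_inclusion_natural)

theorem theorem9p2:
  fixes U :: "'x elem set set" and \<Sigma> :: "'x elem set"
  assumes "universe U" and "\<Sigma> \<in> U" and "\<Sigma> \<noteq> {}"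
  shows "\<exists>T.
    is_functor (LSPSET U \<Sigma>) (WHDTS U \<Sigma>) T \<and>
    preserves_colimits U (LSPSET U \<Sigma>) (WHDTS U \<Sigma>) T \<and>
    extends_labelled_cubes U \<Sigma> T \<and>
    (\<forall>T'. is_functor (LSPSET U \<Sigma>) (WHDTS U \<Sigma>) T' \<and>
          preserves_colimits U (LSPSET U \<Sigma>) (WHDTS U \<Sigma>) T' \<and>
          extends_labelled_cubes U \<Sigma> T' \<longrightarrow>
          naturally_isomorphic (LSPSET U \<Sigma>) (WHDTS U \<Sigma>) T T') \<and>
    is_left_adjoint (LSPSET U \<Sigma>) (WHDTS U \<Sigma>) T"
proof -
  let ?C = "LSPSET U \<Sigma>" and ?E = "WHDTS U \<Sigma>" and ?N = "nerve_functor \<Sigma>"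
  note U = assms(1) and \<Sigma> = assms(2)
  \<comment> \<open>On a labelled cube the prescribed value is chosen, so that the extension is literal.\<close>
  have "\<exists>p. universal_arrow ?C ?E ?N X (fst p) (snd p) \<and>
      (\<forall>a. set a \<subseteq> \<Sigma> \<longrightarrow> X = labelled_cube a \<longrightarrow> p = (cube_whdts a, cube_unit_arrow \<Sigma> a))"
    if X: "X \<in> Ob ?C" for X
  proof (cases "\<exists>a. set a \<subseteq> \<Sigma> \<and> X = labelled_cube a")
    case True
    then obtain a where a: "set a \<subseteq> \<Sigma>" "X = labelled_cube a" by blast
    show ?thesis
      using universal_arrow_labelled_cube[OF U \<Sigma> a(1)] a labelled_cube_inject
      by (intro exI[of _ "(cube_whdts a, cube_unit_arrow \<Sigma> a)"]) auto
  next
    case False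
    obtain L \<eta> where "universal_arrow ?C ?E ?N X L \<eta>"
      using ex_universal_arrow_nerve[OF U \<Sigma>] X unfolding Ob_LSPSET by blast
    then show ?thesis using False by (intro exI[of _ "(L, \<eta>)"]) auto
  qed
  then obtain p where p: "universal_arrow ?C ?E ?N X (fst (p X)) (snd (p X))"
    and p_cube: "set a \<subseteq> \<Sigma> \<Longrightarrow> X = labelled_cube a \<Longrightarrow> p X = (cube_whdts a, cube_unit_arrow \<Sigma> a)"
    if "X \<in> Ob ?C" for X a
    by metis
  interpret universal_arrows ?C ?E ?N "\<lambda>X. fst (p X)" "\<lambda>X. snd (p X)"
    by unfold_locales (simp_all add: is_category_LSPSET is_category_WHDTS is_functor_nerve[OF U \<Sigma>] p)
  have cube: "p (labelled_cube a) = (cube_whdts a, cube_unit_arrow \<Sigma> a)" if "set a \<subseteq> \<Sigma>" for a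
    using p_cube[of "labelled_cube a" a] is_lspset_labelled_cube[OF U that] that by (simp add: Ob_LSPSET)
  have extends: "extends_labelled_cubes U \<Sigma> left_adjoint"
    unfolding extends_labelled_cubes_def FOb_left_adjoint
  proof (intro conjI allI impI)
    show "fst (p (labelled_cube a)) = cube_whdts a" if "set a \<subseteq> \<Sigma>" for a using cube[OF that] by simp
    fix a b \<phi> assume *: "set a \<subseteq> \<Sigma> \<and> set b \<subseteq> \<Sigma> \<and>
      (labelled_cube a, \<phi>, labelled_cube b) \<in> Hom ?C (labelled_cube a) (labelled_cube b)"
    then show "FArr left_adjoint (labelled_cube a, \<phi>, labelled_cube b)
        = cube_whdts_map a b (underlying_cube_map (length a) \<phi>)"
      using cube_unit_natural[OF U, of a \<Sigma> b \<phi>]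
      by (intro FArr_left_adjoint_eqI[of _ "labelled_cube a" "labelled_cube b"]) (simp_all add: cube)
  qed
  have preserves: "preserves_colimits U ?C ?E left_adjoint"
    by (rule left_adjoint_preserves_colimits[OF is_category_LSPSET is_category_WHDTS is_left_adjoint_left_adjoint])
  show ?thesis
    using is_functor_left_adjoint preserves extends is_left_adjoint_left_adjoint
      extension_unique[OF U is_functor_left_adjoint preserves extends] by blast
qed

end
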